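(* Let $\gamma=(\gamma_s)_{s=1}^\infty$ satisfy $0<\gamma_s\le 1/32$ for all $s\in\mathbb N$ and $\sum_{s=1}^\infty\gamma_s<\infty$. Let $K(\gamma)\subset[0,1]$ be the associated Cantor-type set, $\delta_k=\gamma_1\gamma_2\cdots\gamma_k$ and $B_k=2^{-k-1}\log\frac1{\delta_k}$. Then $K(\gamma)$ has the extension property if and only if $$\frac{B_{n+s}}{\sum_{k=s}^{n+s}B_k}\to 0\quad\text{as } n\to\infty,\ \text{uniformly with respect to } s\in\mathbb N .$$
   Context: Construction of $K(\gamma)$: put $r_0=1$, $r_s=\gamma_s r_{s-1}^2$ for $s\ge1$, $P_2(x)=x(x-1)$, $P_{2^{s+1}}=P_{2^s}(P_{2^s}+r_s)$ for $s\ge 1$, $E_s=\{x\in\mathbb R: P_{2^{s+1}}(x)\le 0\}$ for $s\ge0$ (so $E_0=[0,1]$). The sets $E_s$ are decreasing, each being a union of $2^s$ disjoint closed intervals, and $K(\gamma)=\bigcap_{s\ge0}E_s$. Extension property: for a perfect compact set $K\subset\mathbb R$, $\mathcal E(K)$ is the Fréchet space of Whitney functions on $K$, i.e. of traces $f=F|_K$ of functions $F\in C^\infty(\mathbb R)$ (since $K$ is perfect, $f$ determines the derivatives $f^{(k)}=F^{(k)}|_K$), with the topology given by the norms $$\|f\|_q=|f|_{q,K}+\sup\Big\{\frac{|(R_y^qf)^{(k)}(x)|}{|x-y|^{q-k}}:x,y\in K,\ x\ne y,\ k=0,\dots,q\Big\},\quad q=0,1,2,\dots,$$ where $|f|_{q,K}=\sup\{|f^{(k)}(x)|:x\in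 K,k\le q\}$ and $R_y^qf=f-T_y^qf$ is the Taylor remainder. $K$ has the extension property if there is a continuous linear operator $W:\mathcal E(K)\to C^\infty(\mathbb R)$ with $W(f)|_K=f$ for all $f\in\mathcal E(K)$. $\log$ is the natural logarithm. *)

theory Defs
  imports "HOL-Analysis.Analysis"
begin

fun cantor_r :: "(nat \<Rightarrow> real) \<Rightarrow> nat \<Rightarrow> real" where
  "cantor_r \<gamma> 0 = 1"
| "cantor_r \<gamma> (Suc s) = \<gamma> (Suc s) * (cantor_r \<gamma> s)\<^sup>2"

(* cantor_P \<gamma> s is the polynomial of degree 2^(s+1), so that cantor_P \<gamma> 0 is P_2 and
   the recursion P_{2^{s+1}} = P_{2^s} (P_{2^s} + r_s) is shifted by one. *)
fun cantor_P :: "(nat \<Rightarrow> real) \<Rightarrow> nat \<Rightarrow> real \<Rightarrow> real" where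
  "cantor_P \<gamma> 0 x = x * (x - 1)"
| "cantor_P \<gamma> (Suc s) x = cantor_P \<gamma> s x * (cantor_P \<gamma> s x + cantor_r \<gamma> (Suc s))"

definition cantor_E :: "(nat \<Rightarrow> real) \<Rightarrow> nat \<Rightarrow> real set" where
  "cantor_E \<gamma> s = {x. cantor_P \<gamma> s x \<le> 0}"

definition cantor_K :: "(nat \<Rightarrow> real) \<Rightarrow> real set" where
  "cantor_K \<gamma> = (\<Inter>s. cantor_E \<gamma> s)"

definition delta :: "(nat \<Rightarrow> real) \<Rightarrow> nat \<Rightarrow> real" where
  "delta \<gamma> k = (\<Prod>i=1..k. \<gamma> i)"

definition B :: "(nat \<Rightarrow> real) \<Rightarrow> nat \<Rightarrow> real" where
  "B \<gamma> k = ln (1 / delta \<gamma> k) / 2 ^ (k + 1)"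

(* The locally convex topology on a linear space V of functions given by the seminorms p q:
   the open seminorm balls form a subbasis. *)
definition seminorm_topology ::
    "(real \<Rightarrow> real) set \<Rightarrow> (nat \<Rightarrow> (real \<Rightarrow> real) \<Rightarrow> real) \<Rightarrow> (real \<Rightarrow> real) topology" where
  "seminorm_topology V p =
     topology_generated_by {{g \<in> V. p q (\<lambda>x. g x - f x) < e} | q f e. f \<in> V \<and> 0 < e}"

definition smooth_functions :: "(real \<Rightarrow> real) set" where
  "smooth_functions = {F. \<forall>k x. (deriv ^^ k) F field_differentiable (at x)}"

definition smooth_seminorm :: "nat \<Rightarrow> (real \<Rightarrow> real) \<Rightarrow> real" where
  "smooth_seminorm q F = Sup {\<bar>(deriv ^^ k) F x\<bar> | k x. k \<le> q \<and> \<bar>x\<bar> \<le> real q}"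

definition smooth_topology :: "(real \<Rightarrow> real) topology" where
  "smooth_topology = seminorm_topology smooth_functions smooth_seminorm"

(* The remaining definitions are meant for perfect compact K; on other sets the derivatives
   need not be determined by f, and Sup may be applied to an empty or unbounded set. *)

(* A function on K is represented by its extension by 0 to the real line, so that distinct
   elements are distinct functions on K and linear combinations are pointwise. *)
definition whitney_functions :: "real set \<Rightarrow> (real \<Rightarrow> real) set" where
  "whitney_functions K = {(\<lambda>x. if x \<in> K then F x else 0) | F. F \<in> smooth_functions}"

(* Depends only on the values of f on K. *)
definition whitney_deriv :: "real set \<Rightarrow> nat \<Rightarrow> (real \<Rightarrow> real) \<Rightarrow> real \<Rightarrow> real" where
  "whitney_deriv K k f x =
     (THE d. \<exists>F\<in>smooth_functions. (\<forall>t\<in>K. F t = f t) \<and> (deriv ^^ k) F x = d)"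

definition whitney_remainder ::
    "real set \<Rightarrow> nat \<Rightarrow> real \<Rightarrow> (real \<Rightarrow> real) \<Rightarrow> real \<Rightarrow> real" where
  "whitney_remainder K q y f x =
     f x - (\<Sum>j\<le>q. whitney_deriv K j f y / fact j * (x - y) ^ j)"

definition whitney_norm :: "real set \<Rightarrow> nat \<Rightarrow> (real \<Rightarrow> real) \<Rightarrow> real" where
  "whitney_norm K q f =
     Sup {\<bar>whitney_deriv K k f x\<bar> | k x. x \<in> K \<and> k \<le> q} +
     Sup {\<bar>whitney_deriv K k (whitney_remainder K q y f) x\<bar> / \<bar>x - y\<bar> ^ (q - k) | k x y.
            x \<in> K \<and> y \<in> K \<and> x \<noteq> y \<and> k \<le> q}"

definition whitney_topology :: "real set \<Rightarrow> (real \<Rightarrow> real) topology" where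
  "whitney_topology K = seminorm_topology (whitney_functions K) (whitney_norm K)"

definition extension_property :: "real set \<Rightarrow> bool" where
  "extension_property K \<longleftrightarrow>
     (\<exists>W :: (real \<Rightarrow> real) \<Rightarrow> (real \<Rightarrow> real).
        continuous_map (whitney_topology K) smooth_topology W \<and>
        (\<forall>f\<in>whitney_functions K. \<forall>g\<in>whitney_functions K. \<forall>a b.
           W (\<lambda>x. a * f x + b * g x) = (\<lambda>x. a * W f x + b * W g x)) \<and>
        (\<forall>f\<in>whitney_functions K. \<forall>x\<in>K. W f x = f x))"

end

theory Submission
  imports Defs
begin

text \<open>Put \<open>u\<^sub>0 = x\<close> and \<open>u\<^sub>k\<^sub>+\<^sub>1 = u\<^sub>k (1 - u\<^sub>k) / \<gamma>\<^sub>k\<^sub>+\<^sub>1\<close>. Then \<open>- P\<^sub>k\<close> is a positive multiple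
    of \<open>u\<^sub>k\<^sub>+\<^sub>1\<close>, so \<open>K(\<gamma>)\<close>
  consists of the points whose orbit stays in \<open>[0,1]\<close>. The inverse branches code a dense set of
      points
  \<open>v j\<close> of \<open>K(\<gamma>)\<close> by the binary digits of \<open>j\<close>, lowest digit first: the distance of \<open>v i\<close> and \<open>v j\<close>
      is
  comparable with \<open>\<delta>\<^sub>k\<close> up to the constant \<open>C\<close> if \<open>2\<^sup>k\<close> is the largest power of 2 dividing \<open>i - j\<close>.
  This is all the geometry that is used.

  For points of \<open>K\<close> that are equidistributed over the residue classes, the distances from a given
  point, in increasing order, match the diameters that remain when the extreme points are removed
  one at a time. Hence a Newton term \<open>[x\<^sub>0,\<dots>,x\<^sub>N]f \<Prod> (x - x\<^sub>i)\<close> is at most the Whitney norm of order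
  \<open>2\<^sup>m\<close> times the product of the \<open>2\<^sup>m\<close> smallest distances, whose logarithm at level \<open>t\<close> is about
  \<open>- 2\<^sup>t (B\<^sub>t\<^sub>-\<^sub>m + \<dots> + B\<^sub>t)\<close>, while \<open>ln \<delta>\<^sub>t = - 2\<^sup>t\<^sup>+\<^sup>1 B\<^sub>t\<close>.

  If the condition holds, this beats every power of \<open>\<delta>\<^sub>t\<close> once \<open>m\<close> is large, and gluing local
      Lagrange
  interpolants of slowly growing degree by bumps of width \<open>\<delta>\<^sub>t\<close> gives an extension operator.
  Conversely, an extension operator and interpolation between derivatives give
  \<open>|f\<^sup>(\<^sup>q\<^sup>)| \<le> const (h\<^sup>-\<^sup>q \<parallel>f\<parallel>\<^sub>p + h\<^sup>Q\<^sup>-\<^sup>q \<parallel>f\<parallel>\<^sub>R)\<close> with \<open>p\<close> independent of \<open>q\<close> and \<open>Q\<close>. If the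
      condition fails,
  nodal polynomials of a fixed degree on small pieces of \<open>K\<close> violate this.\<close>

section \<open>Smooth functions\<close>

text \<open>The number of nodes is squeezed from two sides. It must be unbounded, since derivatives
  of order \<open>p\<close> require the \<open>2 ^ m\<close> nearest nodes with \<open>m\<close>
  depending on \<open>p\<close>; but every elimination step costs a factor \<open>16 * C\<close>,
  and these factors stay below a fixed power of \<open>1 / \<delta> t\<close> only for O(s) nodes,
  as \<open>\<delta> t\<close> is at most 32^-s. Hence \<open>lev s = s + blen s\<close>, with
  \<open>2 ^ blen s\<close> nodes per interpolant. Consecutive node sets are joined by inserting
  single nodes, and equidistribution has to survive at every intermediate set; this dictates the
  chain in \<open>interp_deriv_increment\<close>. Summability of \<open>\<gamma>\<close> makes
  \<open>C\<close> independent of the level: the branches contract by \<open>\<gamma>\<close> up to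
  a factor \<open>1 + 8 * \<gamma>\<close>. For the converse, the q-th derivative of a nodal
  polynomial on a piece has the size of the product of all but the q nearest distances. Going from
  order \<open>p\<close> to \<open>2 * p\<close> drops \<open>p\<close> factors, all of size
  \<open>\<delta> t\<close> when \<open>p\<close> is a power of 2 and the level is tuned. With
  \<open>h\<close> the fourth root of \<open>\<delta> t\<close>, division by
  \<open>h ^ (2 * p)\<close> gives back only half of this gain.\<close>

definition hderiv :: "nat \<Rightarrow> (real \<Rightarrow> real) \<Rightarrow> real \<Rightarrow> real" where
  "hderiv k F = (deriv ^^ k) F"

lemma hderiv_0 [simp]: "hderiv 0 F = F"
  by (simp add: hderiv_def)

lemma hderiv_Suc: "hderiv (Suc k) F = deriv (hderiv k F)"
  by (simp add: hderiv_def)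

text \<open>The whole family of candidate derivatives is guessed at once, so that smoothness and the
  formula for every higher derivative follow from a single first-order check. The closure lemmas
  below each supply such a family \<open>D\<close>.\<close>

lemma smoothI:
  assumes "\<And>k x. (D k has_real_derivative D (Suc k) x) (at x)"
  shows "D 0 \<in> smooth_functions" and "hderiv k (D 0) = D k"
proof -
  have eq: "hderiv k (D 0) = D k" for k
  proof (induction k)
    case (Suc k)
    have "deriv (D k) = D (Suc k)"
      using assms DERIV_imp_deriv by blast
    with Suc show ?case by (simp add: hderiv_Suc)
  qed simp
  show "hderiv k (D 0) = D k" by (rule eq)
  show "D 0 \<in> smooth_functions"
    unfolding smooth_functions_def mem_Collect_eq
    by (metis assms eq field_differentiable_def hderiv_def)
qed

lemma smooth_hderiv:
  assumes "F \<in> smooth_functions"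
  shows "(hderiv k F has_real_derivative hderiv (Suc k) F x) (at x)"
  using assms unfolding smooth_functions_def hderiv_Suc
  by (simp add: hderiv_def DERIV_deriv_iff_field_differentiable)

lemma smooth_continuous_on:
  assumes "F \<in> smooth_functions"
  shows "continuous_on S (hderiv k F)"
  by (meson DERIV_isCont assms continuous_at_imp_continuous_on smooth_hderiv)

lemma smooth_zero: "(\<lambda>x. 0) \<in> smooth_functions" "hderiv k (\<lambda>x. 0) = (\<lambda>x. 0)"
  using smoothI[of "\<lambda>k x. 0"] by auto

lemma smooth_const:
  "(\<lambda>x. c) \<in> smooth_functions" "hderiv k (\<lambda>x. c) = (if k = 0 then (\<lambda>x. c) else (\<lambda>x. 0))"
  using smoothI[of "\<lambda>k x. if k = 0 then c else 0"] by auto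

lemma smooth_lincomb:
  assumes "F \<in> smooth_functions" "G \<in> smooth_functions"
  shows "(\<lambda>x. a * F x + b * G x) \<in> smooth_functions"
    and "hderiv k (\<lambda>x. a * F x + b * G x) = (\<lambda>x. a * hderiv k F x + b * hderiv k G x)"
proof -
  let ?D = "\<lambda>k x. a * hderiv k F x + b * hderiv k G x"
  have "(?D k has_real_derivative ?D (Suc k) x) (at x)" for k x
    by (intro derivative_intros DERIV_cmult smooth_hderiv assms)
  from smoothI[of ?D, OF this]
  show "(\<lambda>x. a * F x + b * G x) \<in> smooth_functions"
    and "hderiv k (\<lambda>x. a * F x + b * G x) = (\<lambda>x. a * hderiv k F x + b * hderiv k G x)"
    by simp_all
qed

lemma smooth_add:
  assumes "F \<in> smooth_functions" "G \<in> smooth_functions"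
  shows "(\<lambda>x. F x + G x) \<in> smooth_functions"
    and "hderiv k (\<lambda>x. F x + G x) = (\<lambda>x. hderiv k F x + hderiv k G x)"
  using smooth_lincomb(1)[OF assms, of 1 1] smooth_lincomb(2)[OF assms, of k 1 1] by simp_all

lemma smooth_diff:
  assumes "F \<in> smooth_functions" "G \<in> smooth_functions"
  shows "(\<lambda>x. F x - G x) \<in> smooth_functions"
    and "hderiv k (\<lambda>x. F x - G x) = (\<lambda>x. hderiv k F x - hderiv k G x)"
  using smooth_lincomb(1)[OF assms, of 1 "-1"] smooth_lincomb(2)[OF assms, of k 1 "-1"] by simp_all

lemma smooth_sum:
  assumes "\<And>i. i \<in> I \<Longrightarrow> F i \<in> smooth_functions"
  shows "(\<lambda>x. \<Sum>i\<in>I. F i x) \<in> smooth_functions"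
    and "hderiv k (\<lambda>x. \<Sum>i\<in>I. F i x) = (\<lambda>x. \<Sum>i\<in>I. hderiv k (F i) x)"
proof -
  have "((\<lambda>x. \<Sum>i\<in>I. hderiv k (F i) x) has_real_derivative (\<Sum>i\<in>I. hderiv (Suc k) (F i) x)) (at x)"
    for k x
    using smooth_hderiv[OF assms] by (intro DERIV_sum)
  from smoothI[of "\<lambda>k x. \<Sum>i\<in>I. hderiv k (F i) x", OF this]
  show "(\<lambda>x. \<Sum>i\<in>I. F i x) \<in> smooth_functions"
    and "hderiv k (\<lambda>x. \<Sum>i\<in>I. F i x) = (\<lambda>x. \<Sum>i\<in>I. hderiv k (F i) x)"
    by simp_all
qed

lemma smooth_mult:
  assumes "F \<in> smooth_functions" "G \<in> smooth_functions"
  shows "(\<lambda>x. F x * G x) \<in> smooth_functions"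
    and "hderiv k (\<lambda>x. F x * G x) =
      (\<lambda>x. \<Sum>i\<le>k. real (k choose i) * (hderiv i F x * hderiv (k - i) G x))"
proof -
  let ?D = "\<lambda>k x. \<Sum>i\<le>k. real (k choose i) * (hderiv i F x * hderiv (k - i) G x)"
  have "(?D k has_real_derivative ?D (Suc k) x) (at x)" for k x
  proof -
    let ?h = "\<lambda>i j. hderiv i F x * hderiv j G x"
    have "(?D k has_real_derivative
        (\<Sum>i\<le>k. real (k choose i) * (?h (Suc i) (k - i) + ?h i (Suc (k - i))))) (at x)"
      apply (intro DERIV_sum DERIV_cmult)
      subgoal for i
        using DERIV_mult[OF smooth_hderiv[OF assms(1), of i x] smooth_hderiv[OF assms(2), of "k -
            i" x]]
        by (simp add: algebra_simps)
      done
    also have "(\<Sum>i\<le>k. real (k choose i) * (?h (Suc i) (k - i) + ?h i (Suc (k - i)))) =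
        (\<Sum>i\<le>k. real (k choose i) * ?h (Suc i) (k - i)) +
        (\<Sum>i\<le>k. real (k choose i) * ?h i (Suc k - i))"
      by (simp add: distrib_left sum.distrib Suc_diff_le)
    also have "(\<Sum>i\<le>k. real (k choose i) * ?h i (Suc k - i)) =
        (\<Sum>i\<le>Suc k. real (k choose i) * ?h i (Suc k - i))"
      by simp
    also have "\<dots> = ?h 0 (Suc k) + (\<Sum>i\<le>k. real (k choose Suc i) * ?h (Suc i) (k - i))"
      by (subst sum.atMost_Suc_shift) simp
    also have "(\<Sum>i\<le>k. real (k choose i) * ?h (Suc i) (k - i)) +
        (?h 0 (Suc k) + (\<Sum>i\<le>k. real (k choose Suc i) * ?h (Suc i) (k - i))) =
        ?h 0 (Suc k) + (\<Sum>i\<le>k. real (Suc k choose Suc i) * ?h (Suc i) (k - i))"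
      by (simp add: sum.distrib algebra_simps)
    also have "\<dots> = ?D (Suc k) x"
      by (rule sym, subst sum.atMost_Suc_shift) simp
    finally show ?thesis .
  qed
  from smoothI[of ?D, OF this]
  show "(\<lambda>x. F x * G x) \<in> smooth_functions" and "hderiv k (\<lambda>x. F x * G x) = ?D k"
    by simp_all
qed

lemma smooth_affine:
  assumes "F \<in> smooth_functions"
  shows "(\<lambda>x. F (a * x + b)) \<in> smooth_functions"
    and "hderiv k (\<lambda>x. F (a * x + b)) = (\<lambda>x. a ^ k * hderiv k F (a * x + b))"
proof -
  let ?D = "\<lambda>k x. a ^ k * hderiv k F (a * x + b)"
  have "(?D k has_real_derivative ?D (Suc k) x) (at x)" for k x
  proof -
    have "((\<lambda>x. hderiv k F (a * x + b)) has_real_derivative hderiv (Suc k) F (a * x + b) * a) (at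
        x)"
      by (rule DERIV_chain2[OF smooth_hderiv[OF assms]]) (auto intro!: derivative_eq_intros)
    from DERIV_cmult[OF this, of "a ^ k"] show ?thesis
      by (simp add: algebra_simps)
  qed
  from smoothI[of ?D, OF this]
  show "(\<lambda>x. F (a * x + b)) \<in> smooth_functions" and "hderiv k (\<lambda>x. F (a * x + b)) = ?D k"
    by simp_all
qed

lemma smooth_poly: "poly p \<in> smooth_functions" "hderiv k (poly p) = poly ((pderiv ^^ k) p)"
  using smoothI[of "\<lambda>k. poly ((pderiv ^^ k) p)"] poly_DERIV by auto

text \<open>Termwise differentiation by the Weierstrass test. The bounds are global in
  \<open>x\<close>, which the layers of the extension satisfy because their bumps have bounded
  support.\<close>

lemma smooth_suminf:
  assumes F: "\<And>s. F s \<in> smooth_functions"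
    and bound: "\<And>k s x. \<bar>hderiv k (F s) x\<bar> \<le> b k s" and summ: "\<And>k. summable (b k)"
  shows "(\<lambda>x. \<Sum>s. F s x) \<in> smooth_functions"
    and "hderiv k (\<lambda>x. \<Sum>s. F s x) = (\<lambda>x. \<Sum>s. hderiv k (F s) x)"
proof -
  let ?D = "\<lambda>k x. \<Sum>s. hderiv k (F s) x"
  have "(?D k has_real_derivative ?D (Suc k) x) (at x)" for k x
  proof (rule has_field_derivative_series'(2)[of UNIV "\<lambda>s. hderiv k (F s)"
          "\<lambda>s. hderiv (Suc k) (F s)" 0 x])
    show "(hderiv k (F n) has_real_derivative hderiv (Suc k) (F n) x) (at x within UNIV)" for n x
      using smooth_hderiv[OF F] by simp
    show "uniformly_convergent_on UNIV (\<lambda>n x. \<Sum>i<n. hderiv (Suc k) (F i) x)"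
      by (rule Weierstrass_m_test'[OF _ summ[of "Suc k"]]) (use bound[of "Suc k"] in simp)
    show "summable (\<lambda>n. hderiv k (F n) 0)"
      by (rule summable_comparison_test'[OF summ[of k], of 0]) (use bound in simp)
  qed auto
  from smoothI[of ?D, OF this]
  show "(\<lambda>x. \<Sum>s. F s x) \<in> smooth_functions" and "hderiv k (\<lambda>x. \<Sum>s. F s x) = ?D k"
    by simp_all
qed

lemma hderiv_local:
  assumes "F \<in> smooth_functions" "G \<in> smooth_functions" "open S" "\<And>x. x \<in> S \<Longrightarrow> F x = G x"
    and "x \<in> S"
  shows "hderiv k F x = hderiv k G x"
  using assms(5)
proof (induction k arbitrary: x)
  case (Suc k)
  have "(hderiv k F has_real_derivative hderiv (Suc k) G x) (at x)"
    by (rule has_field_derivative_transform_within_open[OF smooth_hderiv[OF assms(2)] assms(3)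
        Suc.prems])
      (use Suc.IH in simp)
  with smooth_hderiv[OF assms(1)] show ?case by (rule DERIV_unique)
qed (use assms(4) in simp)

section \<open>Smooth steps and bumps\<close>

text \<open>The polynomial factor in 1/x makes the class closed under differentiation, so all
  derivatives at 0 are settled by the single limit \<open>flat_exp_tendsto\<close>.\<close>

definition flat_exp :: "real poly \<Rightarrow> real \<Rightarrow> real" where
  "flat_exp p x = (if x > 0 then poly p (1 / x) * exp (- (1 / x)) else 0)"

lemma poly_times_exp_neg_tendsto: "((\<lambda>y. poly p y * exp (- y)) \<longlongrightarrow> 0) at_top" for p :: "real poly"
proof -
  have "((\<lambda>y. \<Sum>i\<le>degree p. coeff p i * (y ^ i * exp (- y))) \<longlongrightarrow> (\<Sum>i\<le>degree p. coeff p i * 0)) at_top"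
  proof (intro tendsto_sum tendsto_mult tendsto_const)
    fix i :: nat
    show "((\<lambda>y::real. y ^ i * exp (- y)) \<longlongrightarrow> 0) at_top"
      using tendsto_power_div_exp_0[of i] by (simp add: exp_minus divide_inverse)
  qed
  then show ?thesis
    by (simp add: poly_altdef sum_distrib_right mult.assoc)
qed

lemma flat_exp_tendsto: "(flat_exp p \<longlongrightarrow> 0) (at 0)"
proof (rule filterlim_split_at)
  have "((\<lambda>x. poly p (inverse x) * exp (- inverse x)) \<longlongrightarrow> 0) (at_right 0)"
    by (rule filterlim_compose[OF poly_times_exp_neg_tendsto filterlim_inverse_at_top_right])
  then show "(flat_exp p \<longlongrightarrow> 0) (at_right 0)"
    by (rule Lim_transform_eventually)
      (auto simp: eventually_at_right_field flat_exp_def divide_inverse intro!: exI[of _ 1])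
  show "(flat_exp p \<longlongrightarrow> 0) (at_left 0)"
    by (rule Lim_transform_eventually[OF tendsto_const])
      (auto simp: eventually_at_left_field flat_exp_def intro!: exI[of _ "-1"])
qed

lemma flat_exp_deriv:
  "(flat_exp p has_real_derivative flat_exp ([:0, 0, 1:] * (p - pderiv p)) x) (at x)"
proof -
  consider "x > 0" | "x < 0" | "x = 0" by linarith
  then show ?thesis
  proof cases
    case 1
    have "((\<lambda>x. poly p (1 / x) * exp (- (1 / x))) has_real_derivative
        flat_exp ([:0, 0, 1:] * (p - pderiv p)) x) (at x)"
      using 1 by (auto intro!: derivative_eq_intros DERIV_chain2[OF poly_DERIV]
          simp: flat_exp_def field_simps power2_eq_square)
    then show ?thesis
      by (rule has_field_derivative_transform_within_open[of _ _ _ "{0<..}"])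
        (use 1 in \<open>auto simp: flat_exp_def\<close>)
  next
    case 2
    have "((\<lambda>x. 0) has_real_derivative flat_exp ([:0, 0, 1:] * (p - pderiv p)) x) (at x)"
      using 2 by (simp add: flat_exp_def)
    then show ?thesis
      by (rule has_field_derivative_transform_within_open[of _ _ _ "{..<0}"])
        (use 2 in \<open>auto simp: flat_exp_def\<close>)
  next
    case 3
    \<comment> \<open>Dividing by \<open>h\<close> multiplies the polynomial in 1/h by its variable,
      so the difference quotient at 0 is again a \<open>flat_exp\<close>.\<close>
    have "(\<lambda>h. (flat_exp p (0 + h) - flat_exp p 0) / h) = flat_exp ([:0, 1:] * p)"
      by (auto simp: fun_eq_iff flat_exp_def)
    then show ?thesis
      using flat_exp_tendsto[of "[:0, 1:] * p"] 3 by (simp add: DERIV_def flat_exp_def)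
  qed
qed

lemma smooth_flat_exp: "flat_exp p \<in> smooth_functions"
proof -
  let ?N = "\<lambda>p :: real poly. [:0, 0, 1:] * (p - pderiv p)"
  show ?thesis
    using smoothI(1)[of "\<lambda>k. flat_exp ((?N ^^ k) p)"] flat_exp_deriv by simp
qed

definition bump_integrand :: "real \<Rightarrow> real" where
  "bump_integrand x = flat_exp 1 x * flat_exp 1 (-1 * x + 1)"

lemma smooth_bump_integrand: "bump_integrand \<in> smooth_functions"
  using smooth_mult(1)[OF smooth_flat_exp[of 1] smooth_affine(1)[OF smooth_flat_exp[of 1], of "-1"
      1]]
  by (simp add: bump_integrand_def[abs_def])

lemma bump_integrand_pos: "0 < x \<Longrightarrow> x < 1 \<Longrightarrow> bump_integrand x > 0"
  by (simp add: bump_integrand_def flat_exp_def)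

lemma bump_integrand_zero: "x \<le> 0 \<or> x \<ge> 1 \<Longrightarrow> bump_integrand x = 0"
  by (auto simp: bump_integrand_def flat_exp_def)

lemma smooth_antideriv:
  assumes "g \<in> smooth_functions"
  shows "\<exists>G \<in> smooth_functions. deriv G = g"
proof -
  \<comment> \<open>The base point lies to the left of both \<open>x\<close> and 0, because the
    integral over an interval with reversed end points is 0. Subtracting the part up to 0 makes the
    value independent of the base point.\<close>
  define G where "G x = integral {-1 - \<bar>x\<bar>..x} g - integral {-1 - \<bar>x\<bar>..0} g" for x :: real
  have cont: "continuous_on S g" for S
    using smooth_continuous_on[OF assms, of S 0] by simp
  have int: "g integrable_on {a..b}" for a b :: real
    by (rule integrable_continuous_real[OF cont])
  have G_eq: "G x = integral {a..x} g - integral {a..0} g" if "a \<le> x" "a \<le> 0" for a x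
  proof -
    define c where "c = min a (-1 - \<bar>x\<bar>)"
    have *: "integral {c..y} g = integral {c..d} g + integral {d..y} g" if "c \<le> d" "d \<le> y" for d y
      using Henstock_Kurzweil_Integration.integral_combine[OF that int] by simp
    have "-1 - \<bar>x\<bar> \<le> x" "-1 - \<bar>x\<bar> \<le> 0" by linarith+
    moreover have "c \<le> a" "c \<le> -1 - \<bar>x\<bar>"
      by (simp_all add: c_def)
    ultimately show ?thesis
      unfolding G_def using *[of a x] *[of a 0] *[of "-1 - \<bar>x\<bar>" x] *[of "-1 - \<bar>x\<bar>" 0] that
      by linarith
  qed
  have "(G has_real_derivative g x) (at x)" for x
  proof -
    define a where "a = - 1 - \<bar>x\<bar>"
    have "((\<lambda>u. integral {a..u} g) has_real_derivative g x) (at x within {a..x + 1})"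
      by (rule integral_has_real_derivative[OF cont]) (auto simp: a_def)
    moreover have "at x within {a..x + 1} = at x"
      by (rule at_within_Icc_at) (auto simp: a_def)
    ultimately have "((\<lambda>u. integral {a..u} g - integral {a..0} g) has_real_derivative g x) (at x)"
      by (auto intro!: derivative_eq_intros)
    then show ?thesis
      by (rule has_field_derivative_transform_within_open[of _ _ _ "{a<..}"])
        (auto simp: a_def intro!: G_eq[symmetric])
  qed
  note DG = this
  define D where "D k = (case k of 0 \<Rightarrow> G | Suc j \<Rightarrow> hderiv j g)" for k
  have "(D k has_real_derivative D (Suc k) x) (at x)" for k x
    using DG smooth_hderiv[OF assms] by (cases k) (auto simp: D_def)
  from smoothI[of D, OF this] DG show ?thesis
    by (auto simp: D_def intro!: bexI[of _ G] DERIV_imp_deriv)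
qed

lemma smooth_step_exists:
  "\<exists>X \<in> smooth_functions. (\<forall>x\<le>0. X x = 0) \<and> (\<forall>x\<ge>1. X x = 1)"
proof -
  obtain G where G: "G \<in> smooth_functions" "deriv G = bump_integrand"
    using smooth_antideriv[OF smooth_bump_integrand] by blast
  have DG: "(G has_real_derivative bump_integrand x) (at x)" for x
    using smooth_hderiv[OF G(1), of 0] G(2) by (simp add: hderiv_Suc)
  have left: "G x = G 0" if "x \<le> 0" for x
  proof (cases "x < 0")
    case True
    then show ?thesis
      using MVT2[of x 0 G bump_integrand] DG bump_integrand_zero by fastforce
  qed (use that in simp)
  have right: "G x = G 1" if "x \<ge> 1" for x
  proof (cases "x > 1")
    case True
    then show ?thesis
      using MVT2[of 1 x G bump_integrand] DG bump_integrand_zero by fastforce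
  qed (use that in simp)
  have pos: "G 1 - G 0 > 0"
    using MVT2[of 0 1 G bump_integrand] DG bump_integrand_pos by fastforce
  let ?X = "\<lambda>x. 1 / (G 1 - G 0) * G x + (- G 0 / (G 1 - G 0)) * poly 1 x"
  have "?X \<in> smooth_functions"
    by (rule smooth_lincomb[OF G(1) smooth_poly(1)])
  moreover have "?X x = 0" if "x \<le> 0" for x
    unfolding left[OF that] by simp
  moreover have "?X x = 1" if "x \<ge> 1" for x
    unfolding right[OF that] using pos by (simp flip: diff_divide_distrib)
  ultimately show ?thesis
    by (intro bexI[of _ ?X]) blast+
qed

definition smooth_step :: "real \<Rightarrow> real" where
  "smooth_step = (SOME X. X \<in> smooth_functions \<and> (\<forall>x\<le>0. X x = 0) \<and> (\<forall>x\<ge>1. X x = 1))"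

lemma smooth_step: "smooth_step \<in> smooth_functions"
  and smooth_step_0: "x \<le> 0 \<Longrightarrow> smooth_step x = 0"
  and smooth_step_1: "x \<ge> 1 \<Longrightarrow> smooth_step x = 1"
proof -
  have "smooth_step \<in> smooth_functions \<and> (\<forall>x\<le>0. smooth_step x = 0) \<and> (\<forall>x\<ge>1. smooth_step x = 1)"
    unfolding smooth_step_def
    using someI_ex[OF smooth_step_exists[unfolded Bex_def]] .
  then show "smooth_step \<in> smooth_functions" "x \<le> 0 \<Longrightarrow> smooth_step x = 0"
    "x \<ge> 1 \<Longrightarrow> smooth_step x = 1" by auto
qed

lemma hderiv_smooth_step_outside:
  assumes "k > 0" "x \<notin> {0..1}"
  shows "hderiv k smooth_step x = 0"
proof (cases "x < 0")
  case True
  have "hderiv k smooth_step x = hderiv k (\<lambda>x. 0) x"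
    by (rule hderiv_local[OF smooth_step smooth_const(1), of "{..<0}"])
      (use True smooth_step_0 in auto)
  with assms(1) show ?thesis by (simp add: smooth_const)
next
  case False
  have "hderiv k smooth_step x = hderiv k (\<lambda>x. 1) x"
    by (rule hderiv_local[OF smooth_step smooth_const(1), of "{1<..}"])
      (use False assms(2) smooth_step_1 in auto)
  with assms(1) show ?thesis by (simp add: smooth_const)
qed

text \<open>At scale R the piece of \<open>K\<close> sits in the unit ball, well inside the plateau
  of radius 2; near that piece, multiplication by the bump leaves all derivatives unchanged.\<close>

definition bump :: "real \<Rightarrow> real" where
  "bump x = smooth_step (1 * x + 3) * smooth_step (-1 * x + 3)"

lemma smooth_bump: "bump \<in> smooth_functions"
  using smooth_mult(1)[OF smooth_affine(1)[OF smooth_step, of 1 3] smooth_affine(1)[OF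
      smooth_step, of "-1" 3]]
  by (simp add: bump_def[abs_def])

lemma bump_1: "\<bar>x\<bar> \<le> 2 \<Longrightarrow> bump x = 1"
  by (simp add: bump_def smooth_step_1)

lemma bump_0: "\<bar>x\<bar> \<ge> 3 \<Longrightarrow> bump x = 0"
  by (cases "x \<ge> 0") (auto simp: bump_def smooth_step_0)

lemma hderiv_bump_0:
  assumes "\<bar>x\<bar> > 3"
  shows "hderiv k bump x = 0"
proof -
  have "hderiv k bump x = hderiv k (\<lambda>x. 0) x"
    by (rule hderiv_local[OF smooth_bump smooth_zero(1), of "- {-3..3}"])
      (use assms bump_0 in auto)
  then show ?thesis by (simp add: smooth_zero)
qed

lemma smooth_bounded_on_compact:
  assumes "F \<in> smooth_functions" "compact S"
  shows "\<exists>M\<ge>0. \<forall>k\<le>q. \<forall>x\<in>S. \<bar>hderiv k F x\<bar> \<le> M"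
proof -
  have "\<exists>M. \<forall>x\<in>S. \<bar>hderiv k F x\<bar> \<le> M" for k
  proof -
    have "bounded (hderiv k F ` S)"
      using compact_imp_bounded[OF compact_continuous_image[OF smooth_continuous_on[OF assms(1)]
          assms(2)]] .
    then show ?thesis by (simp add: bounded_iff)
  qed
  then obtain M where M: "\<And>k x. x \<in> S \<Longrightarrow> \<bar>hderiv k F x\<bar> \<le> M k" by metis
  have "\<bar>hderiv k F x\<bar> \<le> (\<Sum>k\<le>q. \<bar>M k\<bar>)" if "k \<le> q" "x \<in> S" for k x
  proof -
    have "\<bar>M k\<bar> \<le> (\<Sum>k\<le>q. \<bar>M k\<bar>)"
      by (rule member_le_sum) (use that in auto)
    with M[OF that(2), of k] show ?thesis by linarith
  qed
  then show ?thesis by (intro exI[of _ "\<Sum>k\<le>q. \<bar>M k\<bar>"]) (auto intro: sum_nonneg)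
qed

lemma bump_bounded: "\<exists>M\<ge>0. \<forall>k\<le>q. \<forall>x. \<bar>hderiv k bump x\<bar> \<le> M"
proof -
  obtain M where M: "M \<ge> 0" "\<forall>k\<le>q. \<forall>x\<in>{-3..3}. \<bar>hderiv k bump x\<bar> \<le> M"
    using smooth_bounded_on_compact[OF smooth_bump, of "{-3..3}" q] by auto
  have "\<bar>hderiv k bump x\<bar> \<le> M" if "k \<le> q" for k x
  proof (cases "\<bar>x\<bar> > 3")
    case False
    then have "x \<in> {-3..3}" by auto
    with M that show ?thesis by blast
  qed (use M(1) hderiv_bump_0 in simp)
  with M(1) show ?thesis by blast
qed

lemma smooth_step_bounded: "\<exists>M\<ge>0. \<forall>k\<le>q. \<forall>x. \<bar>hderiv k smooth_step x\<bar> \<le> M"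
proof -
  obtain M where M: "M \<ge> 0" "\<forall>k\<le>q. \<forall>x\<in>{0..1}. \<bar>hderiv k smooth_step x\<bar> \<le> M"
    using smooth_bounded_on_compact[OF smooth_step, of "{0..1}" q] by auto
  have "\<bar>hderiv k smooth_step x\<bar> \<le> max 1 M" if "k \<le> q" for k x
  proof (cases "x \<in> {0..1}")
    case True
    with M that show ?thesis by (meson max.coboundedI2)
  next
    case False
    then show ?thesis
      using hderiv_smooth_step_outside[of k x] smooth_step_0[of x] smooth_step_1[of x]
      by (cases "k = 0") auto
  qed
  with M(1) show ?thesis by (intro exI[of _ "max 1 M"]) auto
qed

section \<open>Divided differences and Lagrange interpolation\<close>

definition nodal_poly :: "real set \<Rightarrow> real poly" where
  "nodal_poly X = (\<Prod>y\<in>X. [:-y, 1:])"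

text \<open>Indexed by a set of nodes, so that symmetry is built in and any two nodes may be
  eliminated in \<open>divdiff_recursion\<close>.\<close>

definition divdiff :: "(real \<Rightarrow> real) \<Rightarrow> real set \<Rightarrow> real" where
  "divdiff f X = (\<Sum>x\<in>X. f x / (\<Prod>y\<in>X - {x}. x - y))"

definition lagrange :: "(real \<Rightarrow> real) \<Rightarrow> real set \<Rightarrow> real poly" where
  "lagrange f X = (\<Sum>x\<in>X. smult (f x) (smult (1 / (\<Prod>y\<in>X - {x}. x - y)) (nodal_poly (X - {x}))))"

lemma poly_nodal: "poly (nodal_poly X) x = (\<Prod>y\<in>X. x - y)"
  by (simp add: nodal_poly_def poly_prod)

lemma degree_nodal: "degree (nodal_poly X) = card X"
  unfolding nodal_poly_def by (subst degree_prod_eq_sum_degree) auto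

lemma lead_coeff_nodal: "coeff (nodal_poly X) (card X) = 1"
proof -
  have "lead_coeff (nodal_poly X) = 1"
    unfolding nodal_poly_def lead_coeff_prod by simp
  then show ?thesis by (simp add: degree_nodal)
qed

lemma poly_lagrange_node:
  assumes "finite X" "x \<in> X"
  shows "poly (lagrange f X) x = f x"
proof -
  have "poly (lagrange f X) x = (\<Sum>z\<in>X. if z = x then f x else 0)"
    unfolding lagrange_def poly_sum
  proof (rule sum.cong)
    fix z assume z: "z \<in> X"
    show "poly (smult (f z) (smult (1 / (\<Prod>y\<in>X - {z}. z - y)) (nodal_poly (X - {z})))) x =
        (if z = x then f x else 0)"
    proof (cases "z = x")
      case True
      have "(\<Prod>y\<in>X - {x}. x - y) \<noteq> 0"
        using assms by (subst prod_zero_iff) auto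
      with True show ?thesis by (simp add: poly_nodal)
    next
      case False
      have "(\<Prod>y\<in>X - {z}. x - y) = 0"
        using assms False by (subst prod_zero_iff) auto
      with False show ?thesis by (simp add: poly_nodal)
    qed
  qed simp
  with assms show ?thesis by simp
qed

lemma degree_lagrange: "degree (lagrange f X) \<le> card X - 1"
proof (cases "finite X")
  case True
  show ?thesis
    unfolding lagrange_def
    by (rule degree_sum_le[OF True])
      (use True in \<open>auto intro!: order_trans[OF degree_smult_le] simp: degree_nodal\<close>)
qed (simp add: lagrange_def)

lemma coeff_lagrange:
  assumes "finite X" "card X = Suc n"
  shows "coeff (lagrange f X) n = divdiff f X"
proof -
  have "coeff (nodal_poly (X - {x})) n = 1" if "x \<in> X" for x
    using lead_coeff_nodal[of "X - {x}"] assms that by simp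
  then show ?thesis
    by (simp add: lagrange_def divdiff_def coeff_sum)
qed

text \<open>Subtracting the multiple kills the coefficient at \<open>card X\<close>, and the rest
  would have at least \<open>card X\<close> zeros but smaller degree.\<close>

lemma poly_eq_smult_nodal:
  assumes "finite X" "degree p \<le> card X" "\<And>x. x \<in> X \<Longrightarrow> poly p x = 0"
  shows "p = smult (coeff p (card X)) (nodal_poly X)"
proof (rule ccontr)
  define q where "q = p - smult (coeff p (card X)) (nodal_poly X)"
  assume "p \<noteq> smult (coeff p (card X)) (nodal_poly X)"
  then have q: "q \<noteq> 0" by (simp add: q_def)
  have "X \<subseteq> {x. poly q x = 0}"
    using assms(1,3) by (auto simp: q_def poly_nodal)
  then have "card X \<le> card {x. poly q x = 0}"
    by (rule card_mono[OF poly_roots_finite[OF q]])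
  also have "\<dots> \<le> degree q" by (rule card_poly_roots_bound[OF q])
  finally have "card X \<le> degree q" .
  moreover have "degree q \<le> card X"
    unfolding q_def using assms(2) by (intro degree_diff_le) (auto simp: degree_nodal)
  ultimately have "lead_coeff q = 0"
    by (simp add: q_def lead_coeff_nodal)
  with q show False by simp
qed

text \<open>Newton's form of interpolation: the difference of the two interpolants vanishes on
  \<open>X\<close>, hence is a multiple of the nodal polynomial, and the factor is its leading
  coefficient.\<close>

lemma lagrange_insert:
  assumes "finite X" "b \<notin> X"
  shows "lagrange f (insert b X) = lagrange f X + smult (divdiff f (insert b X)) (nodal_poly X)"
proof (cases "X = {}")
  case True
  then show ?thesis by (simp add: lagrange_def divdiff_def nodal_poly_def)
next
  case False
  define p where "p = lagrange f (insert b X) - lagrange f X"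
  have card: "card (insert b X) = Suc (card X)" "card X > 0"
    using assms False by (auto simp: card_gt_0_iff)
  have "coeff (lagrange f X) (card X) = 0"
    using degree_lagrange[of f X] card by (intro coeff_eq_0) simp
  then have "coeff p (card X) = divdiff f (insert b X)"
    unfolding p_def using coeff_lagrange[OF _ card(1)] assms by simp
  moreover have "p = smult (coeff p (card X)) (nodal_poly X)"
  proof (rule poly_eq_smult_nodal[OF assms(1)])
    show "degree p \<le> card X"
      unfolding p_def using degree_lagrange[of f X] degree_lagrange[of f "insert b X"] card
      by (intro degree_diff_le) auto
    show "poly p x = 0" if "x \<in> X" for x
      using that assms poly_lagrange_node[of X x f] poly_lagrange_node[of "insert b X" x f]
      by (simp add: p_def)
  qed
  ultimately show ?thesis by (simp add: p_def algebra_simps)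
qed

lemma divdiff_cong: "(\<And>x. x \<in> X \<Longrightarrow> f x = g x) \<Longrightarrow> divdiff f X = divdiff g X"
  unfolding divdiff_def by (intro sum.cong) auto

text \<open>Removing a node \<open>c\<close> multiplies the weight of every node \<open>x\<close> by
  \<open>x - c\<close>, which is 0 for \<open>c\<close> itself. Subtracting the two versions leaves
  the constant \<open>b - a\<close> in front of every weight.\<close>

lemma divdiff_recursion:
  assumes "finite X" "a \<in> X" "b \<in> X" "a \<noteq> b"
  shows "divdiff f X = (divdiff f (X - {a}) - divdiff f (X - {b})) / (b - a)"
proof -
  let ?w = "\<lambda>x. f x / (\<Prod>y\<in>X - {x}. x - y)"
  have nz: "(\<Prod>y\<in>S. x - y) \<noteq> 0" if "S \<subseteq> X" "x \<notin> S" for x S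
    using that finite_subset[OF that(1) assms(1)] by auto
  have split: "(\<Prod>y\<in>X - {x}. x - y) = (x - c) * (\<Prod>y\<in>X - {c} - {x}. x - y)"
    if "c \<in> X" "c \<noteq> x" for c x
  proof -
    have eq: "X - {x} = insert c (X - {c} - {x})" using that by auto
    show ?thesis
      by (subst eq, subst prod.insert) (use assms(1) in auto)
  qed
  have part: "divdiff f (X - {c}) = (\<Sum>x\<in>X. (x - c) * ?w x)" if "c \<in> X" for c
  proof -
    have "divdiff f (X - {c}) = (\<Sum>x\<in>X - {c}. (x - c) * ?w x)"
      unfolding divdiff_def
    proof (rule sum.cong)
      fix x assume x: "x \<in> X - {c}"
      then have ne: "c \<noteq> x" by blast
      have cancel: "u / w = t * (u / (t * w))" if "t \<noteq> 0" for u t w :: real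
        using that by simp
      show "f x / (\<Prod>y\<in>X - {c} - {x}. x - y) = (x - c) * ?w x"
        unfolding split[OF that ne] by (rule cancel) (use ne in simp)
    qed simp
    also have "\<dots> = (\<Sum>x\<in>X. (x - c) * ?w x)"
      unfolding sum.remove[OF assms(1) that] by simp
    finally show ?thesis .
  qed
  have alg: "(x - a) * w - (x - b) * w = (b - a) * w" for x w :: real
    by (simp add: algebra_simps)
  have "divdiff f (X - {a}) - divdiff f (X - {b}) = (\<Sum>x\<in>X. (b - a) * ?w x)"
    unfolding part[OF assms(2)] part[OF assms(3)] sum_subtractf[symmetric]
    by (rule sum.cong) (simp_all only: alg)
  also have "\<dots> = (b - a) * divdiff f X"
    by (simp only: divdiff_def sum_distrib_left)
  finally show ?thesis
    using assms(4) by simp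
qed

text \<open>Eliminating a well separated pair at each step; only sets with more than \<open>r + 1\<close> points
  cost a factor.\<close>

lemma divdiff_elimination:
  fixes d :: "nat \<Rightarrow> real"
  assumes "finite X" "card X = Suc N" "r \<le> N" "A \<ge> 0"
    and base: "\<And>Y. Y \<subseteq> X \<Longrightarrow> card Y = Suc r \<Longrightarrow> \<bar>divdiff f Y\<bar> \<le> A"
    and sep: "\<And>Y i. Y \<subseteq> X \<Longrightarrow> card Y = Suc (Suc i) \<Longrightarrow> r \<le> i \<Longrightarrow>
      \<exists>a\<in>Y. \<exists>b\<in>Y. d i \<le> \<bar>a - b\<bar>"
    and dpos: "\<And>i. r \<le> i \<Longrightarrow> i < N \<Longrightarrow> d i > 0"
  shows "\<bar>divdiff f X\<bar> \<le> A * (\<Prod>i=r..<N. 2 / d i)"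
proof -
  have "\<bar>divdiff f Y\<bar> \<le> A * (\<Prod>i=r..<M. 2 / d i)"
    if "Y \<subseteq> X" "card Y = Suc M" "r \<le> M" for M Y
    using that(3,1,2)
  proof (induction M arbitrary: Y rule: dec_induct)
    case base
    then show ?case using assms(5)[of Y] by simp
  next
    case (step M)
    have finY: "finite Y" using step.prems assms(1) finite_subset by blast
    have "Suc (Suc M) \<le> Suc N"
      using card_mono[OF assms(1) step.prems(1)] step.prems(2) assms(2) by simp
    then have dM: "d M > 0" using dpos[of M] step.hyps by simp
    obtain a b where ab: "a \<in> Y" "b \<in> Y" "d M \<le> \<bar>a - b\<bar>"
      using sep[OF step.prems step.hyps(1)] by blast
    with dM have ne: "a \<noteq> b" by auto
    have prod_nonneg: "A * (\<Prod>i=r..<M. 2 / d i) \<ge> 0"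
      by (intro mult_nonneg_nonneg prod_nonneg assms(4)) (use dpos \<open>Suc (Suc M) \<le> Suc N\<close> in \<open>auto
          intro!: less_imp_le\<close>)
    have IH: "\<bar>divdiff f (Y - {c})\<bar> \<le> A * (\<Prod>i=r..<M. 2 / d i)" if "c \<in> Y" for c
      using step.IH[of "Y - {c}"] that step.prems finY by auto
    have "\<bar>divdiff f Y\<bar> = \<bar>divdiff f (Y - {a}) - divdiff f (Y - {b})\<bar> / \<bar>a - b\<bar>"
      using divdiff_recursion[OF finY ab(1,2) ne, of f] by (simp add: abs_minus_commute)
    also have "\<dots> \<le> (2 * (A * (\<Prod>i=r..<M. 2 / d i))) / d M"
      by (rule frac_le) (use IH[OF ab(1)] IH[OF ab(2)] ab(3) dM prod_nonneg in auto)
    also have "\<dots> = A * (\<Prod>i=r..<Suc M. 2 / d i)"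
      using step.hyps by (simp add: prod.atLeastLessThan_Suc)
    finally show ?case .
  qed
  from this[OF order_refl assms(2,3)] show ?thesis .
qed

text \<open>Rolle's theorem iterated, each differentiation costing one zero. The family
  \<open>D\<close> is abstract so that it can be \<open>F\<close> minus its interpolant.\<close>

lemma many_zeros_deriv:
  fixes D :: "nat \<Rightarrow> real \<Rightarrow> real"
  assumes D: "\<And>k x. (D k has_real_derivative D (Suc k) x) (at x)"
    and "finite X" "card X = Suc r" "\<And>x. x \<in> X \<Longrightarrow> D 0 x = 0" "X \<subseteq> {lo..hi}"
  shows "\<exists>\<xi>\<in>{lo..hi}. D r \<xi> = 0"
proof -
  have rolle: "\<exists>Y. finite Y \<and> card Y = n \<and> (\<forall>y\<in>Y. D (Suc k) y = 0) \<and> Y \<subseteq> {Min X<..<Max X}"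
    if "finite X" "card X = Suc n" "\<forall>x\<in>X. D k x = 0" for X :: "real set" and n k
    using that
  proof (induction n arbitrary: X)
    case (Suc n)
    define b where "b = Max X"
    define X' where "X' = X - {b}"
    have b: "b \<in> X" unfolding b_def using Suc.prems by (intro Max_in) auto
    have X': "finite X'" "card X' = Suc n" "\<forall>x\<in>X'. D k x = 0"
      using Suc.prems b by (auto simp: X'_def)
    then have ne: "X' \<noteq> {}" by auto
    define a where "a = Max X'"
    have a: "a \<in> X'" unfolding a_def using X' ne by (intro Max_in) auto
    have "a \<le> b" unfolding b_def using a Suc.prems by (auto simp: X'_def)
    with a have ab: "a < b" by (auto simp: X'_def)
    from Suc.IH[OF X'] obtain Y where
      Y: "finite Y" "card Y = n" "\<forall>y\<in>Y. D (Suc k) y = 0" "Y \<subseteq> {Min X'<..<a}"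
      unfolding a_def by blast
    \<comment> \<open>The new zero between the two largest points is added to those found among the
      remaining points.\<close>
    have "\<exists>z. a < z \<and> z < b \<and> DERIV (D k) z :> 0"
    proof (rule Rolle[OF ab])
      show "D k a = D k b" using X' a b Suc.prems by simp
      show "continuous_on {a..b} (D k)"
        using D DERIV_isCont by (blast intro: continuous_at_imp_continuous_on)
      show "D k differentiable (at x)" for x
        using D real_differentiable_def by blast
    qed
    then obtain z where z: "a < z" "z < b" "DERIV (D k) z :> 0" by blast
    have "D (Suc k) z = 0" using DERIV_unique[OF D z(3)] .
    note z = z(1,2) this
    have "Min X \<le> Min X'" using X' ne Suc.prems by (intro Min_antimono) (auto simp: X'_def)
    moreover have "Min X \<le> a" using a Suc.prems by (intro Min_le) (auto simp: X'_def)
    ultimately have "insert z Y \<subseteq> {Min X<..<Max X}"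
      using Y(4) z ab unfolding b_def[symmetric] by (auto simp: subset_iff)
    moreover have "z \<notin> Y" using Y(4) z by auto
    ultimately show ?case
      using Y z by (intro exI[of _ "insert z Y"]) auto
  qed auto
  have "\<exists>Y. finite Y \<and> card Y = Suc (r - k) \<and> (\<forall>y\<in>Y. D k y = 0) \<and> Y \<subseteq> {lo..hi}" if "k \<le> r" for k
    using that
  proof (induction k)
    case 0
    then show ?case using assms by auto
  next
    case (Suc k)
    then obtain Y where Y: "finite Y" "card Y = Suc (r - k)" "\<forall>y\<in>Y. D k y = 0" "Y \<subseteq> {lo..hi}"
      by auto
    have "Y \<noteq> {}" using Y by auto
    then have "Min Y \<in> {lo..hi}" "Max Y \<in> {lo..hi}"
      using Y(1,4) Min_in[OF Y(1)] Max_in[OF Y(1)] by blast+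
    then have "{Min Y<..<Max Y} \<subseteq> {lo..hi}" by auto
    with rolle[OF Y(1-3)] Suc.prems show ?case
      by (metis Suc_diff_Suc Suc_le_lessD subset_trans)
  qed
  from this[of r] obtain Y where "card Y = 1" "\<forall>y\<in>Y. D r y = 0" "Y \<subseteq> {lo..hi}" by auto
  then show ?thesis by (auto simp: card_1_singleton_iff)
qed

lemma higher_pderiv_le_degree:
  fixes p :: "real poly"
  assumes "degree p \<le> n"
  shows "(pderiv ^^ n) p = [:fact n * coeff p n:]"
  using assms
proof (induction n arbitrary: p)
  case 0
  then show ?case by (auto elim: degree_eq_zeroE)
next
  case (Suc n)
  have "(pderiv ^^ Suc n) p = (pderiv ^^ n) (pderiv p)"
    by (simp add: funpow_swap1)
  also have "\<dots> = [:fact n * coeff (pderiv p) n:]"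
    by (rule Suc.IH) (use Suc.prems in \<open>simp add: degree_pderiv\<close>)
  finally show ?case by (simp add: coeff_pderiv algebra_simps)
qed

text \<open>\<open>F\<close> minus its Lagrange polynomial has \<open>r + 1\<close> zeros, and the
  r-th derivative of that polynomial is constant, equal to
  \<open>fact r * divdiff F X\<close>.\<close>

lemma divdiff_mean_value:
  assumes "F \<in> smooth_functions" "finite X" "card X = Suc r" "X \<subseteq> {lo..hi}"
  shows "\<exists>\<xi>\<in>{lo..hi}. divdiff F X = hderiv r F \<xi> / fact r"
proof -
  let ?L = "lagrange F X"
  let ?D = "\<lambda>k x. hderiv k F x - poly ((pderiv ^^ k) ?L) x"
  have "\<exists>\<xi>\<in>{lo..hi}. ?D r \<xi> = 0"
  proof (rule many_zeros_deriv[of ?D])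
    show "(?D k has_real_derivative ?D (Suc k) x) (at x)" for k x
      using smooth_hderiv[OF assms(1)] by (auto intro!: derivative_eq_intros poly_DERIV)
  qed (use assms poly_lagrange_node in auto)
  moreover have "(pderiv ^^ r) ?L = [:fact r * divdiff F X:]"
    using degree_lagrange[of F X] assms coeff_lagrange[OF assms(2,3), of F]
    by (subst higher_pderiv_le_degree) auto
  ultimately obtain \<xi> where "\<xi> \<in> {lo..hi}" "hderiv r F \<xi> = fact r * divdiff F X" by auto
  then show ?thesis by (intro bexI[of _ \<xi>]) auto
qed

text \<open>Each differentiation deletes one of at most \<open>card Y\<close> factors, and a deleted
  factor is replaced by \<open>max |x - b| h / h\<close>, which is at least 1. The maximum with
  \<open>h\<close> also keeps the bound usable at the nodes.\<close>

lemma higher_deriv_nodal_bound: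
  assumes "finite Y" "h > 0"
  shows "\<bar>poly ((pderiv ^^ p) (nodal_poly Y)) x\<bar> \<le>
    real (card Y) ^ p / h ^ p * (\<Prod>b\<in>Y. max \<bar>x - b\<bar> h)"
  using assms(1)
proof (induction Y arbitrary: p rule: finite_induct)
  case empty
  show ?case
    by (cases p) (simp_all add: nodal_poly_def funpow_swap1 pderiv_1 higher_pderiv_0)
next
  case (insert b Y)
  let ?w = "nodal_poly Y" and ?N = "real (card Y)" and ?P = "\<Prod>b\<in>Y. max \<bar>x - b\<bar> h"
  have P: "?P \<ge> 0" using assms(2) by (intro prod_nonneg) auto
  have w: "nodal_poly (insert b Y) = [:-b, 1:] * ?w"
    using insert.hyps by (simp add: nodal_poly_def)
  have lin: "pderiv ([:-b, 1:] * R + of_nat n * S) = [:-b, 1:] * pderiv R + R + of_nat n * pderiv S"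
    for R S :: "real poly" and n
    by (simp only: pderiv_add pderiv_mult pderiv_of_nat) (simp add: pderiv_pCons)
  have eq: "(pderiv ^^ p) ([:-b, 1:] * q) =
      [:-b, 1:] * (pderiv ^^ p) q + of_nat p * (pderiv ^^ (p - 1)) q" for p and q :: "real poly"
  proof (induction p)
    case (Suc p)
    have "(pderiv ^^ Suc p) ([:-b, 1:] * q) =
        pderiv ([:-b, 1:] * (pderiv ^^ p) q + of_nat p * (pderiv ^^ (p - 1)) q)"
      using Suc by simp
    also have "\<dots> = [:-b, 1:] * (pderiv ^^ Suc p) q + (pderiv ^^ p) q
        + of_nat p * pderiv ((pderiv ^^ (p - 1)) q)"
      by (simp only: lin funpow.simps o_apply)
    also have "of_nat p * pderiv ((pderiv ^^ (p - 1)) q) = of_nat p * (pderiv ^^ p) q"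
      by (cases p) simp_all
    finally show ?case
      by (simp only: of_nat_Suc diff_Suc_1 distrib_right mult_1_left add.assoc)
  qed simp
  have "\<bar>poly ((pderiv ^^ p) (nodal_poly (insert b Y))) x\<bar> \<le>
      \<bar>x - b\<bar> * \<bar>poly ((pderiv ^^ p) ?w) x\<bar> + real p * \<bar>poly ((pderiv ^^ (p - 1)) ?w) x\<bar>"
  proof -
    have "poly ((pderiv ^^ p) (nodal_poly (insert b Y))) x =
        (x - b) * poly ((pderiv ^^ p) ?w) x + real p * poly ((pderiv ^^ (p - 1)) ?w) x"
      unfolding w eq poly_add poly_mult by simp
    then show ?thesis
      by (metis abs_triangle_ineq abs_mult abs_of_nat)
  qed
  also have "\<dots> \<le> max \<bar>x - b\<bar> h * (?N ^ p / h ^ p * ?P) +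
      real p * (max \<bar>x - b\<bar> h * (?N ^ (p - 1) / h ^ p * ?P))"
  proof (rule add_mono)
    show "\<bar>x - b\<bar> * \<bar>poly ((pderiv ^^ p) ?w) x\<bar> \<le> max \<bar>x - b\<bar> h * (?N ^ p / h ^ p * ?P)"
      by (rule mult_mono) (use insert.IH assms(2) in auto)
    show "real p * \<bar>poly ((pderiv ^^ (p - 1)) ?w) x\<bar> \<le>
        real p * (max \<bar>x - b\<bar> h * (?N ^ (p - 1) / h ^ p * ?P))"
    proof (cases p)
      case (Suc k)
      have "\<bar>poly ((pderiv ^^ k) ?w) x\<bar> \<le> h * (?N ^ k / h ^ Suc k * ?P)"
        using insert.IH[of k] assms(2) by simp
      also have "\<dots> \<le> max \<bar>x - b\<bar> h * (?N ^ k / h ^ Suc k * ?P)"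
        by (rule mult_right_mono) (use P assms(2) in auto)
      finally show ?thesis
        unfolding Suc by (intro mult_left_mono) auto
    qed simp
  qed
  also have "\<dots> = (?N ^ p + real p * ?N ^ (p - 1)) / h ^ p * (max \<bar>x - b\<bar> h * ?P)"
    by (simp add: algebra_simps add_divide_distrib)
  also have "\<dots> \<le> (?N + 1) ^ p / h ^ p * (max \<bar>x - b\<bar> h * ?P)"
  proof -
    \<comment> \<open>Only the two top terms of the binomial expansion are kept.\<close>
    have "?N ^ p + real p * ?N ^ (p - 1) \<le> (?N + 1) ^ p"
    proof (cases p)
      case (Suc k)
      have "(?N + 1) ^ Suc k = (\<Sum>i\<le>Suc k. real (Suc k choose i) * ?N ^ i)"
        using binomial_ring[of ?N 1 "Suc k"] by simp
      also have "\<dots> = (\<Sum>i<k. real (Suc k choose i) * ?N ^ i) + real (Suc k) * ?N ^ k + ?N ^ Suc k"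
        by (simp add: lessThan_Suc_atMost[symmetric])
      also have "\<dots> \<ge> real (Suc k) * ?N ^ k + ?N ^ Suc k"
        by (simp add: sum_nonneg)
      finally show ?thesis using Suc by simp
    qed simp
    then show ?thesis
      by (intro mult_right_mono divide_right_mono) (use P assms(2) in \<open>auto intro:
          mult_nonneg_nonneg simp: le_max_iff_disj\<close>)
  qed
  also have "max \<bar>x - b\<bar> h * ?P = (\<Prod>b\<in>insert b Y. max \<bar>x - b\<bar> h)"
    using insert.hyps by simp
  also have "?N + 1 = real (card (insert b Y))"
    using insert.hyps by simp
  finally show ?case .
qed

text \<open>Sorting by decreasing level, expressed through counts. For \<open>agree\<close> as the
  level, the i-th smallest distance can thus be read off from the sizes of residue classes
  alone.\<close>

lemma enumerate_by_level:
  fixes \<kappa> :: "'a \<Rightarrow> nat"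
  assumes "finite J"
  shows "\<exists>js. bij_betw js {..<card J} J \<and>
    (\<forall>i<card J. \<forall>k. k \<le> \<kappa> (js i) \<longleftrightarrow> i < card {j\<in>J. k \<le> \<kappa> j})"
  using assms
proof (induction "card J" arbitrary: J)
  case 0
  then show ?case by (auto simp: bij_betw_def)
next
  case (Suc n)
  then have "J \<noteq> {}" by auto
  \<comment> \<open>An element of lowest level goes to the end of the enumeration.\<close>
  obtain m where m: "m \<in> J" "\<And>j. j \<in> J \<Longrightarrow> \<kappa> m \<le> \<kappa> j"
    using ex_min_if_finite[of "\<kappa> ` J"] Suc.prems \<open>J \<noteq> {}\<close>
    by (metis (no_types, lifting) arg_min_if_finite(1) arg_min_least)
  have cJ: "n = card (J - {m})" using m Suc by simp
  from Suc.hyps(1)[OF this] Suc.prems obtain js where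
    bij: "bij_betw js {..<n} (J - {m})" and
    js: "\<And>i k. i < n \<Longrightarrow> k \<le> \<kappa> (js i) \<longleftrightarrow> i < card {j\<in>J - {m}. k \<le> \<kappa> j}"
    unfolding cJ by auto
  define js' where "js' = js(n := m)"
  have "bij_betw js' {..<n} (J - {m})"
    using bij by (subst bij_betw_cong[of _ _ js]) (auto simp: js'_def)
  moreover have "js' n = m" by (simp add: js'_def)
  ultimately have "bij_betw js' (insert n {..<n}) (insert m (J - {m}))"
    unfolding bij_betw_def inj_on_insert by auto
  then have "bij_betw js' {..<card J} J"
    using m(1) Suc(2) by (simp add: lessThan_Suc insert_absorb flip: Suc(2))
  moreover have "k \<le> \<kappa> (js' i) \<longleftrightarrow> i < card {j\<in>J. k \<le> \<kappa> j}" if i: "i < card J" for i k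
  proof (cases "k \<le> \<kappa> m")
    case True
    then have "{j\<in>J. k \<le> \<kappa> j} = J" using m order_trans by blast
    moreover have "js' i \<in> J" using calculation i
      by (metis \<open>bij_betw js' {..<card J} J\<close> bij_betwE lessThan_iff)
    ultimately show ?thesis using True m i order_trans by auto
  next
    case False
    then have eq: "{j\<in>J. k \<le> \<kappa> j} = {j\<in>J - {m}. k \<le> \<kappa> j}" by auto
    show ?thesis
    proof (cases "i < n")
      case True
      then show ?thesis using js eq by (simp add: js'_def)
    next
      case iN: False
      then have "i = n" using i Suc(2) by simp
      moreover have "card {j\<in>J - {m}. k \<le> \<kappa> j} \<le> n"
        unfolding cJ by (rule card_mono) (use Suc.prems in auto)
      ultimately show ?thesis using eq False by (simp add: js'_def)
    qed
  qed
  ultimately show ?case by blast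
qed

section \<open>Binary coding of the Cantor set\<close>

text \<open>\<open>near\<close> and \<open>far\<close> say that a residue class modulo
  \<open>2 ^ k\<close> has diameter at most about \<open>\<delta> k\<close> and that its two halves
  are at least \<open>\<delta> k / 2\<close> apart, with one constant \<open>C\<close> for all
  levels. \<open>\<delta>_ratio\<close> makes the gaps of one level eventually exceed any multiple
  of the diameters of the next.\<close>

locale cantor_coding =
  fixes K :: "real set" and v :: "nat \<Rightarrow> real" and \<delta> :: "nat \<Rightarrow> real" and C :: real
  assumes K_closure: "K = closure (range v)"
    and v_range: "v j \<in> {0..1}"
    and C_ge_1: "C \<ge> 1"
    and \<delta>_0: "\<delta> 0 = 1"
    and \<delta>_pos: "\<delta> k > 0"
    and \<delta>_Suc: "\<delta> (Suc k) \<le> \<delta> k / 32"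
    and \<delta>_ratio: "(\<lambda>k. \<delta> (Suc k) / \<delta> k) \<longlonglongrightarrow> 0"
    and near: "i mod 2 ^ k = j mod 2 ^ k \<Longrightarrow> \<bar>v i - v j\<bar> \<le> C * \<delta> k"
    and far: "i mod 2 ^ Suc k \<noteq> j mod 2 ^ Suc k \<Longrightarrow> \<bar>v i - v j\<bar> \<ge> \<delta> k / 2"

section \<open>Logistic orbits, inverse branches and the coded points\<close>

definition logistic :: "real \<Rightarrow> real \<Rightarrow> real" where
  "logistic g u = u * (1 - u) / g"

text \<open>The two solutions w of \<open>w * (1 - w) = g * u\<close>, the smaller one for digit
  0.\<close>

definition branch :: "real \<Rightarrow> nat \<Rightarrow> real \<Rightarrow> real" where
  "branch g b u = (if b = 0 then (1 - sqrt (1 - 4 * g * u)) / 2 else (1 + sqrt (1 - 4 * g * u)) /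
      2)"

fun orbit :: "(nat \<Rightarrow> real) \<Rightarrow> nat \<Rightarrow> nat \<Rightarrow> real \<Rightarrow> real" where
  "orbit \<gamma> m 0 u = u"
| "orbit \<gamma> m (Suc k) u = orbit \<gamma> (Suc m) k (logistic (\<gamma> (Suc m)) u)"

text \<open>The digits of \<open>j\<close> beyond its highest one are 0 and select the lower branch,
  which fixes 0; stopping at \<open>j = 0\<close> with value 0 is this infinite composition. The
  offset \<open>m\<close> tells at which \<open>\<gamma>\<close> the composition begins.\<close>

fun code_point :: "(nat \<Rightarrow> real) \<Rightarrow> nat \<Rightarrow> nat \<Rightarrow> real" where
  "code_point \<gamma> m j =
     (if j = 0 then 0 else branch (\<gamma> (Suc m)) (j mod 2) (code_point \<gamma> (Suc m) (j div 2)))"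

declare code_point.simps [simp del]

lemma code_point_unfold:
  "code_point \<gamma> m j = branch (\<gamma> (Suc m)) (j mod 2) (code_point \<gamma> (Suc m) (j div 2))"
proof (cases "j = 0")
  case True
  moreover have "code_point \<gamma> m 0 = 0" for m by (subst code_point.simps) simp
  ultimately show ?thesis by (simp add: branch_def)
qed (subst code_point.simps, simp)

lemma orbit_Suc: "orbit \<gamma> m (Suc k) u = logistic (\<gamma> (Suc (m + k))) (orbit \<gamma> m k u)"
  by (induction k arbitrary: m u) simp_all

lemma sqrt_discriminant:
  assumes "0 < g" "g \<le> 1 / 32" "0 \<le> u" "u \<le> 1"
  shows "sqrt (1 - 4 * g * u) \<ge> 1 - 4 * g" "sqrt (1 - 4 * g * u) \<le> 1"
proof -
  have gu: "0 \<le> g * u" "g * u \<le> g" using assms by (auto simp: mult_left_le)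
  have "(1 - 4 * g)\<^sup>2 \<le> 1 - 4 * g"
    using assms(1,2) by (simp add: power2_eq_square mult_left_le)
  with gu have "(1 - 4 * g)\<^sup>2 \<le> 1 - 4 * g * u" by linarith
  then show "sqrt (1 - 4 * g * u) \<ge> 1 - 4 * g" by (rule real_le_rsqrt)
  show "sqrt (1 - 4 * g * u) \<le> 1" using gu by simp
qed

lemma branch_range:
  assumes "0 < g" "g \<le> 1 / 32" "0 \<le> u" "u \<le> 1"
  shows "branch g b u \<in> (if b = 0 then {0..1 / 4} else {3 / 4..1})"
  using sqrt_discriminant[OF assms] assms(1,2) by (auto simp: branch_def)

text \<open>Rationalising the difference of the two square roots gives the exact factor
  \<open>g / S\<close>, where \<open>S\<close> is their mean and lies between
  \<open>1 - 4 * g\<close> and 1. The majorant \<open>1 + 8 * g\<close> of 1/S is the form whose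
  infinite product is controlled by the sum of the \<open>\<gamma>\<close>.\<close>

lemma branch_dist:
  assumes g: "0 < g" "g \<le> 1 / 32" and u: "0 \<le> u" "u \<le> 1" and u': "0 \<le> u'" "u' \<le> 1"
  shows "\<bar>branch g b u - branch g b u'\<bar> \<le> g * (1 + 8 * g) * \<bar>u - u'\<bar>"
    and "\<bar>branch g b u - branch g b u'\<bar> \<ge> g * \<bar>u - u'\<bar>"
proof -
  define s s' where "s = sqrt (1 - 4 * g * u)" and "s' = sqrt (1 - 4 * g * u')"
  have s: "1 - 4 * g \<le> s" "s \<le> 1" and s': "1 - 4 * g \<le> s'" "s' \<le> 1"
    unfolding s_def s'_def using sqrt_discriminant g u u' by auto
  define S where "S = (s + s') / 2"
  have S: "1 - 4 * g \<le> S" "S \<le> 1" "S > 0" using s s' g by (auto simp: S_def)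
  have gu: "g * u \<le> g" "g * u' \<le> g" using assms by (auto simp: mult_left_le)
  have sq: "s\<^sup>2 = 1 - 4 * g * u" "s'\<^sup>2 = 1 - 4 * g * u'"
    unfolding s_def s'_def by (rule real_sqrt_pow2, use gu g in linarith)+
  have "\<bar>branch g b u - branch g b u'\<bar> = \<bar>s - s'\<bar> / 2"
    unfolding branch_def s_def[symmetric] s'_def[symmetric] by (simp add: abs_if field_simps)
  also have "\<bar>s - s'\<bar> / 2 = g * \<bar>u - u'\<bar> / S"
  proof -
    have "(s - s') * (s + s') = 4 * g * (u' - u)"
      using sq by (simp add: algebra_simps power2_eq_square)
    then have "\<bar>s - s'\<bar> * \<bar>s + s'\<bar> = 4 * g * \<bar>u' - u\<bar>"
      using g by (simp flip: abs_mult) (simp add: abs_mult)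
    moreover have "\<bar>s + s'\<bar> = 2 * S" using S by (simp add: S_def)
    ultimately show ?thesis using S by (simp add: field_simps abs_minus_commute)
  qed
  finally have eq: "\<bar>branch g b u - branch g b u'\<bar> = g * \<bar>u - u'\<bar> / S" .
  have gd: "g * \<bar>u - u'\<bar> \<ge> 0" using g by simp
  show "\<bar>branch g b u - branch g b u'\<bar> \<ge> g * \<bar>u - u'\<bar>"
    unfolding eq using S gd by (simp add: pos_le_divide_eq mult_left_le)
  have "g * g \<le> g * (1 / 32)" using g by (intro mult_left_mono) auto
  then have "1 \<le> (1 + 8 * g) * (1 - 4 * g)" using g by (simp add: algebra_simps)
  also have "\<dots> \<le> (1 + 8 * g) * S" using S g by (intro mult_left_mono) auto
  finally have "g * \<bar>u - u'\<bar> * 1 \<le> g * \<bar>u - u'\<bar> * ((1 + 8 * g) * S)"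
    using gd by (rule mult_left_mono)
  then show "\<bar>branch g b u - branch g b u'\<bar> \<le> g * (1 + 8 * g) * \<bar>u - u'\<bar>"
    unfolding eq using S by (simp add: pos_divide_le_eq mult_ac)
qed

lemma logistic_branch:
  assumes "0 < g" "g \<le> 1 / 32" "0 \<le> u" "u \<le> 1"
  shows "logistic g (branch g b u) = u"
proof -
  have "g * u \<le> g" using assms by (simp add: mult_left_le)
  then have "(sqrt (1 - 4 * g * u))\<^sup>2 = 1 - 4 * g * u"
    using assms by (intro real_sqrt_pow2) linarith
  then have "branch g b u * (1 - branch g b u) = g * u"
    by (simp add: branch_def power2_eq_square field_simps)
  with assms show ?thesis by (simp add: logistic_def)
qed

lemma branch_logistic:
  assumes "g \<noteq> 0"
  shows "branch g (if u \<le> 1 / 2 then 0 else 1) (logistic g u) = u"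
proof -
  have "g * logistic g u = u * (1 - u)"
    using assms by (simp add: logistic_def)
  then have "1 - 4 * g * logistic g u = (1 - 2 * u)\<^sup>2"
    by (simp only: mult.assoc) (simp add: power2_eq_square algebra_simps)
  then show ?thesis by (simp add: branch_def)
qed

lemma mod_power_Suc_eq_iff:
  "i mod 2 ^ Suc k = j mod 2 ^ Suc k \<longleftrightarrow>
    i mod 2 = j mod 2 \<and> (i div 2) mod 2 ^ k = (j div 2) mod (2 ^ k :: nat)"
proof -
  have "i mod 2 ^ Suc k = 2 * ((i div 2) mod 2 ^ k) + i mod 2" for i :: nat
    by (simp add: mod_mult2_eq)
  moreover have "2 * a + b = 2 * c + d \<longleftrightarrow> b = d \<and> a = c" if "b < 2" "d < 2" for a b c d :: nat
    using that by arith
  ultimately show ?thesis by simp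
qed

lemma zero_le_mult_pos_iff: "0 < r \<Longrightarrow> 0 \<le> r * u \<longleftrightarrow> 0 \<le> u" for r u :: real
  by (simp add: zero_le_mult_iff)

lemma logistic_nonneg_iff: "0 < g \<Longrightarrow> 0 \<le> logistic g u \<longleftrightarrow> u \<in> {0..1}"
  by (auto simp: logistic_def zero_le_divide_iff zero_le_mult_iff)

lemma prod_shift:
  fixes h :: "nat \<Rightarrow> real"
  shows "(\<Prod>l=1..Suc k. h (m + l)) = h (Suc m) * (\<Prod>l=1..k. h (Suc m + l))"
  by (induction k) (simp_all add: mult.assoc)

context
  fixes \<gamma> :: "nat \<Rightarrow> real"
  assumes \<gamma>: "\<And>s. s \<ge> 1 \<Longrightarrow> 0 < \<gamma> s \<and> \<gamma> s \<le> 1 / 32"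
begin

lemma \<gamma>_Suc: "0 < \<gamma> (Suc s)" "\<gamma> (Suc s) \<le> 1 / 32"
  using \<gamma>[of "Suc s"] by auto

lemma cantor_r_pos: "cantor_r \<gamma> s > 0"
  by (induction s) (use \<gamma>_Suc in auto)

text \<open>If P = -r u, then P (P + r) = - r^2 u (1 - u), and r^2 times the next
  \<open>\<gamma>\<close> is the next \<open>cantor_r\<close>.\<close>

lemma cantor_P_orbit: "cantor_P \<gamma> s x = - cantor_r \<gamma> (Suc s) * orbit \<gamma> 0 (Suc s) x"
proof (induction s)
  case 0
  have "\<gamma> 1 * logistic (\<gamma> 1) x = x * (1 - x)"
    using \<gamma>_Suc[of 0] by (simp add: logistic_def)
  then show ?case by (simp add: right_diff_distrib)
next
  case (Suc s)
  define r u where "r = cantor_r \<gamma> (Suc s)" and "u = orbit \<gamma> 0 (Suc s) x"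
  have "cantor_P \<gamma> (Suc s) x = - r * u * (- r * u + r)"
    by (simp only: cantor_P.simps Suc r_def u_def)
  also have "\<dots> = - (\<gamma> (Suc (Suc s)) * r\<^sup>2) * logistic (\<gamma> (Suc (Suc s))) u"
  proof -
    have "\<gamma> (Suc (Suc s)) * logistic (\<gamma> (Suc (Suc s))) u = u * (1 - u)"
      using \<gamma>_Suc[of "Suc s"] by (simp add: logistic_def)
    then have "(\<gamma> (Suc (Suc s)) * r\<^sup>2) * logistic (\<gamma> (Suc (Suc s))) u = r\<^sup>2 * (u * (1 - u))"
      by (metis mult.assoc mult.commute)
    then show ?thesis by (simp add: power2_eq_square algebra_simps)
  qed
  also have "logistic (\<gamma> (Suc (Suc s))) u = orbit \<gamma> 0 (Suc (Suc s)) x"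
    unfolding u_def by (subst (2) orbit_Suc) simp
  finally show ?case by (simp only: cantor_r.simps r_def)
qed

lemma cantor_K_orbit: "x \<in> cantor_K \<gamma> \<longleftrightarrow> (\<forall>k. orbit \<gamma> 0 k x \<in> {0..1})"
proof -
  have "x \<in> cantor_E \<gamma> s \<longleftrightarrow> orbit \<gamma> 0 s x \<in> {0..1}" for s
  proof -
    have "x \<in> cantor_E \<gamma> s \<longleftrightarrow> 0 \<le> cantor_r \<gamma> (Suc s) * orbit \<gamma> 0 (Suc s) x"
      unfolding cantor_E_def mem_Collect_eq cantor_P_orbit by simp
    also have "\<dots> \<longleftrightarrow> 0 \<le> orbit \<gamma> 0 (Suc s) x"
      by (rule zero_le_mult_pos_iff[OF cantor_r_pos])
    also have "\<dots> \<longleftrightarrow> orbit \<gamma> 0 s x \<in> {0..1}"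
      unfolding orbit_Suc by (rule logistic_nonneg_iff) (use \<gamma>_Suc(1)[of s] in simp)
    finally show ?thesis .
  qed
  then show ?thesis by (auto simp: cantor_K_def)
qed

lemma code_point_range: "code_point \<gamma> m j \<in> {0..1}"
proof (induction j arbitrary: m rule: less_induct)
  case (less j)
  have "code_point \<gamma> (Suc m) (j div 2) \<in> {0..1}"
    by (cases "j = 0") (use less in \<open>auto simp: code_point.simps[of _ _ 0]\<close>)
  then show ?case
    using branch_range[OF \<gamma>_Suc, of "code_point \<gamma> (Suc m) (j div 2)" m "j mod 2"]
    by (subst code_point_unfold) (auto split: if_splits)
qed

lemmas code_point_bounds = code_point_range[unfolded atLeastAtMost_iff, THEN conjunct1]
  code_point_range[unfolded atLeastAtMost_iff, THEN conjunct2]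

lemma orbit_code_point: "orbit \<gamma> m k (code_point \<gamma> m j) = code_point \<gamma> (m + k) (j div 2 ^ k)"
proof (induction k arbitrary: m j)
  case (Suc k)
  have "logistic (\<gamma> (Suc m)) (code_point \<gamma> m j) = code_point \<gamma> (Suc m) (j div 2)"
    by (subst code_point_unfold) (rule logistic_branch[OF \<gamma>_Suc code_point_bounds])
  then show ?case by (simp add: Suc div_mult2_eq)
qed simp

text \<open>The lowest digit is the outermost branch, so common low digits mean common outer
  contractions, whose factors multiply.\<close>

lemma code_point_near:
  assumes "i mod 2 ^ k = j mod 2 ^ k"
  shows "\<bar>code_point \<gamma> m i - code_point \<gamma> m j\<bar> \<le>
    (\<Prod>l=1..k. \<gamma> (m + l) * (1 + 8 * \<gamma> (m + l)))"
  using assms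
proof (induction k arbitrary: m i j)
  case 0
  then show ?case using code_point_range[of m i] code_point_range[of m j] by auto
next
  case (Suc k)
  let ?q = "\<lambda>l. \<gamma> l * (1 + 8 * \<gamma> l)"
  have ij: "i mod 2 = j mod 2" "(i div 2) mod 2 ^ k = (j div 2) mod 2 ^ k"
    using Suc.prems unfolding mod_power_Suc_eq_iff by auto
  have "\<bar>code_point \<gamma> m i - code_point \<gamma> m j\<bar> \<le>
      ?q (Suc m) * \<bar>code_point \<gamma> (Suc m) (i div 2) - code_point \<gamma> (Suc m) (j div 2)\<bar>"
    unfolding code_point_unfold[of \<gamma> m i] code_point_unfold[of \<gamma> m j] ij(1)
    by (rule branch_dist(1)[OF \<gamma>_Suc code_point_bounds code_point_bounds])
  also have "\<dots> \<le> ?q (Suc m) * (\<Prod>l=1..k. ?q (Suc m + l))"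
    by (intro mult_left_mono Suc.IH ij(2)) (use \<gamma>_Suc[of m] in auto)
  also have "\<dots> = (\<Prod>l=1..Suc k. ?q (m + l))"
    by (rule prod_shift[symmetric])
  finally show ?case .
qed

text \<open>At the first differing digit the two points lie in [0, 1/4] and [3/4, 1]. The common
  branches applied before that digit shrink this gap by no more than the product of their
  \<open>\<gamma>\<close>.\<close>

lemma code_point_far:
  assumes "i mod 2 ^ Suc k \<noteq> j mod 2 ^ Suc k"
  shows "\<bar>code_point \<gamma> m i - code_point \<gamma> m j\<bar> \<ge> (\<Prod>l=1..k. \<gamma> (m + l)) / 2"
  using assms
proof (induction k arbitrary: m i j)
  case 0
  then have "i mod 2 = 0 \<longleftrightarrow> j mod 2 \<noteq> 0" by auto
  then show ?case
    using branch_range[OF \<gamma>_Suc code_point_bounds, of m "i mod 2" "Suc m" "i div 2"]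
      branch_range[OF \<gamma>_Suc code_point_bounds, of m "j mod 2" "Suc m" "j div 2"]
    unfolding code_point_unfold[of \<gamma> m i] code_point_unfold[of \<gamma> m j]
    by (auto split: if_splits)
next
  case (Suc k)
  have eq: "(\<Prod>l=1..Suc k. \<gamma> (m + l)) = \<gamma> (Suc m) * (\<Prod>l=1..k. \<gamma> (Suc m + l))"
    by (rule prod_shift)
  show ?case
  proof (cases "i mod 2 = j mod 2")
    case False
    have "(\<Prod>l=1..Suc k. \<gamma> (m + l)) \<le> 1"
    proof (rule prod_le_1)
      fix l assume "l \<in> {1..Suc k}"
      then show "0 \<le> \<gamma> (m + l) \<and> \<gamma> (m + l) \<le> 1" using \<gamma>[of "m + l"] by auto
    qed
    moreover have "i mod 2 = 0 \<longleftrightarrow> j mod 2 \<noteq> 0" using False by auto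
    ultimately show ?thesis
      using branch_range[OF \<gamma>_Suc code_point_bounds, of m "i mod 2" "Suc m" "i div 2"]
        branch_range[OF \<gamma>_Suc code_point_bounds, of m "j mod 2" "Suc m" "j div 2"]
      unfolding code_point_unfold[of \<gamma> m i] code_point_unfold[of \<gamma> m j]
      by (auto split: if_splits)
  next
    case True
    then have "(i div 2) mod 2 ^ Suc k \<noteq> (j div 2) mod 2 ^ Suc k"
      using Suc.prems mod_power_Suc_eq_iff[of i "Suc k" j] by blast
    from Suc.IH[OF this, of "Suc m"]
    have "(\<Prod>l=1..Suc k. \<gamma> (m + l)) / 2 \<le>
        \<gamma> (Suc m) * \<bar>code_point \<gamma> (Suc m) (i div 2) - code_point \<gamma> (Suc m) (j div 2)\<bar>"
      unfolding eq using \<gamma>_Suc(1)[of m] by (simp only: mult_le_cancel_left_pos flip: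
          times_divide_eq_right)
    also have "\<dots> \<le> \<bar>code_point \<gamma> m i - code_point \<gamma> m j\<bar>"
      unfolding code_point_unfold[of \<gamma> m i] code_point_unfold[of \<gamma> m j] True
      by (rule branch_dist(2)[OF \<gamma>_Suc code_point_bounds code_point_bounds])
    finally show ?thesis .
  qed
qed

text \<open>The lowest digit of the approximating index is read off from the half of [0, 1]
  containing \<open>x\<close>; the next ones come from the image of \<open>x\<close>, which the
  orbit hypothesis keeps in [0, 1].\<close>

lemma code_point_dense:
  assumes "\<And>k. orbit \<gamma> m k x \<in> {0..1}"
  shows "\<exists>j. \<bar>x - code_point \<gamma> m j\<bar> \<le> (\<Prod>l=1..k. \<gamma> (m + l) * (1 + 8 * \<gamma> (m + l)))"
  using assms
proof (induction k arbitrary: m x)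
  case 0
  then show ?case using code_point_range[of m 0] 0[of 0] by (intro exI[of _ 0]) auto
next
  case (Suc k)
  let ?q = "\<lambda>l. \<gamma> l * (1 + 8 * \<gamma> l)"
  define u where "u = logistic (\<gamma> (Suc m)) x"
  have "orbit \<gamma> (Suc m) k u \<in> {0..1}" for k
    using Suc.prems[of "Suc k"] by (simp add: u_def)
  note u = this
  from Suc.IH[OF this] obtain j where j: "\<bar>u - code_point \<gamma> (Suc m) j\<bar> \<le> (\<Prod>l=1..k. ?q (Suc m + l))"
    by blast
  define b :: nat where "b = (if x \<le> 1 / 2 then 0 else 1)"
  have b: "(2 * j + b) mod 2 = b" "(2 * j + b) div 2 = j" by (auto simp: b_def)
  have x: "x = branch (\<gamma> (Suc m)) b u"
    unfolding b_def u_def using branch_logistic[of "\<gamma> (Suc m)" x] \<gamma>_Suc(1)[of m] by simp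
  have u01: "0 \<le> u" "u \<le> 1" using u[of 0] by auto
  have "\<bar>x - code_point \<gamma> m (2 * j + b)\<bar> \<le> ?q (Suc m) * \<bar>u - code_point \<gamma> (Suc m) j\<bar>"
    unfolding code_point_unfold[of \<gamma> m "2 * j + b"] b
    by (subst x, rule branch_dist(1)[OF \<gamma>_Suc u01 code_point_bounds])
  also have "\<dots> \<le> ?q (Suc m) * (\<Prod>l=1..k. ?q (Suc m + l))"
    by (intro mult_left_mono j) (use \<gamma>_Suc[of m] in auto)
  also have "\<dots> = (\<Prod>l=1..Suc k. ?q (m + l))"
    by (rule prod_shift[symmetric])
  finally show ?case by blast
qed

lemma delta_Suc: "delta \<gamma> (Suc k) = delta \<gamma> k * \<gamma> (Suc k)"
  by (simp add: delta_def)

lemma delta_pos: "delta \<gamma> k > 0"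
  by (induction k) (use \<gamma>_Suc in \<open>auto simp: delta_Suc, simp add: delta_def\<close>)

lemma delta_le: "delta \<gamma> k \<le> (1 / 32) ^ k"
proof (induction k)
  case (Suc k)
  show ?case
    unfolding delta_Suc power_Suc2
    by (rule mult_mono) (use Suc \<gamma>_Suc[of k] in auto)
qed (simp add: delta_def)

text \<open>Summability bounds the accumulated distortion, the product of all
  \<open>1 + 8 * \<gamma>\<close>, by the exponential that serves as the constant \<open>C\<close>.
  It also forces \<open>\<gamma>\<close> to 0, which is \<open>\<delta>_ratio\<close>.\<close>

lemma cantor_coding_cantor_K:
  assumes summ: "summable (\<lambda>s. \<gamma> (Suc s))"
  shows "cantor_coding (cantor_K \<gamma>) (code_point \<gamma> 0) (delta \<gamma>) (exp (8 * (\<Sum>s. \<gamma> (Suc s))))"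
proof
  let ?C = "exp (8 * (\<Sum>s. \<gamma> (Suc s)))"
  have nonneg: "0 \<le> \<gamma> (Suc s)" for s using \<gamma>_Suc(1)[of s] by simp
  have prod_le: "(\<Prod>l=1..k. \<gamma> (0 + l) * (1 + 8 * \<gamma> (0 + l))) \<le> ?C * delta \<gamma> k" for k
  proof -
    have "(\<Prod>l=1..k. \<gamma> (0 + l) * (1 + 8 * \<gamma> (0 + l))) = delta \<gamma> k * (\<Prod>l=1..k. 1 + 8 * \<gamma> l)"
      by (simp add: delta_def prod.distrib)
    also have "(\<Prod>l=1..k. 1 + 8 * \<gamma> l) \<le> (\<Prod>l=1..k. exp (8 * \<gamma> l))"
      by (rule prod_mono) (use \<gamma> in \<open>auto simp: less_imp_le\<close>)
    also have "\<dots> = exp (8 * (\<Sum>l<k. \<gamma> (Suc l)))"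
      by (simp add: exp_sum[symmetric] sum_distrib_left sum.atLeast1_atMost_eq)
    also have "\<dots> \<le> ?C"
      using sum_le_suminf[OF summ, of "{..<k}"] nonneg by simp
    finally show ?thesis
      using delta_pos[of k] by (simp add: mult.commute)
  qed
  show near: "\<bar>code_point \<gamma> 0 i - code_point \<gamma> 0 j\<bar> \<le> ?C * delta \<gamma> k"
    if "i mod 2 ^ k = j mod 2 ^ k" for i j k
    using code_point_near[OF that, of 0] prod_le[of k] by linarith
  show "delta \<gamma> k / 2 \<le> \<bar>code_point \<gamma> 0 i - code_point \<gamma> 0 j\<bar>"
    if "i mod 2 ^ Suc k \<noteq> j mod 2 ^ Suc k" for i j k
    using code_point_far[OF that, of 0] by (simp add: delta_def)
  show "?C \<ge> 1" using suminf_nonneg[OF summ nonneg] by simp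
  show "code_point \<gamma> 0 j \<in> {0..1}" for j by (rule code_point_range)
  show "delta \<gamma> 0 = 1" by (simp add: delta_def)
  show "delta \<gamma> k > 0" for k by (rule delta_pos)
  show "delta \<gamma> (Suc k) \<le> delta \<gamma> k / 32" for k
    using mult_left_mono[OF \<gamma>_Suc(2)[of k], of "delta \<gamma> k"] delta_pos[of k] by (simp add: delta_Suc)
  have "(\<lambda>k. delta \<gamma> (Suc k) / delta \<gamma> k) = (\<lambda>k. \<gamma> (Suc k))"
    using delta_pos by (auto simp: delta_Suc fun_eq_iff less_imp_neq[symmetric])
  then show "(\<lambda>k. delta \<gamma> (Suc k) / delta \<gamma> k) \<longlonglongrightarrow> 0"
    using summable_LIMSEQ_zero[OF summ] by simp
  show "cantor_K \<gamma> = closure (range (code_point \<gamma> 0))"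
  proof (rule antisym)
    show "cantor_K \<gamma> \<subseteq> closure (range (code_point \<gamma> 0))"
    proof
      fix x assume "x \<in> cantor_K \<gamma>"
      then have orb: "\<And>k. orbit \<gamma> 0 k x \<in> {0..1}" by (simp add: cantor_K_orbit)
      show "x \<in> closure (range (code_point \<gamma> 0))"
        unfolding closure_approachable
      proof (intro allI impI)
        fix e :: real assume "e > 0"
        have "(\<lambda>k. ?C * (1 / 32) ^ k) \<longlonglongrightarrow> ?C * 0"
          by (intro tendsto_mult tendsto_const LIMSEQ_realpow_zero) auto
        then have "eventually (\<lambda>k. ?C * (1 / 32) ^ k < e) sequentially"
          using \<open>e > 0\<close> by (intro order_tendstoD) auto
        then obtain k where k: "?C * (1 / 32) ^ k < e" by (auto simp: eventually_sequentially)
        obtain j where "\<bar>x - code_point \<gamma> 0 j\<bar> \<le> ?C * delta \<gamma> k"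
          using code_point_dense[OF orb, of k] prod_le[of k] by (meson order_trans)
        also have "\<dots> \<le> ?C * (1 / 32) ^ k"
          by (rule mult_left_mono[OF delta_le]) auto
        finally show "\<exists>y\<in>range (code_point \<gamma> 0). dist y x < e"
          using k by (auto simp: dist_real_def abs_minus_commute intro!: exI[of _ j])
      qed
    qed
    have "continuous_on UNIV (orbit \<gamma> 0 k)" for k
      by (induction k) (auto simp: orbit_Suc[abs_def] logistic_def divide_inverse simp del:
          orbit.simps(2)
          intro!: continuous_intros)
    then have "closed (orbit \<gamma> 0 k -` {0..1})" for k
      by (intro continuous_closed_vimage) (auto simp: continuous_on_eq_continuous_at)
    moreover have "cantor_K \<gamma> = (\<Inter>k. orbit \<gamma> 0 k -` {0..1})"
      using cantor_K_orbit by auto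
    ultimately have "closed (cantor_K \<gamma>)" by auto
    moreover have "range (code_point \<gamma> 0) \<subseteq> cantor_K \<gamma>"
      using cantor_K_orbit orbit_code_point code_point_range by auto
    ultimately show "closure (range (code_point \<gamma> 0)) \<subseteq> cantor_K \<gamma>"
      by (rule closure_minimal[rotated])
  qed
qed

end

section \<open>Whitney norms\<close>

text \<open>The sequence \<open>c\<close> holds the derivatives at \<open>y\<close>, so
  differentiation is a shift of \<open>c\<close>. There are \<open>n\<close> terms, hence a Taylor
  polynomial of order \<open>q\<close> has \<open>n = Suc q\<close>.\<close>

definition taylor_fun :: "(nat \<Rightarrow> real) \<Rightarrow> nat \<Rightarrow> real \<Rightarrow> real \<Rightarrow> real" where
  "taylor_fun c n y x = (\<Sum>j<n. c j / fact j * (x - y) ^ j)"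

lemma taylor_fun_deriv:
  "(taylor_fun c n y has_real_derivative taylor_fun (\<lambda>j. c (Suc j)) (n - 1) y x) (at x)"
proof (cases n)
  case 0
  then show ?thesis by (simp add: taylor_fun_def[abs_def])
next
  case (Suc m)
  have "((\<lambda>x. \<Sum>j<n. c j / fact j * (x - y) ^ j) has_real_derivative
      (\<Sum>j<n. c j / fact j * (real j * (x - y) ^ (j - 1)))) (at x)"
    by (auto intro!: derivative_eq_intros sum.cong)
  also have "(\<Sum>j<n. c j / fact j * (real j * (x - y) ^ (j - 1))) =
      (\<Sum>j<m. c (Suc j) / fact (Suc j) * (real (Suc j) * (x - y) ^ j))"
    unfolding Suc by (subst sum.lessThan_Suc_shift) simp
  also have "\<dots> = taylor_fun (\<lambda>j. c (Suc j)) (n - 1) y x"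
    unfolding taylor_fun_def fact_Suc by (rule sum.cong) (use Suc in \<open>auto simp del: of_nat_Suc\<close>)
  finally show ?thesis by (simp add: taylor_fun_def[abs_def])
qed

lemma smooth_taylor_fun:
  "taylor_fun c n y \<in> smooth_functions"
  "hderiv k (taylor_fun c n y) = taylor_fun (\<lambda>j. c (k + j)) (n - k) y"
proof -
  have *: "(taylor_fun (\<lambda>j. c (k + j)) (n - k) y has_real_derivative
      taylor_fun (\<lambda>j. c (Suc k + j)) (n - Suc k) y x) (at x)" for k x
    using taylor_fun_deriv[of "\<lambda>j. c (k + j)" "n - k" y x] by simp
  from smoothI[of "\<lambda>k. taylor_fun (\<lambda>j. c (k + j)) (n - k) y", OF *]
  show "taylor_fun c n y \<in> smooth_functions"
    "hderiv k (taylor_fun c n y) = taylor_fun (\<lambda>j. c (k + j)) (n - k) y" by simp_all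
qed

lemma taylor_fun_center: "n > 0 \<Longrightarrow> taylor_fun c n y y = c 0"
  unfolding taylor_fun_def by (subst sum.remove[of _ 0]) (auto simp: power_0_left)

text \<open>For \<open>k \<le> q\<close>, the k-th derivative of the Taylor remainder of order
  \<open>q\<close>, written as the remainder of order \<open>q - k\<close> of the k-th
  derivative.\<close>

definition jet_remainder :: "(real \<Rightarrow> real) \<Rightarrow> nat \<Rightarrow> nat \<Rightarrow> real \<Rightarrow> real \<Rightarrow> real" where
  "jet_remainder F q k y x = hderiv k F x - taylor_fun (\<lambda>j. hderiv (k + j) F y) (Suc q - k) y x"

lemma taylor_remainder:
  assumes "F \<in> smooth_functions"
  shows "\<exists>t\<in>{min x y..max x y}. hderiv k F x - taylor_fun (\<lambda>j. hderiv (k + j) F y) n y x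
    = hderiv (k + n) F t / fact n * (x - y) ^ n"
proof (cases "n = 0 \<or> x = y")
  case True
  then show ?thesis
  proof
    assume "n = 0"
    then show ?thesis by (intro bexI[of _ x]) (auto simp: taylor_fun_def)
  next
    assume xy: "x = y"
    then show ?thesis
      by (cases "n = 0") (auto simp: taylor_fun_center taylor_fun_def intro!: bexI[of _ x])
  qed
next
  case False
  have "\<exists>t. (if x < y then x < t \<and> t < y else y < t \<and> t < x) \<and> hderiv k F x =
      (\<Sum>m<n. hderiv (k + m) F y / fact m * (x - y) ^ m) + hderiv (k + n) F t / fact n * (x - y) ^ n"
    by (rule Taylor[of n "\<lambda>m. hderiv (k + m) F" "hderiv k F" "min x y" "max x y" y x])
      (use False smooth_hderiv[OF assms] in auto)
  then obtain t where t: "(if x < y then x < t \<and> t < y else y < t \<and> t < x) \<and> hderiv k F x =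
      (\<Sum>m<n. hderiv (k + m) F y / fact m * (x - y) ^ m) + hderiv (k + n) F t / fact n * (x - y) ^ n"
    by (rule exE)
  have "t \<in> {min x y..max x y}" using conjunct1[OF t] by (auto split: if_splits)
  moreover have "hderiv k F x - taylor_fun (\<lambda>j. hderiv (k + j) F y) n y x =
      hderiv (k + n) F t / fact n * (x - y) ^ n"
    unfolding taylor_fun_def conjunct2[OF t] by simp
  ultimately show ?thesis by blast
qed

text \<open>Along \<open>K\<close> the difference quotients of
  \<open>hderiv k F - hderiv k G\<close> vanish, and \<open>x\<close> is a limit point of
  \<open>K\<close>, so the derivative of the difference is 0 there. This is what makes
  \<open>whitney_deriv\<close> well defined.\<close>

lemma hderiv_unique_on_perfect:
  assumes F: "F \<in> smooth_functions" "G \<in> smooth_functions" and eq: "\<And>t. t \<in> K \<Longrightarrow> F t = G t"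
    and perfect: "\<And>x. x \<in> K \<Longrightarrow> x islimpt K"
  shows "x \<in> K \<Longrightarrow> hderiv k F x = hderiv k G x"
proof (induction k arbitrary: x)
  case (Suc k)
  let ?H = "\<lambda>y. hderiv k F y - hderiv k G y"
  have "(?H has_real_derivative hderiv (Suc k) F x - hderiv (Suc k) G x) (at x within K)"
    by (rule has_field_derivative_at_within, intro DERIV_diff smooth_hderiv F)
  then have "((\<lambda>y. (?H y - ?H x) / (y - x)) \<longlongrightarrow> hderiv (Suc k) F x - hderiv (Suc k) G x) (at x
      within K)"
    by (simp add: has_field_derivative_iff)
  moreover have "((\<lambda>y. (?H y - ?H x) / (y - x)) \<longlongrightarrow> 0) (at x within K)"
    by (rule Lim_transform_eventually[OF tendsto_const])
      (use Suc in \<open>auto simp: eventually_at_filter\<close>)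
  moreover have "at x within K \<noteq> bot"
    using perfect[OF Suc.prems] by (simp add: trivial_limit_within)
  ultimately have "hderiv (Suc k) F x - hderiv (Suc k) G x = 0"
    by (intro tendsto_unique)
  then show ?case by simp
qed (use eq in simp)

locale perfect_compact =
  fixes K :: "real set"
  assumes compact: "compact K" and perfect: "x \<in> K \<Longrightarrow> x islimpt K" and nonempty: "K \<noteq> {}"
begin

text \<open>No condition is put on \<open>f\<close> outside \<open>K\<close>, so that the relation
  also applies to Taylor remainders, which do not vanish there.\<close>

definition represents :: "(real \<Rightarrow> real) \<Rightarrow> (real \<Rightarrow> real) \<Rightarrow> bool" where
  "represents F f \<longleftrightarrow> F \<in> smooth_functions \<and> (\<forall>t\<in>K. F t = f t)"

lemma whitney_deriv_eq:
  assumes "represents F f" "x \<in> K"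
  shows "whitney_deriv K k f x = hderiv k F x"
  unfolding whitney_deriv_def
proof (rule the_equality)
  show "\<exists>G\<in>smooth_functions. (\<forall>t\<in>K. G t = f t) \<and> (deriv ^^ k) G x = hderiv k F x"
    using assms by (auto simp: represents_def hderiv_def)
  fix d assume "\<exists>F\<in>smooth_functions. (\<forall>t\<in>K. F t = f t) \<and> (deriv ^^ k) F x = d"
  then obtain G where "G \<in> smooth_functions" "\<forall>t\<in>K. G t = f t" "hderiv k G x = d"
    by (auto simp: hderiv_def)
  then show "d = hderiv k F x"
    using hderiv_unique_on_perfect[of G F K x k] perfect assms by (auto simp: represents_def)
qed

lemma whitney_deriv_remainder_eq:
  assumes "represents F f" "x \<in> K" "y \<in> K"
  shows "whitney_deriv K k (whitney_remainder K q y f) x = jet_remainder F q k y x"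
proof -
  let ?T = "taylor_fun (\<lambda>j. hderiv j F y) (Suc q) y"
  have "represents (\<lambda>x. F x - ?T x) (whitney_remainder K q y f)"
    unfolding represents_def
  proof (intro conjI ballI)
    show "(\<lambda>x. F x - ?T x) \<in> smooth_functions"
      using assms(1) unfolding represents_def by (intro smooth_diff(1) smooth_taylor_fun(1)) simp
    show "F t - ?T t = whitney_remainder K q y f t" if "t \<in> K" for t
      using assms(1) that
      by (simp add: represents_def whitney_remainder_def taylor_fun_def lessThan_Suc_atMost
          whitney_deriv_eq[OF assms(1,3)])
  qed
  then have "whitney_deriv K k (whitney_remainder K q y f) x = hderiv k (\<lambda>x. F x - ?T x) x"
    using whitney_deriv_eq assms by blast
  also have "\<dots> = jet_remainder F q k y x"
    using assms(1) by (simp add: represents_def smooth_diff smooth_taylor_fun jet_remainder_def)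
  finally show ?thesis .
qed

lemma whitney_norm_eq:
  assumes "represents F f"
  shows "whitney_norm K q f =
    Sup {\<bar>hderiv k F x\<bar> | k x. x \<in> K \<and> k \<le> q} +
    Sup {\<bar>jet_remainder F q k y x\<bar> / \<bar>x - y\<bar> ^ (q - k) | k x y.
      x \<in> K \<and> y \<in> K \<and> x \<noteq> y \<and> k \<le> q}"
proof -
  have "{\<bar>whitney_deriv K k f x\<bar> | k x. x \<in> K \<and> k \<le> q} = {\<bar>hderiv k F x\<bar> | k x. x \<in> K \<and> k \<le> q}"
    by (intro Collect_cong) (metis whitney_deriv_eq[OF assms])
  moreover have "{\<bar>whitney_deriv K k (whitney_remainder K q y f) x\<bar> / \<bar>x - y\<bar> ^ (q - k) | k x y.
            x \<in> K \<and> y \<in> K \<and> x \<noteq> y \<and> k \<le> q} = {\<bar>jet_remainder F q k y x\<bar> / \<bar>x - y\<bar> ^ (q - k) | k x y.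
      x \<in> K \<and> y \<in> K \<and> x \<noteq> y \<and> k \<le> q}"
    by (intro Collect_cong) (metis whitney_deriv_remainder_eq[OF assms])
  ultimately show ?thesis unfolding whitney_norm_def by simp
qed

text \<open>The expansion is stopped one order early, so that only derivatives up to order
  \<open>q\<close> occur: the remainder becomes a difference of two values of the q-th derivative
  times a power of \<open>x - y\<close>.\<close>

lemma jet_remainder_bounded:
  assumes "F \<in> smooth_functions"
  shows "\<exists>M. \<forall>k x y. x \<in> K \<and> y \<in> K \<and> k \<le> q \<longrightarrow> \<bar>jet_remainder F q k y x\<bar> \<le> M * \<bar>x - y\<bar> ^ (q - k)"
proof -
  obtain R where R: "\<And>x. x \<in> K \<Longrightarrow> \<bar>x\<bar> \<le> R"
    using compact_imp_bounded[OF compact] by (auto simp: bounded_iff)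
  obtain M where M: "M \<ge> 0" "\<forall>k\<le>q. \<forall>x\<in>{-R..R}. \<bar>hderiv k F x\<bar> \<le> M"
    using smooth_bounded_on_compact[OF assms, of "{-R..R}" q] by auto
  have "\<bar>jet_remainder F q k y x\<bar> \<le> (2 * M) * \<bar>x - y\<bar> ^ (q - k)"
    if "x \<in> K" "y \<in> K" "k \<le> q" for k x y
  proof -
    let ?D = "hderiv q F" and ?f = "(x - y) ^ (q - k) / fact (q - k)"
    note kq = that(3)
    obtain t where t: "t \<in> {min x y..max x y}"
      "hderiv k F x - taylor_fun (\<lambda>j. hderiv (k + j) F y) (q - k) y x = ?D t / fact (q - k) * (x -
          y) ^ (q - k)"
      using taylor_remainder[OF assms, of x y k "q - k"] kq by auto
    have "taylor_fun (\<lambda>j. hderiv (k + j) F y) (Suc q - k) y x =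
        taylor_fun (\<lambda>j. hderiv (k + j) F y) (q - k) y x + ?D y / fact (q - k) * (x - y) ^ (q - k)"
      using kq by (simp add: taylor_fun_def Suc_diff_le)
    with t have eq: "jet_remainder F q k y x = (?D t - ?D y) * ?f"
      by (simp add: jet_remainder_def algebra_simps diff_divide_distrib)
    have xy: "x \<in> {-R..R}" "y \<in> {-R..R}" using R[of x] R[of y] that by auto
    then have "t \<in> {-R..R}" using t(1) by (auto simp: min_def max_def split: if_splits)
    with xy have "\<bar>?D t\<bar> \<le> M" "\<bar>?D y\<bar> \<le> M" using M(2) by auto
    then have "\<bar>?D t - ?D y\<bar> \<le> 2 * M" by linarith
    moreover have "\<bar>?f\<bar> \<le> \<bar>x - y\<bar> ^ (q - k)"
      by (simp add: power_abs divide_le_eq mult_le_cancel_left1)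
    ultimately show ?thesis
      unfolding eq abs_mult by (intro mult_mono) auto
  qed
  then show ?thesis by blast
qed

lemma two_points: "\<exists>x y. x \<in> K \<and> y \<in> K \<and> x \<noteq> y"
  using nonempty perfect unfolding islimpt_def by (metis UNIV_I all_not_in_conv open_UNIV)

text \<open>Replaces the suprema by pointwise bounds, once both sets are known to be bounded above.
  Keeping the two summands apart lets the triangle inequality be checked for each of them.\<close>

lemma whitney_norm_split:
  assumes "represents F f"
  shows "\<exists>a b. a \<ge> 0 \<and> b \<ge> 0 \<and> whitney_norm K q f = a + b \<and>
    (\<forall>k\<le>q. \<forall>x\<in>K. \<bar>hderiv k F x\<bar> \<le> a) \<and>
    (\<forall>k\<le>q. \<forall>x\<in>K. \<forall>y\<in>K. \<bar>jet_remainder F q k y x\<bar> \<le> b * \<bar>x - y\<bar> ^ (q - k))"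
proof -
  define A where "A = {\<bar>hderiv k F x\<bar> | k x. x \<in> K \<and> k \<le> q}"
  define B where "B = {\<bar>jet_remainder F q k y x\<bar> / \<bar>x - y\<bar> ^ (q - k) | k x y.
      x \<in> K \<and> y \<in> K \<and> x \<noteq> y \<and> k \<le> q}"
  have F: "F \<in> smooth_functions" using assms by (simp add: represents_def)
  obtain M where M: "\<forall>k\<le>q. \<forall>x\<in>K. \<bar>hderiv k F x\<bar> \<le> M"
    using smooth_bounded_on_compact[OF F compact, of q] by auto
  then have bA: "bdd_above A" unfolding A_def by (auto intro!: bdd_aboveI[of _ M])
  obtain M' where M': "\<And>k x y. x \<in> K \<Longrightarrow> y \<in> K \<Longrightarrow> k \<le> q \<Longrightarrow>
      \<bar>jet_remainder F q k y x\<bar> \<le> M' * \<bar>x - y\<bar> ^ (q - k)"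
    using jet_remainder_bounded[OF F, of q] by blast
  have bB: "bdd_above B"
  proof (rule bdd_aboveI[of _ M'])
    fix b assume "b \<in> B"
    then obtain k x y where "x \<in> K" "y \<in> K" "x \<noteq> y" "k \<le> q"
      "b = \<bar>jet_remainder F q k y x\<bar> / \<bar>x - y\<bar> ^ (q - k)"
      unfolding B_def by blast
    then show "b \<le> M'" using M'[of x y k] by (simp add: pos_divide_le_eq)
  qed
  have A: "\<bar>hderiv k F x\<bar> \<le> Sup A" if "k \<le> q" "x \<in> K" for k x
    by (rule cSup_upper[OF _ bA]) (use that in \<open>auto simp: A_def\<close>)
  have B: "\<bar>jet_remainder F q k y x\<bar> / \<bar>x - y\<bar> ^ (q - k) \<le> Sup B"
    if "k \<le> q" "x \<in> K" "y \<in> K" "x \<noteq> y" for k x y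
    by (rule cSup_upper[OF _ bB], unfold B_def) (use that in blast)
  obtain x0 y0 where xy: "x0 \<in> K" "y0 \<in> K" "x0 \<noteq> y0" using two_points by blast
  have "Sup A \<ge> 0" using A[of 0 x0] xy by (meson abs_ge_zero le0 order_trans)
  moreover have "0 \<le> \<bar>jet_remainder F q 0 y0 x0\<bar> / \<bar>x0 - y0\<bar> ^ (q - 0)" by simp
  then have "Sup B \<ge> 0" using B[of 0 x0 y0] xy by (meson le0 order_trans)
  moreover have "\<bar>jet_remainder F q k y x\<bar> \<le> Sup B * \<bar>x - y\<bar> ^ (q - k)"
    if "k \<le> q" "x \<in> K" "y \<in> K" for k x y
  proof (cases "x = y")
    case True
    have "jet_remainder F q k x x = 0"
      using that(1) by (simp add: jet_remainder_def taylor_fun_center)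
    with True \<open>Sup B \<ge> 0\<close> show ?thesis by simp
  qed (use B[OF that] in \<open>simp add: pos_divide_le_eq\<close>)
  moreover have "whitney_norm K q f = Sup A + Sup B"
    unfolding A_def B_def by (rule whitney_norm_eq[OF assms])
  ultimately show ?thesis
    using A by (intro exI[of _ "Sup A"] exI[of _ "Sup B"]) simp
qed

lemma
  assumes "represents F f"
  shows hderiv_le_whitney_norm: "x \<in> K \<Longrightarrow> k \<le> q \<Longrightarrow> \<bar>hderiv k F x\<bar> \<le> whitney_norm K q f"
    and jet_remainder_le_whitney_norm: "x \<in> K \<Longrightarrow> y \<in> K \<Longrightarrow> k \<le> q \<Longrightarrow>
      \<bar>jet_remainder F q k y x\<bar> \<le> whitney_norm K q f * \<bar>x - y\<bar> ^ (q - k)"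
    and whitney_norm_nonneg: "whitney_norm K q f \<ge> 0"
proof -
  obtain a b where ab: "a \<ge> 0" "b \<ge> 0" "whitney_norm K q f = a + b"
    "\<And>k x. k \<le> q \<Longrightarrow> x \<in> K \<Longrightarrow> \<bar>hderiv k F x\<bar> \<le> a"
    "\<And>k x y. k \<le> q \<Longrightarrow> x \<in> K \<Longrightarrow> y \<in> K \<Longrightarrow> \<bar>jet_remainder F q k y x\<bar> \<le> b * \<bar>x - y\<bar> ^ (q - k)"
    using whitney_norm_split[OF assms, of q] by blast
  show "whitney_norm K q f \<ge> 0" using ab(1-3) by simp
  show "\<bar>hderiv k F x\<bar> \<le> whitney_norm K q f" if "x \<in> K" "k \<le> q" for x k
    using ab(2,3) ab(4)[OF that(2,1)] by simp
  show "\<bar>jet_remainder F q k y x\<bar> \<le> whitney_norm K q f * \<bar>x - y\<bar> ^ (q - k)"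
    if "x \<in> K" "y \<in> K" "k \<le> q" for x y k
    by (rule order_trans[OF ab(5)[OF that(3,1,2)] mult_right_mono]) (use ab(1,3) in auto)
qed

lemma whitney_norm_le:
  assumes "represents F f"
    and "\<And>k x. x \<in> K \<Longrightarrow> k \<le> q \<Longrightarrow> \<bar>hderiv k F x\<bar> \<le> a"
    and "\<And>k x y. x \<in> K \<Longrightarrow> y \<in> K \<Longrightarrow> x \<noteq> y \<Longrightarrow> k \<le> q \<Longrightarrow>
      \<bar>jet_remainder F q k y x\<bar> \<le> b * \<bar>x - y\<bar> ^ (q - k)"
  shows "whitney_norm K q f \<le> a + b"
proof -
  obtain x0 y0 where xy: "x0 \<in> K" "y0 \<in> K" "x0 \<noteq> y0" using two_points by blast
  show ?thesis
    unfolding whitney_norm_eq[OF assms(1)]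
  proof (intro add_mono cSup_least)
    show "{\<bar>hderiv k F x\<bar> |k x. x \<in> K \<and> k \<le> q} \<noteq> {}" using xy(1) by blast
    show "{\<bar>jet_remainder F q k y x\<bar> / \<bar>x - y\<bar> ^ (q - k) |k x y.
        x \<in> K \<and> y \<in> K \<and> x \<noteq> y \<and> k \<le> q} \<noteq> {}" using xy by blast
  next
    fix z assume "z \<in> {\<bar>jet_remainder F q k y x\<bar> / \<bar>x - y\<bar> ^ (q - k) |k x y.
        x \<in> K \<and> y \<in> K \<and> x \<noteq> y \<and> k \<le> q}"
    then obtain k x y where "x \<in> K" "y \<in> K" "x \<noteq> y" "k \<le> q"
      "z = \<bar>jet_remainder F q k y x\<bar> / \<bar>x - y\<bar> ^ (q - k)" by blast
    with assms(3)[of x y k] show "z \<le> b" by (simp add: pos_divide_le_eq)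
  qed (use assms(2) in auto)
qed

lemma jet_remainder_lincomb:
  assumes "F \<in> smooth_functions" "G \<in> smooth_functions"
  shows "jet_remainder (\<lambda>x. a * F x + b * G x) q k y x =
    a * jet_remainder F q k y x + b * jet_remainder G q k y x"
  unfolding jet_remainder_def taylor_fun_def smooth_lincomb(2)[OF assms]
  by (simp add: algebra_simps sum.distrib sum_distrib_left add_divide_distrib)

lemma represents_lincomb:
  assumes "represents F f" "represents G g"
  shows "represents (\<lambda>x. a * F x + b * G x) (\<lambda>x. a * f x + b * g x)"
  using assms by (auto simp: represents_def smooth_lincomb)

lemma whitney_norm_lincomb:
  assumes "represents F f" "represents G g"
  shows "whitney_norm K q (\<lambda>x. a * f x + b * g x) \<le> \<bar>a\<bar> * whitney_norm K q f + \<bar>b\<bar> * whitney_norm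
      K q g"
proof -
  have F: "F \<in> smooth_functions" "G \<in> smooth_functions" using assms by (auto simp: represents_def)
  obtain A B where AB: "whitney_norm K q f = A + B"
      "\<And>k x. k \<le> q \<Longrightarrow> x \<in> K \<Longrightarrow> \<bar>hderiv k F x\<bar> \<le> A"
      "\<And>k x y. k \<le> q \<Longrightarrow> x \<in> K \<Longrightarrow> y \<in> K \<Longrightarrow> \<bar>jet_remainder F q k y x\<bar> \<le> B * \<bar>x - y\<bar> ^ (q - k)"
    using whitney_norm_split[OF assms(1), of q] by blast
  obtain A' B' where AB': "whitney_norm K q g = A' + B'"
      "\<And>k x. k \<le> q \<Longrightarrow> x \<in> K \<Longrightarrow> \<bar>hderiv k G x\<bar> \<le> A'"
      "\<And>k x y. k \<le> q \<Longrightarrow> x \<in> K \<Longrightarrow> y \<in> K \<Longrightarrow> \<bar>jet_remainder G q k y x\<bar> \<le> B' * \<bar>x - y\<bar> ^ (q - k)"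
    using whitney_norm_split[OF assms(2), of q] by blast
  have tri: "\<bar>a * s + b * t\<bar> \<le> \<bar>a\<bar> * S + \<bar>b\<bar> * T" if "\<bar>s\<bar> \<le> S" "\<bar>t\<bar> \<le> T" for s t S T :: real
    using that by (intro order_trans[OF abs_triangle_ineq] add_mono) (auto simp: abs_mult
        mult_left_mono)
  have "whitney_norm K q (\<lambda>x. a * f x + b * g x) \<le> (\<bar>a\<bar> * A + \<bar>b\<bar> * A') + (\<bar>a\<bar> * B + \<bar>b\<bar> * B')"
  proof (rule whitney_norm_le[OF represents_lincomb[OF assms]])
    show "\<bar>hderiv k (\<lambda>x. a * F x + b * G x) x\<bar> \<le> \<bar>a\<bar> * A + \<bar>b\<bar> * A'" if "x \<in> K" "k \<le> q" for k x
      unfolding smooth_lincomb(2)[OF F] by (rule tri) (use AB AB' that in auto)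
    show "\<bar>jet_remainder (\<lambda>x. a * F x + b * G x) q k y x\<bar> \<le> (\<bar>a\<bar> * B + \<bar>b\<bar> * B') * \<bar>x - y\<bar> ^ (q -
        k)"
      if "x \<in> K" "y \<in> K" "x \<noteq> y" "k \<le> q" for k x y
      unfolding jet_remainder_lincomb[OF F] distrib_right mult.assoc
      by (rule tri) (use AB(3) AB'(3) that in auto)
  qed
  also have "\<dots> = \<bar>a\<bar> * whitney_norm K q f + \<bar>b\<bar> * whitney_norm K q g"
    unfolding AB(1) AB'(1) by (simp add: algebra_simps)
  finally show ?thesis .
qed

end

lemma finite_real_enumerate:
  fixes X :: "real set"
  assumes "finite X" "card X = Suc r"
  shows "\<exists>x. x ` {..r} = X \<and> (\<forall>i j. i < j \<longrightarrow> j \<le> r \<longrightarrow> x i < x j)"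
proof -
  let ?xs = "sorted_list_of_set X"
  have "sorted_wrt (<) ?xs" by (rule strict_sorted_list_of_set)
  moreover have len: "length ?xs = Suc r" using assms by simp
  moreover have "(\<lambda>i. ?xs ! i) ` {..r} = X"
  proof -
    have "(\<lambda>i. ?xs ! i) ` {..<length ?xs} = set ?xs"
      by (auto simp: set_conv_nth)
    then show ?thesis using assms len by (simp add: lessThan_Suc_atMost)
  qed
  ultimately show ?thesis
    by (intro exI[of _ "\<lambda>i. ?xs ! i"]) (auto simp: sorted_wrt_iff_nth_less)
qed

context perfect_compact
begin

text \<open>The Taylor polynomials at consecutive nodes are glued by smooth steps on the gaps between
  them. This yields an extension whose \<open>r\<close>-th derivative is controlled by the Whitney norm.\<close>

lemma divdiff_le_whitney_norm:
  "\<exists>c\<ge>0. \<forall>f F X. represents F f \<longrightarrow> X \<subseteq> K \<longrightarrow> finite X \<longrightarrow> card X = Suc r \<longrightarrow>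
    \<bar>divdiff f X\<bar> \<le> c * whitney_norm K r f"
proof -
  obtain M where M: "M \<ge> 0" "\<And>k x. k \<le> r \<Longrightarrow> \<bar>hderiv k smooth_step x\<bar> \<le> M"
    using smooth_step_bounded[of r] by blast
  \<comment> \<open>The 1 is for the first Taylor polynomial. The rest counts \<open>r\<close> gaps,
    \<open>Suc r\<close> Leibniz terms, binomial coefficients up to \<open>2 ^ r\<close>,
    derivatives of the step up to \<open>M\<close>, and differences of Taylor polynomials up to
    \<open>r + 2\<close> norms.\<close>
  define c where "c = 1 + real r * (real (Suc r) * (2 ^ r * (M * (real r + 2))))"
  have c0: "c \<ge> 0" using M by (simp add: c_def)
  have "\<bar>divdiff f X\<bar> \<le> c * whitney_norm K r f"
    if rep: "represents F f" and X: "X \<subseteq> K" "finite X" "card X = Suc r" for f F X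
  proof -
    define N where "N = whitney_norm K r f"
    have N0: "N \<ge> 0" unfolding N_def by (rule whitney_norm_nonneg[OF rep])
    have F: "F \<in> smooth_functions" using rep by (simp add: represents_def)
    obtain x where x: "x ` {..r} = X" "\<And>i j. i < j \<Longrightarrow> j \<le> r \<Longrightarrow> x i < x j"
      using finite_real_enumerate[OF X(2,3)] by blast
    have xK: "x i \<in> K" if "i \<le> r" for i using x(1) X(1) that by blast
    define T where "T i = taylor_fun (\<lambda>j. hderiv j F (x i)) (Suc r) (x i)" for i
    define h where "h i = x (Suc i) - x i" for i
    define S where "S i y = smooth_step (1 / h i * y + - x i / h i)" for i y
    define D where "D i y = T (Suc i) y - T i y" for i y
    \<comment> \<open>At the node \<open>x l\<close> exactly the steps with index below
      \<open>l\<close> equal 1, so the sum telescopes to the l-th Taylor polynomial.\<close>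
    define G where "G y = T 0 y + (\<Sum>i<r. S i y * D i y)" for y
    have h: "h i > 0" if "i < r" for i using x(2)[of i "Suc i"] that by (simp add: h_def)
    have T: "T i \<in> smooth_functions" for i unfolding T_def by (rule smooth_taylor_fun)
    have hT: "hderiv k (T i) = taylor_fun (\<lambda>j. hderiv (k + j) F (x i)) (Suc r - k) (x i)" for k i
      unfolding T_def by (rule smooth_taylor_fun)
    have D: "D i \<in> smooth_functions" "hderiv k (D i) = (\<lambda>y. hderiv k (T (Suc i)) y - hderiv k (T
        i) y)" for i k
      unfolding D_def[abs_def] using smooth_diff[OF T T] by auto
    have S: "S i \<in> smooth_functions" "hderiv k (S i) = (\<lambda>y. (1 / h i) ^ k * hderiv k smooth_step
        (1 / h i * y + - x i / h i))" for i k
      unfolding S_def[abs_def] by (rule smooth_affine[OF smooth_step])+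
    have SD: "(\<lambda>y. S i y * D i y) \<in> smooth_functions" for i by (rule smooth_mult(1)[OF S(1) D(1)])
    have sumSD: "(\<lambda>y. \<Sum>i<r. S i y * D i y) \<in> smooth_functions"
      by (rule smooth_sum(1)[OF SD])
    have G: "G \<in> smooth_functions"
      unfolding G_def[abs_def] by (rule smooth_add(1)[OF T sumSD])
    have hG: "hderiv r G y = hderiv r (T 0) y +
        (\<Sum>i<r. \<Sum>m\<le>r. real (r choose m) * (hderiv m (S i) y * hderiv (r - m) (D i) y))" for y
      unfolding G_def[abs_def] smooth_add(2)[OF T sumSD] smooth_sum(2)[OF SD] smooth_mult(2)[OF
          S(1) D(1)] ..
    have arg: "1 / h i * y + - x i / h i = (y - x i) / h i" if "i < r" for i y
      using h[OF that] by (simp add: field_simps)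
    have G_node: "G y = f y" if "y \<in> X" for y
    proof -
      obtain l where l: "l \<le> r" "y = x l" using \<open>y \<in> X\<close> x(1) by blast
      have Sv: "S i y = (if i < l then 1 else 0)" if "i < r" for i
      proof (cases "i < l")
        case True
        then have "x (Suc i) \<le> x l" using x(2)[of "Suc i" l] l(1) by (cases "Suc i = l") auto
        then have "(y - x i) / h i \<ge> 1" using h[OF \<open>i < r\<close>] l by (simp add: h_def)
        then show ?thesis using True arg[OF that] by (simp add: S_def smooth_step_1)
      next
        case False
        then have "x l \<le> x i" using x(2)[of l i] that by (cases "l = i") auto
        then have "(y - x i) / h i \<le> 0" using h[OF \<open>i < r\<close>] l by (simp add: divide_nonpos_pos)
        then show ?thesis using False arg[OF that] by (simp add: S_def smooth_step_0)
      qed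
      have "(\<Sum>i<r. S i y * D i y) = (\<Sum>i<r. if i < l then D i y else 0)"
        by (rule sum.cong) (auto simp: Sv)
      also have "\<dots> = (\<Sum>i\<in>{..<r} \<inter> {i. i < l}. D i y)"
        by (simp add: sum.inter_restrict)
      also have "{..<r} \<inter> {i. i < l} = {..<l}" using l(1) by auto
      also have "(\<Sum>i<l. D i y) = T l y - T 0 y"
        unfolding D_def by (rule sum_lessThan_telescope)
      finally have "G y = T l y" by (simp add: G_def)
      also have "\<dots> = F (x l)" unfolding T_def l(2) by (simp add: taylor_fun_center)
      finally show ?thesis using rep xK[OF l(1)] l(2) by (simp add: represents_def)
    qed
    have topT: "\<bar>hderiv r (T i) y\<bar> \<le> N" if "i \<le> r" for i y
      unfolding hT N_def using hderiv_le_whitney_norm[OF rep xK[OF that], of r r]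
      by (simp add: taylor_fun_def)
    have Dbound: "\<bar>hderiv (r - m) (D i) y\<bar> \<le> (real r + 1) * N * h i ^ m"
      if i: "i < r" and m: "m \<le> r" and y: "y \<in> {x i..x (Suc i)}" for i m y
    proof -
      \<comment> \<open>\<open>D i\<close> has degree at most \<open>r\<close>, so it equals its
        expansion about the right node \<open>b\<close>. The coefficients there are jet remainders
        of \<open>F\<close> between the two nodes; they supply the powers of \<open>h i\<close> that
        cancel those lost by differentiating the step.\<close>
      define j b where "j = r - m" and "b = x (Suc i)"
      obtain t where "hderiv j (D i) y - taylor_fun (\<lambda>l. hderiv (j + l) (D i) b) (Suc r - j) b y =
          hderiv (j + (Suc r - j)) (D i) t / fact (Suc r - j) * (y - b) ^ (Suc r - j)"
        using taylor_remainder[OF D(1)[of i], of y b j "Suc r - j"] by blast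
      moreover have "hderiv (j + (Suc r - j)) (D i) t = 0"
        unfolding D(2) hT by (simp add: j_def taylor_fun_def)
      ultimately have eq: "hderiv j (D i) y = taylor_fun (\<lambda>l. hderiv (j + l) (D i) b) (Suc r - j)
          b y"
        by simp
      have "\<bar>hderiv (j + l) (D i) b / fact l * (y - b) ^ l\<bar> \<le> N * h i ^ m" if l: "l < Suc r - j"
          for l
      proof -
        have "hderiv (j + l) (D i) b = jet_remainder F r (j + l) (x i) b"
          unfolding D(2) hT jet_remainder_def b_def using l by (simp add: taylor_fun_center)
        also have "\<bar>\<dots>\<bar> \<le> N * \<bar>b - x i\<bar> ^ (r - (j + l))"
          unfolding N_def
          by (rule jet_remainder_le_whitney_norm[OF rep]) (use xK i l in \<open>auto simp: b_def\<close>)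
        finally have 1: "\<bar>hderiv (j + l) (D i) b\<bar> \<le> N * h i ^ (m - l)"
          using h[OF i] m l by (simp add: h_def b_def j_def)
        have 2: "\<bar>y - b\<bar> ^ l \<le> h i ^ l"
          by (rule power_mono) (use y in \<open>auto simp: h_def b_def\<close>)
        have "\<bar>hderiv (j + l) (D i) b / fact l * (y - b) ^ l\<bar> =
            \<bar>hderiv (j + l) (D i) b\<bar> / fact l * \<bar>y - b\<bar> ^ l"
          by (simp add: abs_mult power_abs)
        also have "\<dots> \<le> (N * h i ^ (m - l)) * h i ^ l"
        proof (rule mult_mono[OF _ 2])
          have "\<bar>hderiv (j + l) (D i) b\<bar> / fact l \<le> \<bar>hderiv (j + l) (D i) b\<bar>"
            by (simp add: divide_le_eq mult_le_cancel_left1)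
          with 1 show "\<bar>hderiv (j + l) (D i) b\<bar> / fact l \<le> N * h i ^ (m - l)" by linarith
        qed (use N0 h[OF i] in auto)
        also have "\<dots> = N * h i ^ m"
          using l m by (simp add: j_def flip: power_add)
        finally show ?thesis .
      qed
      then have "\<bar>hderiv j (D i) y\<bar> \<le> (\<Sum>l<Suc r - j. N * h i ^ m)"
        unfolding eq taylor_fun_def by (intro order_trans[OF sum_abs] sum_mono) auto
      also have "\<dots> = real (Suc r - j) * (N * h i ^ m)" by simp
      also have "\<dots> \<le> (real r + 1) * (N * h i ^ m)"
        using N0 h[OF i] by (intro mult_right_mono) auto
      finally show ?thesis by (simp add: j_def mult.assoc)
    qed
    have tm: "\<bar>hderiv m (S i) y * hderiv (r - m) (D i) y\<bar> \<le> M * ((real r + 2) * N)"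
      if i: "i < r" and m: "m \<le> r" for i m y
    proof -
      have Sb: "\<bar>hderiv m (S i) y\<bar> \<le> M / h i ^ m"
      proof -
        have "\<bar>(1 / h i) ^ m * t\<bar> \<le> M / h i ^ m" if "\<bar>t\<bar> \<le> M" for t
          using h[OF i] that by (simp add: abs_mult power_one_over divide_right_mono)
        then show ?thesis unfolding S(2) using M(2)[OF m] by blast
      qed
      consider "y \<in> {x i..x (Suc i)}" | "y \<notin> {x i..x (Suc i)}" "m = 0" | "y \<notin> {x i..x (Suc i)}" "m
          > 0"
        by blast
      then show ?thesis
      proof cases
        case 1
        have "\<bar>hderiv m (S i) y * hderiv (r - m) (D i) y\<bar> \<le> M / h i ^ m * ((real r + 1) * N * h i
            ^ m)"
          unfolding abs_mult by (rule mult_mono[OF Sb Dbound[OF i m 1]]) (use M h[OF i] in auto)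
        also have "\<dots> = M * ((real r + 1) * N)" using h[OF i] by simp
        also have "\<dots> \<le> M * ((real r + 2) * N)" using M(1) N0 by (intro mult_left_mono
            mult_right_mono) auto
        finally show ?thesis .
      next
        case 2
        have "\<bar>hderiv r (D i) y\<bar> \<le> 2 * N"
          using topT[of i y] topT[of "Suc i" y] i by (simp add: D(2))
        also have "\<dots> \<le> (real r + 2) * N" using N0 by (intro mult_right_mono) auto
        finally show ?thesis
          unfolding abs_mult using Sb 2 M(1) N0 by (intro mult_mono) auto
      next
        case 3
        then have "(y - x i) / h i \<notin> {0..1}" using h[OF i] by (auto simp: field_simps h_def)
        then have "hderiv m (S i) y = 0"
          unfolding S(2) arg[OF i] using hderiv_smooth_step_outside 3(2) by simp
        then show ?thesis using M(1) N0 by simp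
      qed
    qed
    have "\<bar>hderiv r G y\<bar> \<le> c * N" for y
    proof -
      have "\<bar>\<Sum>m\<le>r. real (r choose m) * (hderiv m (S i) y * hderiv (r - m) (D i) y)\<bar> \<le>
          (\<Sum>m\<le>r. 2 ^ r * (M * ((real r + 2) * N)))" if "i < r" for i
      proof (rule order_trans[OF sum_abs], rule sum_mono)
        fix m assume "m \<in> {..r}"
        then have "m \<le> r" by simp
        have "real (r choose m) \<le> 2 ^ r"
          using binomial_le_pow2[of r m] by (metis of_nat_le_iff of_nat_numeral of_nat_power)
        then show "\<bar>real (r choose m) * (hderiv m (S i) y * hderiv (r - m) (D i) y)\<bar> \<le> 2 ^ r * (M
            * ((real r + 2) * N))"
          unfolding abs_mult[of "real (r choose m)"]
          by (intro mult_mono tm[OF that \<open>m \<le> r\<close>]) auto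
      qed
      then have "\<bar>\<Sum>i<r. \<Sum>m\<le>r. real (r choose m) * (hderiv m (S i) y * hderiv (r - m) (D i) y)\<bar> \<le>
          (\<Sum>i<r. \<Sum>m\<le>r. 2 ^ r * (M * ((real r + 2) * N)))"
        by (intro order_trans[OF sum_abs]) (rule sum_mono, simp)
      also have "\<dots> = (c - 1) * N" by (simp add: c_def)
      finally show ?thesis unfolding hG using topT[of 0 y] by (simp add: algebra_simps)
    qed
    note Gb = this
    obtain \<xi> where "divdiff G X = hderiv r G \<xi> / fact r"
      using divdiff_mean_value[OF G X(2,3), of "Min X" "Max X"] X(2) by fastforce
    then have "\<bar>divdiff G X\<bar> \<le> \<bar>hderiv r G \<xi>\<bar>"
      by (simp add: divide_le_eq mult_le_cancel_left1)
    then show ?thesis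
      using Gb[of \<xi>] divdiff_cong[of X G f] G_node N_def by simp
  qed
  with c0 show ?thesis by blast
qed

lemma whitney_functions_iff:
  "f \<in> whitney_functions K \<longleftrightarrow> (\<exists>F. represents F f) \<and> (\<forall>x. x \<notin> K \<longrightarrow> f x = 0)"
proof
  assume "f \<in> whitney_functions K"
  then obtain F where F: "F \<in> smooth_functions" "f = (\<lambda>x. if x \<in> K then F x else 0)"
    unfolding whitney_functions_def by blast
  then have "represents F f" by (simp add: represents_def)
  with F(2) show "(\<exists>F. represents F f) \<and> (\<forall>x. x \<notin> K \<longrightarrow> f x = 0)" by auto
next
  assume "(\<exists>F. represents F f) \<and> (\<forall>x. x \<notin> K \<longrightarrow> f x = 0)"
  then obtain F where F: "represents F f" and f: "\<And>x. x \<notin> K \<Longrightarrow> f x = 0" by blast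
  then have "f = (\<lambda>x. if x \<in> K then F x else 0)" by (auto simp: represents_def fun_eq_iff)
  with F show "f \<in> whitney_functions K"
    unfolding whitney_functions_def represents_def by blast
qed

lemma whitney_functions_lincomb:
  assumes "f \<in> whitney_functions K" "g \<in> whitney_functions K"
  shows "(\<lambda>x. a * f x + b * g x) \<in> whitney_functions K"
  using assms represents_lincomb unfolding whitney_functions_iff by fastforce

lemma zero_whitney: "(\<lambda>x. 0) \<in> whitney_functions K" "represents (\<lambda>x. 0) (\<lambda>x. 0)"
proof -
  show "represents (\<lambda>x. 0) (\<lambda>x. 0)" by (simp add: represents_def smooth_zero)
  then show "(\<lambda>x. 0) \<in> whitney_functions K" unfolding whitney_functions_iff by blast
qed

end

section \<open>Continuity of linear operators in terms of the seminorms\<close>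

lemma smooth_seminorm_upper:
  assumes "F \<in> smooth_functions" "k \<le> q" "\<bar>x\<bar> \<le> real q"
  shows "\<bar>hderiv k F x\<bar> \<le> smooth_seminorm q F"
proof -
  let ?A = "{\<bar>hderiv k F x\<bar> | k x. k \<le> q \<and> \<bar>x\<bar> \<le> real q}"
  obtain M where M: "\<forall>k\<le>q. \<forall>x\<in>{- real q..real q}. \<bar>hderiv k F x\<bar> \<le> M"
    using smooth_bounded_on_compact[OF assms(1), of "{- real q..real q}" q] by auto
  have bdd: "bdd_above ?A"
  proof (rule bdd_aboveI[of _ M])
    fix a assume "a \<in> ?A"
    then obtain k x where "a = \<bar>hderiv k F x\<bar>" "k \<le> q" "\<bar>x\<bar> \<le> real q" by blast
    moreover have "x \<in> {- real q..real q}" using \<open>\<bar>x\<bar> \<le> real q\<close> by auto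
    ultimately show "a \<le> M" using M by auto
  qed
  have "\<bar>hderiv k F x\<bar> \<in> ?A" using assms by blast
  then show ?thesis unfolding smooth_seminorm_def hderiv_def[symmetric] by (rule cSup_upper[OF _
      bdd])
qed

lemma smooth_seminorm_least:
  assumes "\<And>k x. k \<le> q \<Longrightarrow> \<bar>x\<bar> \<le> real q \<Longrightarrow> \<bar>hderiv k F x\<bar> \<le> M"
  shows "smooth_seminorm q F \<le> M"
  unfolding smooth_seminorm_def hderiv_def[symmetric]
proof (rule cSup_least)
  have "\<bar>hderiv 0 F 0\<bar> \<in> {\<bar>hderiv k F x\<bar> |k x. k \<le> q \<and> \<bar>x\<bar> \<le> real q}"
    by (rule CollectI) (use zero_le in fastforce)
  then show "{\<bar>hderiv k F x\<bar> |k x. k \<le> q \<and> \<bar>x\<bar> \<le> real q} \<noteq> {}" by blast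
qed (use assms in auto)

lemma smooth_seminorm_lincomb:
  assumes "F \<in> smooth_functions" "G \<in> smooth_functions"
  shows "smooth_seminorm q (\<lambda>x. a * F x + b * G x) \<le> \<bar>a\<bar> * smooth_seminorm q F + \<bar>b\<bar> *
      smooth_seminorm q G"
proof (rule smooth_seminorm_least)
  fix k x assume "k \<le> q" "\<bar>x\<bar> \<le> real q"
  then show "\<bar>hderiv k (\<lambda>x. a * F x + b * G x) x\<bar> \<le> \<bar>a\<bar> * smooth_seminorm q F + \<bar>b\<bar> *
      smooth_seminorm q G"
    unfolding smooth_lincomb(2)[OF assms]
    by (intro order_trans[OF abs_triangle_ineq] add_mono)
      (auto simp: abs_mult intro!: mult_left_mono smooth_seminorm_upper assms)
qed

lemma openin_seminorm_ball:
  assumes "f \<in> V" "e > 0"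
  shows "openin (seminorm_topology V p) {g \<in> V. p q (\<lambda>x. g x - f x) < e}"
  unfolding seminorm_topology_def
  by (rule topology_generated_by_Basis) (use assms in blast)

lemma topspace_seminorm:
  assumes "\<And>q. p q (\<lambda>x. 0) \<le> 0"
  shows "topspace (seminorm_topology V p) = V"
proof
  show "topspace (seminorm_topology V p) \<subseteq> V"
    unfolding seminorm_topology_def topology_generated_by_topspace by blast
  show "V \<subseteq> topspace (seminorm_topology V p)"
  proof
    fix f assume "f \<in> V"
    then have "f \<in> {g \<in> V. p 0 (\<lambda>x. g x - f x) < 1}" using assms[of 0] by simp
    with openin_seminorm_ball[OF \<open>f \<in> V\<close>, of 1 p 0] show "f \<in> topspace (seminorm_topology V p)"
      using openin_subset by fastforce
  qed
qed

text \<open>By induction over the generated topology; the triangle inequality puts a ball around 0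
  into any subbasic ball around \<open>f\<close> that contains 0.\<close>

lemma seminorm_nhd_zero:
  assumes "openin (seminorm_topology V p) U" "(\<lambda>x. 0) \<in> U"
    and triangle: "\<And>q f g. f \<in> V \<Longrightarrow> g \<in> V \<Longrightarrow> p q (\<lambda>x. g x - f x) \<le> p q g + p q (\<lambda>x. 0 - f x)"
  shows "\<exists>Q e. finite Q \<and> e > 0 \<and> {g \<in> V. \<forall>q\<in>Q. p q g < e} \<subseteq> U"
proof -
  have "generate_topology_on {{g \<in> V. p q (\<lambda>x. g x - f x) < e} | q f e. f \<in> V \<and> 0 < e} U"
    using assms(1) unfolding seminorm_topology_def openin_topology_generated_by_iff .
  then show ?thesis using assms(2)
  proof (induction rule: generate_topology_on.induct)
    case (Int a b)
    then obtain Q e Q' e' where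
      *: "finite Q" "e > 0" "{g \<in> V. \<forall>q\<in>Q. p q g < e} \<subseteq> a"
      "finite Q'" "e' > 0" "{g \<in> V. \<forall>q\<in>Q'. p q g < e'} \<subseteq> b" by auto
    then show ?case
      by (intro exI[of _ "Q \<union> Q'"] exI[of _ "min e e'"]) auto
  next
    case (UN S)
    then obtain s where "s \<in> S" "(\<lambda>x. 0) \<in> s" by blast
    with UN obtain Q e where "finite Q" "e > 0" "{g \<in> V. \<forall>q\<in>Q. p q g < e} \<subseteq> s" by blast
    with \<open>s \<in> S\<close> show ?case by blast
  next
    case (Basis s)
    then obtain q f e where s: "s = {g \<in> V. p q (\<lambda>x. g x - f x) < e}" "f \<in> V" by blast
    define e' where "e' = e - p q (\<lambda>x. 0 - f x)"
    have "e' > 0" using Basis s by (simp add: e'_def)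
    moreover have "{g \<in> V. \<forall>q\<in>{q}. p q g < e'} \<subseteq> s"
    proof
      fix g assume "g \<in> {g \<in> V. \<forall>q\<in>{q}. p q g < e'}"
      then have "g \<in> V" "p q g < e'" by auto
      with triangle[OF s(2) \<open>g \<in> V\<close>, of q] show "g \<in> s" by (simp add: s(1) e'_def)
    qed
    ultimately show ?case by blast
  qed simp
qed

lemma smooth_seminorm_zero: "smooth_seminorm q (\<lambda>x. 0) \<le> 0"
  by (rule smooth_seminorm_least) (simp add: smooth_zero)

context perfect_compact
begin

definition linear_op :: "((real \<Rightarrow> real) \<Rightarrow> (real \<Rightarrow> real)) \<Rightarrow> bool" where
  "linear_op W \<longleftrightarrow> (\<forall>f\<in>whitney_functions K. \<forall>g\<in>whitney_functions K. \<forall>a b.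
     W (\<lambda>x. a * f x + b * g x) = (\<lambda>x. a * W f x + b * W g x))"

lemma whitney_norm_zero: "whitney_norm K q (\<lambda>x. 0) \<le> 0"
  using whitney_norm_lincomb[OF zero_whitney(2) zero_whitney(2), of q 0 0] by simp

text \<open>Linearity turns the estimate for \<open>W f\<close> into one for
  \<open>W g - W f\<close>, so each subbasic ball around \<open>W f\<close> contains the image of a
  ball around \<open>f\<close>.\<close>

lemma continuous_if_estimate:
  assumes lin: "linear_op W" and smooth: "\<And>f. f \<in> whitney_functions K \<Longrightarrow> W f \<in> smooth_functions"
    and est: "\<And>q. \<exists>r C. \<forall>f\<in>whitney_functions K. smooth_seminorm q (W f) \<le> C * whitney_norm K r f"
  shows "continuous_map (whitney_topology K) smooth_topology W"
proof -
  let ?V = "whitney_functions K"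
  have top: "topspace (whitney_topology K) = ?V"
    unfolding whitney_topology_def by (rule topspace_seminorm) (rule whitney_norm_zero)
  have "openin (whitney_topology K) (W -` U \<inter> topspace (whitney_topology K))"
    if "U \<in> {{G \<in> smooth_functions. smooth_seminorm q (\<lambda>x. G x - F x) < e} | q F e. F \<in>
        smooth_functions \<and> 0 < e}"
    for U
  proof -
    from that obtain q F e where U: "U = {G \<in> smooth_functions. smooth_seminorm q (\<lambda>x. G x - F x)
        < e}"
      and F: "F \<in> smooth_functions" by blast
    obtain r C where C: "\<And>f. f \<in> ?V \<Longrightarrow> smooth_seminorm q (W f) \<le> C * whitney_norm K r f"
      using est by blast
    show ?thesis
    proof (subst openin_subopen, safe)
      fix f assume "W f \<in> U" "f \<in> topspace (whitney_topology K)"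
      then have f: "f \<in> ?V" and Wf: "W f \<in> smooth_functions" "smooth_seminorm q (\<lambda>x. W f x - F x)
          < e"
        using U top by auto
      define \<eta> where "\<eta> = (e - smooth_seminorm q (\<lambda>x. W f x - F x)) / (\<bar>C\<bar> + 1)"
      have \<eta>: "\<eta> > 0" using Wf(2) by (simp add: \<eta>_def)
      have "W g \<in> U" if g: "g \<in> ?V" "whitney_norm K r (\<lambda>x. g x - f x) < \<eta>" for g
      proof -
        have gf: "(\<lambda>x. g x - f x) \<in> ?V"
          using whitney_functions_lincomb[OF g(1) f, of 1 "-1"] by simp
        then obtain H where H: "represents H (\<lambda>x. g x - f x)" unfolding whitney_functions_iff by
            blast
        have "W (\<lambda>x. g x - f x) = (\<lambda>x. W g x - W f x)"
        proof -
          have "W (\<lambda>x. 1 * g x + (-1) * f x) = (\<lambda>x. 1 * W g x + (-1) * W f x)"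
            using lin g(1) f unfolding linear_op_def by blast
          then show ?thesis by simp
        qed
        moreover have "smooth_seminorm q (W (\<lambda>x. g x - f x)) \<le> \<bar>C\<bar> * whitney_norm K r (\<lambda>x. g x - f
            x)"
          using C[OF gf] mult_right_mono[OF abs_ge_self whitney_norm_nonneg[OF H], of C r] by
              linarith
        moreover have "\<bar>C\<bar> * whitney_norm K r (\<lambda>x. g x - f x) \<le> \<bar>C\<bar> * \<eta>"
          using g(2) by (intro mult_left_mono) auto
        moreover have "\<bar>C\<bar> * \<eta> < (\<bar>C\<bar> + 1) * \<eta>" using \<eta> by simp
        moreover have "(\<bar>C\<bar> + 1) * \<eta> = e - smooth_seminorm q (\<lambda>x. W f x - F x)"
          by (simp add: \<eta>_def)
        ultimately have 1: "smooth_seminorm q (\<lambda>x. W g x - W f x) < e - smooth_seminorm q (\<lambda>x. W f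
            x - F x)"
          by simp
        have "smooth_seminorm q (\<lambda>x. 1 * (W g x - W f x) + 1 * (W f x - F x)) \<le>
            \<bar>1\<bar> * smooth_seminorm q (\<lambda>x. W g x - W f x) + \<bar>1\<bar> * smooth_seminorm q (\<lambda>x. W f x - F x)"
          by (rule smooth_seminorm_lincomb) (use smooth g(1) Wf(1) F in \<open>auto intro!: smooth_diff\<close>)
        with 1 have "smooth_seminorm q (\<lambda>x. W g x - F x) < e" by simp
        with smooth[OF g(1)] show ?thesis by (simp add: U)
      qed
      moreover have "f \<in> {g \<in> ?V. whitney_norm K r (\<lambda>x. g x - f x) < \<eta>}"
        using f \<eta> whitney_norm_zero[of r] by simp
      moreover have "openin (whitney_topology K) {g \<in> ?V. whitney_norm K r (\<lambda>x. g x - f x) < \<eta>}"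
        unfolding whitney_topology_def by (rule openin_seminorm_ball[OF f \<eta>])
      ultimately show "\<exists>T. openin (whitney_topology K) T \<and> f \<in> T \<and> T \<subseteq> W -` U \<inter> topspace
          (whitney_topology K)"
        unfolding top by (intro exI[of _ "{g \<in> ?V. whitney_norm K r (\<lambda>x. g x - f x) < \<eta>}"]) auto
    qed
  qed
  moreover have "W ` topspace (whitney_topology K) \<subseteq>
      \<Union> {{G \<in> smooth_functions. smooth_seminorm q (\<lambda>x. G x - F x) < e} | q F e. F \<in>
          smooth_functions \<and> 0 < e}"
  proof (unfold top, safe)
    fix f assume f: "f \<in> ?V"
    have "W f \<in> {G \<in> smooth_functions. smooth_seminorm 0 (\<lambda>x. G x - W f x) < 1}"
      using smooth[OF f] smooth_seminorm_zero[of 0] by simp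
    then show "W f \<in> \<Union> {{G \<in> smooth_functions. smooth_seminorm q (\<lambda>x. G x - F x) < e} | q F e. F \<in>
        smooth_functions \<and> 0 < e}"
      using smooth[OF f] zero_less_one by blast
  qed
  ultimately show ?thesis
    unfolding smooth_topology_def seminorm_topology_def by (intro continuous_on_generated_topo) auto
qed

text \<open>The preimage of a unit ball contains a neighbourhood of 0 given by finitely many Whitney
  norms, all dominated by the sum of the norms up to their largest order. Scaling \<open>f\<close>
  into it gives the estimate.\<close>

lemma estimate_if_continuous:
  assumes cont: "continuous_map (whitney_topology K) smooth_topology W" and lin: "linear_op W"
  shows "\<exists>r C. \<forall>f\<in>whitney_functions K. smooth_seminorm q (W f) \<le> C * (\<Sum>i\<le>r. whitney_norm K i f)"
    and "f \<in> whitney_functions K \<Longrightarrow> W f \<in> smooth_functions"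
proof -
  let ?V = "whitney_functions K"
  have top: "topspace (whitney_topology K) = ?V"
    unfolding whitney_topology_def by (rule topspace_seminorm) (rule whitney_norm_zero)
  have top': "topspace smooth_topology = smooth_functions"
    unfolding smooth_topology_def by (rule topspace_seminorm) (rule smooth_seminorm_zero)
  show smooth: "W f \<in> smooth_functions" if "f \<in> ?V" for f
    using continuous_map_image_subset_topspace[OF cont] that unfolding top top' by blast
  have W0: "W (\<lambda>x. 0) = (\<lambda>x. 0)"
  proof -
    have "W (\<lambda>x. 0 * 0 + 0 * 0) = (\<lambda>x. 0 * W (\<lambda>x. 0) x + 0 * W (\<lambda>x. 0) x)"
      by (rule lin[unfolded linear_op_def, rule_format, OF zero_whitney(1) zero_whitney(1), of 0 0])
    then show ?thesis by simp
  qed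
  let ?U = "{G \<in> smooth_functions. smooth_seminorm q (\<lambda>x. G x - 0) < 1}"
  have "openin smooth_topology ?U"
    unfolding smooth_topology_def by (rule openin_seminorm_ball) (use smooth_zero in auto)
  then have op: "openin (whitney_topology K) {f \<in> ?V. W f \<in> ?U}"
    using openin_continuous_map_preimage[OF cont] unfolding top by blast
  have "(\<lambda>x. 0) \<in> {f \<in> ?V. W f \<in> ?U}"
    using zero_whitney W0 smooth_seminorm_zero[of q] smooth_zero(1) by simp
  moreover have "whitney_norm K q (\<lambda>x. g x - f x) \<le> whitney_norm K q g + whitney_norm K q (\<lambda>x. 0 -
      f x)"
    if fg: "f \<in> ?V" "g \<in> ?V" for q f g
  proof -
    obtain F G where F: "represents F f" and G: "represents G g"
      using fg unfolding whitney_functions_iff by blast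
    have "represents (\<lambda>x. 0 - F x) (\<lambda>x. 0 - f x)"
      using represents_lincomb[OF F F, of 0 "-1"] by simp
    from whitney_norm_lincomb[OF G this, of q 1 1] show ?thesis by simp
  qed
  ultimately obtain Q e where Q: "finite Q" "e > 0" "{g \<in> ?V. \<forall>q\<in>Q. whitney_norm K q g < e} \<subseteq> {f \<in>
      ?V. W f \<in> ?U}"
    using seminorm_nhd_zero[of ?V "whitney_norm K", OF op[unfolded whitney_topology_def]] by blast
  define r where "r = Max (insert 0 Q)"
  have "smooth_seminorm q (W f) \<le> 1 / e * (\<Sum>i\<le>r. whitney_norm K i f)" if f: "f \<in> ?V" for f
  proof -
    define N where "N = (\<Sum>i\<le>r. whitney_norm K i f)"
    obtain F where F: "represents F f" using f unfolding whitney_functions_iff by blast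
    note nn = whitney_norm_nonneg[OF F]
    have N0: "N \<ge> 0" unfolding N_def by (intro sum_nonneg nn)
    \<comment> \<open>The positive \<open>\<eta>\<close> avoids a division by \<open>N\<close>,
      which may be 0, and is sent to 0 afterwards.\<close>
    have "smooth_seminorm q (W f) \<le> (N + \<eta>) / e" if \<eta>: "\<eta> > 0" for \<eta>
    proof -
      define a where "a = e / (N + \<eta>)"
      have a: "a > 0" using N0 \<eta> Q(2) by (simp add: a_def)
      define g where "g = (\<lambda>x. a * f x + 0 * f x)"
      have g: "g \<in> ?V" unfolding g_def by (rule whitney_functions_lincomb[OF f f])
      have "whitney_norm K i g < e" if "i \<in> Q" for i
      proof -
        have "i \<le> r" unfolding r_def using Q(1) that by (intro Max_ge) auto
        then have "whitney_norm K i f \<le> N" unfolding N_def by (intro member_le_sum) (auto intro: nn)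
        then have "a * whitney_norm K i f \<le> a * N" using a by (intro mult_left_mono) auto
        also have "\<dots> < e" using N0 \<eta> Q(2) by (simp add: a_def field_simps)
        finally show ?thesis using whitney_norm_lincomb[OF F F, of i a 0] a by (simp add: g_def)
      qed
      then have Wg: "smooth_seminorm q (W g) < 1" using Q(3) g by auto
      have "W (\<lambda>x. (1 / a) * g x + 0 * g x) = (\<lambda>x. (1 / a) * W g x + 0 * W g x)"
        by (rule lin[unfolded linear_op_def, rule_format, OF g g])
      then have eq: "W f = (\<lambda>x. (1 / a) * W g x + 0 * W g x)"
        using a by (simp add: g_def)
      have "smooth_seminorm q (W f) \<le> \<bar>1 / a\<bar> * smooth_seminorm q (W g) + \<bar>0\<bar> * smooth_seminorm q
          (W g)"
        by (subst eq) (rule smooth_seminorm_lincomb[OF smooth[OF g] smooth[OF g]])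
      also have "\<dots> = 1 / a * smooth_seminorm q (W g)" using a by simp
      also have "\<dots> \<le> 1 / a * 1" using a Wg by (intro mult_left_mono) auto
      finally show ?thesis by (simp add: a_def)
    qed
    note bound = this
    have "smooth_seminorm q (W f) * e - N \<le> \<eta>" if "\<eta> > 0" for \<eta>
      using bound[OF that] Q(2) by (simp add: pos_le_divide_eq)
    then have "smooth_seminorm q (W f) * e - N \<le> 0" by (rule field_le_epsilon) auto
    then show ?thesis using Q(2) by (simp add: N_def field_simps)
  qed
  then show "\<exists>r C. \<forall>f\<in>?V. smooth_seminorm q (W f) \<le> C * (\<Sum>i\<le>r. whitney_norm K i f)" by blast
qed

end

section \<open>Decay of the scales and perfectness of the coded set\<close>

context cantor_coding
begin

lemma \<delta>_le_power: "\<delta> k \<le> (1 / 32) ^ k"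
proof (induction k)
  case (Suc k)
  then show ?case using \<delta>_Suc[of k] by simp
qed (simp add: \<delta>_0)

lemma \<delta>_antimono: "i \<le> j \<Longrightarrow> \<delta> j \<le> \<delta> i"
proof (induction j rule: dec_induct)
  case (step j)
  then show ?case using \<delta>_Suc[of j] \<delta>_pos[of j] by linarith
qed simp

lemma \<delta>_le_1: "\<delta> k \<le> 1"
  using \<delta>_antimono[of 0 k] \<delta>_0 by simp

lemma \<delta>_tendsto_0: "\<delta> \<longlonglongrightarrow> 0"
proof (rule tendsto_sandwich[OF _ _ tendsto_const])
  show "(\<lambda>k. (1 / 32 :: real) ^ k) \<longlonglongrightarrow> 0" by (intro LIMSEQ_realpow_zero) auto
qed (use \<delta>_le_power \<delta>_pos in \<open>auto intro!: always_eventually less_imp_le\<close>)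

lemma v_distinct:
  assumes "i \<noteq> j"
  shows "v i \<noteq> v j"
proof -
  have "n < 2 ^ Suc (i + j)" if "n \<le> i + j" for n
    using less_exp[of n] power_increasing[of n "Suc (i + j)" "2 :: nat"] that by linarith
  then have "i < 2 ^ Suc (i + j)" "j < 2 ^ Suc (i + j)" by auto
  then have "i mod 2 ^ Suc (i + j) \<noteq> j mod 2 ^ Suc (i + j)"
    using assms by simp
  from far[OF this] show ?thesis using \<delta>_pos[of "i + j"] by auto
qed

lemma inj_v: "inj v"
  unfolding inj_def using v_distinct by blast

lemma v_in_K: "v j \<in> K"
  unfolding K_closure using closure_subset[of "range v"] by auto

lemma K_approx:
  assumes "x \<in> K" "e > 0"
  shows "\<exists>j. \<bar>x - v j\<bar> < e"
  using assms unfolding K_closure closure_approachable by (auto simp: dist_real_def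
      abs_minus_commute)

lemma perfect_compact_K: "perfect_compact K"
proof
  show "compact K"
    unfolding K_closure compact_closure
    by (rule bounded_subset[of "{0..1}"]) (use v_range in auto)
  show "K \<noteq> {}" using v_in_K by blast
  fix x assume x: "x \<in> K"
  show "x islimpt K"
    unfolding islimpt_approachable
  proof (intro allI impI)
    fix e :: real assume e: "e > 0"
    have "(\<lambda>k. (C + 1) * \<delta> k) \<longlonglongrightarrow> (C + 1) * 0"
      by (intro tendsto_mult tendsto_const \<delta>_tendsto_0)
    then have "eventually (\<lambda>k. (C + 1) * \<delta> k < e) sequentially"
      using e by (intro order_tendstoD) auto
    then obtain k where k: "(C + 1) * \<delta> k < e" by (auto simp: eventually_sequentially)
    obtain j where j: "\<bar>x - v j\<bar> < \<delta> k" using K_approx[OF x \<delta>_pos] by blast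
    \<comment> \<open>The index \<open>j + 2 ^ k\<close> has the same \<open>k\<close> lowest digits
      as \<open>j\<close>. Of two distinct points near \<open>x\<close>, at least one differs from
      \<open>x\<close>.\<close>
    have nj: "\<bar>v (j + 2 ^ k) - v j\<bar> \<le> C * \<delta> k" by (rule near) simp
    have C: "0 \<le> C * \<delta> k" using C_ge_1 \<delta>_pos[of k] by simp
    have k': "C * \<delta> k + \<delta> k < e" using k by (simp add: distrib_right)
    have "dist (v j) x < e" "dist (v (j + 2 ^ k)) x < e"
      unfolding dist_real_def using j nj C k' by linarith+
    moreover have "v j \<noteq> v (j + 2 ^ k)" by (rule v_distinct) simp
    ultimately show "\<exists>x'\<in>K. x' \<noteq> x \<and> dist x' x < e" using v_in_K by metis
  qed
qed

end

sublocale cantor_coding \<subseteq> perfect_compact K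
  by (rule perfect_compact_K)

section \<open>Counting residues\<close>

lemma card_residue:
  fixes m r T :: nat
  assumes "r < m"
  shows "card {j. j < T \<and> j mod m = r} = T div m + (if r < T mod m then 1 else 0)"
proof (induction T)
  case (Suc T)
  have "{j. j < Suc T \<and> j mod m = r} =
      (if T mod m = r then insert T {j. j < T \<and> j mod m = r} else {j. j < T \<and> j mod m = r})"
    by (auto simp: less_Suc_eq)
  then have "card {j. j < Suc T \<and> j mod m = r} =
      card {j. j < T \<and> j mod m = r} + (if T mod m = r then 1 else 0)"
    by simp
  also have "\<dots> = Suc T div m + (if r < Suc T mod m then 1 else 0)"
    unfolding Suc using assms mod_less_divisor[of m T] by (auto simp: div_Suc mod_Suc)
  finally show ?case .
qed simp

lemma card_residue_bounds:
  fixes m T :: nat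
  assumes "m > 0"
  shows "T div m \<le> card {j. j < T \<and> j mod m = a mod m}"
    and "card {j. j < Suc T \<and> j mod m = a mod m} \<le> T div m + 1"
proof -
  have a: "a mod m < m" using assms by simp
  show "T div m \<le> card {j. j < T \<and> j mod m = a mod m}"
    unfolding card_residue[OF a] by simp
  show "card {j. j < Suc T \<and> j mod m = a mod m} \<le> T div m + 1"
    unfolding card_residue[OF a] by (auto simp: div_Suc mod_Suc)
qed

lemma mod_power_mono:
  fixes i j :: nat
  assumes "i mod 2 ^ l = j mod 2 ^ l" "k \<le> l"
  shows "i mod 2 ^ k = j mod 2 ^ k"
  using assms by (metis le_imp_power_dvd mod_mod_cancel)

lemma card_residue_power:
  fixes a k t :: nat
  assumes "k \<le> t"
  shows "card {j. j < 2 ^ t \<and> j mod 2 ^ k = a mod 2 ^ k} = (2 :: nat) ^ (t - k)"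
proof -
  have "(2 :: nat) ^ t mod 2 ^ k = 0" "(2 :: nat) ^ t div 2 ^ k = 2 ^ (t - k)"
    using assms by (auto simp: le_imp_power_dvd power_diff)
  then show ?thesis
    by (subst card_residue) auto
qed

text \<open>The number of common lowest binary digits, cut off at \<open>t\<close>; by
  \<open>near\<close> and \<open>far\<close> it determines the distance of \<open>v j\<close> and
  \<open>v a\<close> up to constants, down to scale \<open>\<delta> t\<close>.\<close>

definition agree :: "nat \<Rightarrow> nat \<Rightarrow> nat \<Rightarrow> nat" where
  "agree t a j = Max {k. k \<le> t \<and> j mod 2 ^ k = a mod 2 ^ k}"

lemma agree_le: "agree t a j \<le> t"
  and le_agree_iff: "k \<le> t \<Longrightarrow> k \<le> agree t a j \<longleftrightarrow> j mod 2 ^ k = a mod 2 ^ k"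
proof -
  let ?A = "{k. k \<le> t \<and> j mod 2 ^ k = a mod 2 ^ k}"
  have fin: "finite ?A" "0 \<in> ?A" by auto
  then have in_A: "agree t a j \<in> ?A" unfolding agree_def by (intro Max_in) auto
  then show "agree t a j \<le> t" by simp
  assume "k \<le> t"
  show "k \<le> agree t a j \<longleftrightarrow> j mod 2 ^ k = a mod 2 ^ k"
  proof
    show "j mod 2 ^ k = a mod 2 ^ k" if "k \<le> agree t a j"
      by (rule mod_power_mono[OF _ that]) (use in_A in blast)
    show "k \<le> agree t a j" if "j mod 2 ^ k = a mod 2 ^ k"
      unfolding agree_def by (rule Max_ge) (use fin(1) that \<open>k \<le> t\<close> in auto)
  qed
qed

text \<open>The binary length of \<open>i\<close>. Among the nodes of a residue class with indices
  below \<open>2 ^ t\<close>, ordered by distance from one of them, the i-th lies at scale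
  \<open>\<delta> (t - blen i)\<close>.\<close>

definition blen :: "nat \<Rightarrow> nat" where
  "blen i = (LEAST l. i < 2 ^ l)"

lemma blen_le_iff: "blen i \<le> l \<longleftrightarrow> i < 2 ^ l"
proof
  have "i < 2 ^ blen i" unfolding blen_def by (rule LeastI[of _ i]) (rule less_exp)
  also assume "blen i \<le> l"
  then have "(2 :: nat) ^ blen i \<le> 2 ^ l" by (rule power_increasing) simp
  finally show "i < 2 ^ l" .
qed (auto simp: blen_def intro: Least_le)

lemma blen_mono: "i \<le> j \<Longrightarrow> blen i \<le> blen j"
  using blen_le_iff[of j "blen j"] blen_le_iff[of i "blen j"] by simp

lemma blen_block: "2 ^ l \<le> i \<Longrightarrow> i < 2 ^ Suc l \<Longrightarrow> blen i = Suc l"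
  using blen_le_iff[of i "Suc l"] blen_le_iff[of i l] by simp

lemma blen_0: "blen 0 = 0"
  using blen_le_iff[of 0 0] by simp

lemma prod_blen:
  fixes g :: "nat \<Rightarrow> real"
  assumes "a \<le> c"
  shows "(\<Prod>i=2^a..<2^c. g (blen i)) = (\<Prod>l=a..<c. g (Suc l) ^ 2 ^ l)"
  using assms
proof (induction c rule: dec_induct)
  case (step c)
  have "(\<Prod>i=2^a..<2^Suc c. g (blen i)) = (\<Prod>i=2^a..<2^c. g (blen i)) * (\<Prod>i=2^c..<2^Suc c. g (blen
      i))"
    by (rule prod.atLeastLessThan_concat[symmetric]) (use step.hyps in \<open>auto intro:
        power_increasing\<close>)
  also have "(\<Prod>i=2^c..<2^Suc c. g (blen i)) = (\<Prod>i\<in>{2^c..<(2::nat)^Suc c}. g (Suc c))"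
    by (rule prod.cong) (auto simp del: power_Suc intro!: arg_cong[of _ _ g] blen_block)
  also have "\<dots> = g (Suc c) ^ 2 ^ c" by simp
  finally show ?case unfolding step.IH using step.hyps by simp
qed simp

section \<open>Interpolation error on the Cantor set\<close>

context cantor_coding
begin

lemma dist_le_agree: "\<bar>v j - v a\<bar> \<le> C * \<delta> (agree t a j)"
  by (rule near) (use le_agree_iff[of "agree t a j" t a j] agree_le in simp)

lemma dist_ge_agree:
  assumes "agree t a j < t"
  shows "\<bar>v j - v a\<bar> \<ge> \<delta> (agree t a j) / 2"
  by (rule far) (use le_agree_iff[of "Suc (agree t a j)" t a j] assms in simp)

definition weight :: "nat \<Rightarrow> real" where
  "weight k = ln (1 / \<delta> k) / 2 ^ (k + 1)"

lemma weight_nonneg: "weight k \<ge> 0"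
  unfolding weight_def using \<delta>_pos[of k] \<delta>_le_1[of k] by simp

lemma weight_pos: "k \<ge> 1 \<Longrightarrow> weight k > 0"
proof -
  assume "k \<ge> 1"
  then have "\<delta> k \<le> 1 / 32" using \<delta>_antimono[of 1 k] \<delta>_Suc[of 0] \<delta>_0 by simp
  then show ?thesis unfolding weight_def using \<delta>_pos[of k] by simp
qed

lemma ln_\<delta>: "ln (\<delta> k) = - (2 ^ (k + 1) * weight k)"
  unfolding weight_def using \<delta>_pos[of k] by (simp add: ln_div)

text \<open>The dyadic block of indices from \<open>2 ^ l\<close> has \<open>2 ^ l\<close> equal
  factors, and this number cancels against the normalisation of \<open>weight\<close>: each level
  enters the logarithm with the same coefficient \<open>2 ^ t\<close>. This is where the sums of the
  \<open>B\<close> come from.\<close>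

lemma ln_prod_blen:
  assumes "a \<le> c" "c \<le> t"
  shows "ln (\<Prod>i=2^a..<2^c. \<delta> (t - blen i)) = - (2 ^ t * (\<Sum>k=t-c..<t-a. weight k))"
proof -
  have "ln (\<Prod>i=2^a..<2^c. \<delta> (t - blen i)) = ln (\<Prod>l=a..<c. \<delta> (t - Suc l) ^ 2 ^ l)"
    by (subst prod_blen[OF assms(1), of "\<lambda>l. \<delta> (t - l)"]) simp
  also have "\<dots> = (\<Sum>l=a..<c. ln (\<delta> (t - Suc l) ^ 2 ^ l))"
    by (rule ln_prod) (simp_all add: \<delta>_pos less_imp_neq[OF \<delta>_pos, symmetric])
  also have "\<dots> = (\<Sum>l=a..<c. - (2 ^ t * weight (t - Suc l)))"
  proof (rule sum.cong)
    fix l assume "l \<in> {a..<c}"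
    then have "l < t" using assms by simp
    then have "(2 :: real) ^ l * 2 ^ (t - Suc l + 1) = 2 ^ t"
      by (simp flip: power_add del: power_Suc)
    then show "ln (\<delta> (t - Suc l) ^ 2 ^ l) = - (2 ^ t * weight (t - Suc l))"
      using \<delta>_pos[of "t - Suc l"] by (simp add: ln_realpow ln_\<delta> mult.assoc[symmetric] del:
          power_Suc)
  qed simp
  also have "\<dots> = - (2 ^ t * (\<Sum>l=a..<c. weight (t - Suc l)))"
    by (simp add: sum_negf sum_distrib_left)
  also have "(\<Sum>l=a..<c. weight (t - Suc l)) = (\<Sum>k=t-c..<t-a. weight k)"
    by (rule sum.reindex_bij_witness[of _ "\<lambda>k. t - Suc k" "\<lambda>l. t - Suc l"]) (use assms in auto)
  finally show ?thesis .
qed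

text \<open>The index 0 contributes an additional \<open>\<delta> t\<close>, which counts as
  \<open>2 * weight t\<close> and covers the last summand. The factor 2 in \<open>2 * P\<close>
  comes from the exponent \<open>t + 1\<close> in \<open>ln_\<delta>\<close>.\<close>

lemma prod_blen_le_power:
  assumes "m \<le> t" "real (2 * P) * weight t \<le> (\<Sum>k=t-m..t. weight k)"
  shows "(\<Prod>i<2^m. \<delta> (t - blen i)) \<le> \<delta> t ^ P"
proof -
  have pos: "(\<Prod>i<2^m. \<delta> (t - blen i)) > 0" "\<delta> t ^ P > 0" "(\<Prod>i=2^0..<2^m. \<delta> (t - blen i)) > 0"
    using \<delta>_pos by (auto intro!: prod_pos)
  have split: "{..<2^m} = insert 0 {1..<(2::nat)^m}" by auto
  have "(\<Prod>i<2^m. \<delta> (t - blen i)) = \<delta> t * (\<Prod>i=2^0..<2^m. \<delta> (t - blen i))"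
    unfolding split by (simp add: blen_0)
  then have "ln (\<Prod>i<2^m. \<delta> (t - blen i)) = ln (\<delta> t) + ln (\<Prod>i=2^0..<2^m. \<delta> (t - blen i))"
    using ln_mult_pos[OF \<delta>_pos pos(3)] by (simp only:)
  also have "\<dots> = - (2 ^ t * (2 * weight t + (\<Sum>k=t-m..<t. weight k)))"
    by (subst ln_prod_blen) (use assms(1) in \<open>auto simp: ln_\<delta> algebra_simps\<close>)
  also have "\<dots> \<le> - (2 ^ t * (real (2 * P) * weight t))"
  proof -
    have "(\<Sum>k=t-m..t. weight k) = (\<Sum>k=t-m..<t. weight k) + weight t"
      by (simp add: sum.last_plus atLeastLessThanSuc_atLeastAtMost[symmetric] add.commute)
    then show ?thesis using assms(2) weight_nonneg[of t] by (intro le_imp_neg_le mult_left_mono)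
        auto
  qed
  also have "\<dots> = ln (\<delta> t ^ P)"
    using \<delta>_pos[of t] by (simp add: ln_realpow ln_\<delta>)
  finally show ?thesis using ln_le_cancel_iff[OF pos(1,2)] by simp
qed

text \<open>The \<open>i\<close>-th nearest node cancels the \<open>i\<close>-th denominator of the elimination, up to the first
  \<open>r\<close> nodes. This needs that no residue class contains many more nodes than the class of \<open>a\<close>.\<close>

lemma divdiff_times_nodal_le:
  fixes t a b m :: nat
  assumes Y: "finite Y" "b \<notin> Y" and m: "m \<le> t"
    and dom: "\<And>k a'. card {j\<in>insert b Y. j mod 2 ^ k = a' mod 2 ^ k} \<le>
      card {j\<in>Y. j mod 2 ^ k = a mod 2 ^ k} + 1"
    and top: "card {j\<in>Y. j mod 2 ^ t = a mod 2 ^ t} \<le> 2 ^ m"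
    and deep: "\<And>k. k \<le> m \<Longrightarrow> 2 ^ k \<le> card {j\<in>Y. j mod 2 ^ (t - k) = a mod 2 ^ (t - k)}"
    and base: "\<And>Z. Z \<subseteq> v ` insert b Y \<Longrightarrow> card Z = Suc (2 ^ m) \<Longrightarrow> \<bar>divdiff f Z\<bar> \<le> A"
    and A: "A \<ge> 0" and x: "\<bar>x - v a\<bar> \<le> 3 * C * \<delta> t"
  shows "\<bar>divdiff f (v ` insert b Y)\<bar> * (\<Prod>y\<in>v ` Y. max \<bar>x - y\<bar> (\<delta> t)) \<le>
    A * (16 * C) ^ card Y * (\<Prod>i<2^m. \<delta> (t - blen i))"
proof -
  define N where "N = card Y"
  define r :: nat where "r = 2 ^ m"
  have rN: "r \<le> N"
    unfolding r_def N_def using deep[of m] by (rule order_trans[OF _ card_mono]) (use Y in auto)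
  \<comment> \<open>Nodes are numbered by decreasing agreement with \<open>a\<close>, that is,
    essentially by increasing distance from \<open>v a\<close>.\<close>
  obtain js where bij: "bij_betw js {..<N} Y" and
    js: "\<And>i k. i < N \<Longrightarrow> k \<le> agree t a (js i) \<longleftrightarrow> i < card {j\<in>Y. k \<le> agree t a j}"
    using enumerate_by_level[OF Y(1), of "agree t a"] unfolding N_def by blast
  define ka where "ka i = agree t a (js i)" for i
  have cls: "{j\<in>Y. k \<le> agree t a j} = {j\<in>Y. j mod 2 ^ k = a mod 2 ^ k}" if "k \<le> t" for k
    using le_agree_iff[OF that] by simp
  have ka_t: "ka i < t" and ka_count: "card {j\<in>Y. j mod 2 ^ Suc (ka i) = a mod 2 ^ Suc (ka i)} \<le> i"
    if i: "r \<le> i" "i < N" for i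
  proof -
    have "\<not> t \<le> ka i" unfolding ka_def js[OF i(2)] cls[OF order_refl] using top i(1) by (simp add:
        r_def)
    then show kt: "ka i < t" by simp
    have "\<not> Suc (ka i) \<le> agree t a (js i)" by (simp add: ka_def)
    then show "card {j\<in>Y. j mod 2 ^ Suc (ka i) = a mod 2 ^ Suc (ka i)} \<le> i"
      unfolding js[OF i(2)] using cls[of "Suc (ka i)"] kt by simp
  qed
  have ka_deep: "\<delta> (ka i) \<le> \<delta> (t - blen i)" if "i < r" for i
  proof (rule \<delta>_antimono)
    have bm: "blen i \<le> m" using that by (simp add: blen_le_iff r_def)
    have "i < 2 ^ blen i" using blen_le_iff by blast
    also have "\<dots> \<le> card {j\<in>Y. t - blen i \<le> agree t a j}"
      using deep[OF bm] by (subst cls) auto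
    finally show "t - blen i \<le> ka i"
      unfolding ka_def using js[of i "t - blen i"] that rN by simp
  qed
  have "\<bar>divdiff f (v ` insert b Y)\<bar> \<le> A * (\<Prod>i=r..<N. 2 / (\<delta> (ka i) / 2))"
  proof (rule divdiff_elimination[of _ N r])
    show "finite (v ` insert b Y)" using Y by simp
    have card_v: "card (v ` S) = card S" for S by (rule card_image) (rule inj_on_subset[OF inj_v
        subset_UNIV])
    show "card (v ` insert b Y) = Suc N" unfolding card_v using Y by (simp add: N_def)
    show "\<exists>y\<in>Z. \<exists>z\<in>Z. \<delta> (ka i) / 2 \<le> \<bar>y - z\<bar>"
      if Z: "Z \<subseteq> v ` insert b Y" "card Z = Suc (Suc i)" and ri: "r \<le> i" for Z i
    \<comment> \<open>Otherwise all \<open>i + 2\<close> points of \<open>Z\<close> lie in one class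
      modulo \<open>2 ^ Suc (ka i)\<close>. By \<open>dom\<close> that class has at most one element
      more than the class of \<open>a\<close>, which has at most \<open>i\<close> in
      \<open>Y\<close>.\<close>
    proof (rule ccontr)
      assume neg: "\<not> ?thesis"
      obtain J where J: "J \<subseteq> insert b Y" "Z = v ` J" using Z(1) by (metis subset_imageE)
      have cJ: "card J = Suc (Suc i)" using Z(2) J(2) card_v by simp
      have "card J \<le> card (insert b Y)" using J(1) Y by (intro card_mono) auto
      then have "i < N" using cJ Y by (simp add: N_def)
      have "J \<noteq> {}" using cJ by auto
      then obtain a' where a': "a' \<in> J" by blast
      have "j mod 2 ^ Suc (ka i) = a' mod 2 ^ Suc (ka i)" if "j \<in> J" for j
        using far[of j "ka i" a'] neg that a' J(2) by blast
      then have "J \<subseteq> {j\<in>insert b Y. j mod 2 ^ Suc (ka i) = a' mod 2 ^ Suc (ka i)}" using J(1) by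
          blast
      then have "card J \<le> card {j\<in>insert b Y. j mod 2 ^ Suc (ka i) = a' mod 2 ^ Suc (ka i)}"
        using Y by (intro card_mono) auto
      also have "\<dots> \<le> card {j\<in>Y. j mod 2 ^ Suc (ka i) = a mod 2 ^ Suc (ka i)} + 1" by (rule dom)
      also have "\<dots> \<le> i + 1" using ka_count[OF ri \<open>i < N\<close>] by simp
      finally show False using cJ by simp
    qed
  qed (use rN A base \<delta>_pos in \<open>auto simp: r_def\<close>)
  moreover have "(\<Prod>y\<in>v ` Y. max \<bar>x - y\<bar> (\<delta> t)) \<le> (\<Prod>i<N. 4 * C * \<delta> (ka i))"
  proof -
    have "(\<Prod>y\<in>v ` Y. max \<bar>x - y\<bar> (\<delta> t)) = (\<Prod>j\<in>Y. max \<bar>x - v j\<bar> (\<delta> t))"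
      by (rule prod.reindex_cong[of v]) (use inj_on_subset[OF inj_v subset_UNIV] in auto)
    also have "\<dots> = (\<Prod>i<N. max \<bar>x - v (js i)\<bar> (\<delta> t))"
      by (rule prod.reindex_bij_betw[OF bij, symmetric])
    \<comment> \<open>The factor 4 is 3 for the position of \<open>x\<close> relative to
      \<open>v a\<close> and 1 for the distance from \<open>v a\<close> to the node.\<close>
    also have "\<dots> \<le> (\<Prod>i<N. 4 * C * \<delta> (ka i))"
    proof (rule prod_mono, safe)
      fix i
      show "0 \<le> max \<bar>x - v (js i)\<bar> (\<delta> t)" by simp
      have dt: "\<delta> t \<le> \<delta> (ka i)" unfolding ka_def by (rule \<delta>_antimono[OF agree_le])
      have "\<bar>x - v a\<bar> \<le> 3 * (C * \<delta> t)" using x by (simp add: mult.assoc)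
      moreover have "C * \<delta> t \<le> C * \<delta> (ka i)" "\<delta> (ka i) \<le> C * \<delta> (ka i)"
        using dt C_ge_1 \<delta>_pos[of "ka i"] by (auto intro: mult_left_mono)
      moreover have "\<bar>v (js i) - v a\<bar> \<le> C * \<delta> (ka i)" unfolding ka_def by (rule dist_le_agree)
      ultimately have "\<bar>x - v (js i)\<bar> \<le> 4 * (C * \<delta> (ka i))" "\<delta> t \<le> 4 * (C * \<delta> (ka i))"
        using dt \<delta>_pos[of "ka i"] by linarith+
      then show "max \<bar>x - v (js i)\<bar> (\<delta> t) \<le> 4 * C * \<delta> (ka i)" by (simp add: mult.assoc)
    qed
    finally show ?thesis .
  qed
  ultimately have "\<bar>divdiff f (v ` insert b Y)\<bar> * (\<Prod>y\<in>v ` Y. max \<bar>x - y\<bar> (\<delta> t)) \<le>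
      (A * (\<Prod>i=r..<N. 2 / (\<delta> (ka i) / 2))) * (\<Prod>i<N. 4 * C * \<delta> (ka i))"
    by (intro mult_mono) (use A \<delta>_pos in \<open>auto intro!: prod_nonneg mult_nonneg_nonneg simp:
        less_imp_le le_max_iff_disj\<close>)
  also have "\<dots> = A * ((\<Prod>i=r..<N. 2 / (\<delta> (ka i) / 2) * (4 * C * \<delta> (ka i))) * (\<Prod>i<r. 4 * C * \<delta> (ka
      i)))"
  proof -
    have "(\<Prod>i<N. 4 * C * \<delta> (ka i)) = (\<Prod>i<r. 4 * C * \<delta> (ka i)) * (\<Prod>i=r..<N. 4 * C * \<delta> (ka i))"
      unfolding lessThan_atLeast0 by (rule prod.atLeastLessThan_concat[OF _ rN, symmetric]) simp
    moreover have "(A * p) * (q * p') = A * ((p * p') * q)" for p q p' :: real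
      by (simp only: mult_ac)
    ultimately show ?thesis unfolding prod.distrib[of "\<lambda>i. 2 / (\<delta> (ka i) / 2)"] by (simp only:)
  qed
  \<comment> \<open>The denominators of the elimination cancel the distances; only the
    \<open>r\<close> smallest distances survive.\<close>
  also have "(\<Prod>i=r..<N. 2 / (\<delta> (ka i) / 2) * (4 * C * \<delta> (ka i))) = (16 * C) ^ (N - r)"
  proof -
    have "2 / (\<delta> (ka i) / 2) * (4 * C * \<delta> (ka i)) = 16 * C" for i
      using \<delta>_pos[of "ka i"] by simp
    then show ?thesis by simp
  qed
  also have "A * ((16 * C) ^ (N - r) * (\<Prod>i<r. 4 * C * \<delta> (ka i))) \<le>
      A * ((16 * C) ^ (N - r) * ((16 * C) ^ r * (\<Prod>i<r. \<delta> (t - blen i))))"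
  proof (intro mult_left_mono)
    have "(\<Prod>i<r. 4 * C * \<delta> (ka i)) \<le> (\<Prod>i<r. 16 * C * \<delta> (t - blen i))"
    proof (rule prod_mono)
      fix i assume "i \<in> {..<r}"
      then have "4 * C * \<delta> (ka i) \<le> 16 * C * \<delta> (t - blen i)"
        using ka_deep[of i] C_ge_1 \<delta>_pos[of "ka i"] by (intro mult_mono) auto
      then show "0 \<le> 4 * C * \<delta> (ka i) \<and> 4 * C * \<delta> (ka i) \<le> 16 * C * \<delta> (t - blen i)"
        using C_ge_1 \<delta>_pos[of "ka i"] by simp
    qed
    then show "(\<Prod>i<r. 4 * C * \<delta> (ka i)) \<le> (16 * C) ^ r * (\<Prod>i<r. \<delta> (t - blen i))"
      by (simp add: prod.distrib)
  qed (use A C_ge_1 in auto)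
  also have "\<dots> = A * (16 * C) ^ card Y * (\<Prod>i<2^m. \<delta> (t - blen i))"
  proof -
    have "(16 * C) ^ (N - r) * ((16 * C) ^ r * p) = (16 * C) ^ N * p" for p
      using rN by (simp only: mult.assoc[symmetric] power_add[symmetric] le_add_diff_inverse2)
    then show ?thesis by (simp only: N_def r_def mult.assoc)
  qed
  finally show ?thesis .
qed

end

section \<open>Necessity\<close>

text \<open>The divided difference on \<open>q + 1\<close> points with spacing \<open>h\<close>
  yields some point where the q-th derivative is of order \<open>M / h ^ q\<close>; the mean value
  theorem carries this to \<open>z\<close> at the cost of \<open>q * h\<close> times the next
  derivative.\<close>

lemma intermediate_derivative_step:
  assumes g: "g \<in> smooth_functions" and h: "0 < h" "real q * h \<le> 1 / 2"
    and M: "\<And>x. x \<in> {0..1} \<Longrightarrow> \<bar>g x\<bar> \<le> M" "\<And>x. x \<in> {0..1} \<Longrightarrow> \<bar>hderiv (Suc q) g x\<bar> \<le> M'"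
    and z: "z \<in> {0..1}"
  shows "\<bar>hderiv q g z\<bar> \<le> fact q * (real q + 1) * (M / h ^ q) + real q * (h * M')"
proof -
  \<comment> \<open>The points run from \<open>z\<close> towards the middle of [0, 1], where a
    length of 1/2 is available.\<close>
  define \<sigma> :: real where "\<sigma> = (if z \<le> 1 / 2 then 1 else -1)"
  define lo hi where "lo = min z (z + \<sigma> * (real q * h))" and "hi = max z (z + \<sigma> * (real q * h))"
  define X where "X = (\<lambda>i. z + \<sigma> * (real i * h)) ` {..q}"
  have inj: "inj_on (\<lambda>i. z + \<sigma> * (real i * h)) {..q}"
    using h by (auto simp: inj_on_def \<sigma>_def)
  have X: "finite X" "card X = Suc q" unfolding X_def using card_image[OF inj] by auto
  define w where "w = real q * h"
  have "0 \<le> w" "w \<le> 1 / 2" using h by (simp_all add: w_def)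
  with z have lohi: "lo \<ge> 0" "hi \<le> 1" "hi - lo \<le> real q * h"
    unfolding lo_def hi_def \<sigma>_def w_def[symmetric] by auto
  have Xsub: "X \<subseteq> {lo..hi}"
  proof
    fix x assume "x \<in> X"
    then obtain i where i: "i \<le> q" "x = z + \<sigma> * (real i * h)" unfolding X_def by blast
    have "0 \<le> real i * h" "real i * h \<le> w"
      unfolding w_def using h i(1) by (auto intro: mult_right_mono)
    then show "x \<in> {lo..hi}"
      unfolding i(2) lo_def hi_def \<sigma>_def w_def[symmetric] by auto
  qed
  obtain \<eta> where \<eta>: "\<eta> \<in> {lo..hi}" "divdiff g X = hderiv q g \<eta> / fact q"
    using divdiff_mean_value[OF g X Xsub] by blast
  have "\<bar>divdiff g X\<bar> \<le> (\<Sum>x\<in>X. M / h ^ q)"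
    unfolding divdiff_def
  proof (rule order_trans[OF sum_abs], rule sum_mono)
    fix x assume x: "x \<in> X"
    have "h ^ q = (\<Prod>y\<in>X - {x}. h)" using X x by simp
    also have "\<dots> \<le> (\<Prod>y\<in>X - {x}. \<bar>x - y\<bar>)"
    proof (rule prod_mono, safe)
      fix y assume y: "y \<in> X" "y \<noteq> x"
      obtain i j where ij: "x = z + \<sigma> * (real i * h)" "y = z + \<sigma> * (real j * h)"
        using x y unfolding X_def by blast
      have "x - y = \<sigma> * ((real i - real j) * h)" using ij by (simp add: algebra_simps)
      then have "\<bar>x - y\<bar> = \<bar>real i - real j\<bar> * h" using h by (simp add: abs_mult \<sigma>_def)
      moreover have "i \<noteq> j" using ij y by auto
      then have "\<bar>real i - real j\<bar> \<ge> 1" by linarith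
      ultimately show "h \<le> \<bar>x - y\<bar>" using h by simp
    qed (use h in auto)
    finally have "h ^ q \<le> \<bar>\<Prod>y\<in>X - {x}. x - y\<bar>" by (simp add: abs_prod)
    moreover have "\<bar>g x\<bar> \<le> M" using M(1)[of x] x Xsub lohi by auto
    ultimately show "\<bar>g x / (\<Prod>y\<in>X - {x}. x - y)\<bar> \<le> M / h ^ q"
      unfolding abs_divide using h by (intro frac_le) auto
  qed
  also have "\<dots> = (real q + 1) * (M / h ^ q)" using X by simp
  finally have "\<bar>divdiff g X\<bar> * fact q \<le> (real q + 1) * (M / h ^ q) * fact q"
    by (rule mult_right_mono) simp
  then have 1: "\<bar>hderiv q g \<eta>\<bar> \<le> fact q * (real q + 1) * (M / h ^ q)"
    using \<eta>(2) by (simp add: mult_ac)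
  obtain t where t: "t \<in> {min z \<eta>..max z \<eta>}"
    "hderiv q g z - taylor_fun (\<lambda>j. hderiv (q + j) g \<eta>) 1 \<eta> z = hderiv (q + 1) g t / fact 1 * (z -
        \<eta>) ^ 1"
    using taylor_remainder[OF g, of z \<eta> q 1] by blast
  then have eq: "hderiv q g z = hderiv q g \<eta> + hderiv (Suc q) g t * (z - \<eta>)"
    by (simp add: taylor_fun_def)
  have zlh: "z \<in> {lo..hi}" by (auto simp: lo_def hi_def)
  have "t \<in> {0..1}" using t(1) \<eta>(1) zlh lohi by (auto simp: min_def max_def split: if_splits)
  then have "\<bar>hderiv (Suc q) g t\<bar> * \<bar>z - \<eta>\<bar> \<le> M' * (real q * h)"
    using M(2) \<eta>(1) zlh lohi by (intro mult_mono) (auto intro: order_trans[OF abs_ge_zero])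
  with 1 show ?thesis unfolding eq
    by (intro order_trans[OF abs_triangle_ineq]) (simp add: abs_mult mult_ac)
qed

text \<open>Iterates the one-step estimate downwards from order \<open>q + d\<close>: the bound for
  order \<open>q + 1\<close>, multiplied by \<open>h\<close>, has exactly the form of the bound for
  order \<open>q\<close>.\<close>

lemma intermediate_derivative:
  "\<exists>A\<ge>0. \<forall>g h M M'. g \<in> smooth_functions \<longrightarrow> 0 < h \<longrightarrow> real (q + d) * h \<le> 1 / 2 \<longrightarrow>
    (\<forall>x\<in>{0..1}. \<bar>g x\<bar> \<le> M) \<longrightarrow> (\<forall>x\<in>{0..1}. \<bar>hderiv (q + d) g x\<bar> \<le> M') \<longrightarrow>
    (\<forall>x\<in>{0..1}. \<bar>hderiv q g x\<bar> \<le> A * (M / h ^ q + h ^ d * M'))"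
proof (induction d arbitrary: q)
  case 0
  have "\<bar>hderiv q g x\<bar> \<le> 1 * (M / h ^ q + h ^ 0 * M')"
    if "0 < h" "\<forall>x\<in>{0..1}. \<bar>g x\<bar> \<le> M" "\<forall>x\<in>{0..1}. \<bar>hderiv (q + 0) g x\<bar> \<le> M'" "x \<in> {0..1}"
    for g h M M' and x :: real
  proof -
    have "0 \<le> M" using that(2,4) abs_ge_zero order_trans by blast
    then have "0 \<le> M / h ^ q" using that(1) by simp
    moreover have "\<bar>hderiv q g x\<bar> \<le> M'" using that(3,4) by simp
    ultimately show ?thesis by simp
  qed
  then show ?case by (intro exI[of _ 1]) auto
next
  case (Suc d)
  obtain A where A: "A \<ge> 0" "\<And>g h M M' x. g \<in> smooth_functions \<Longrightarrow> 0 < h \<Longrightarrow> real (Suc q + d) * h \<le> 1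
      / 2 \<Longrightarrow>
    (\<forall>x\<in>{0..1}. \<bar>g x\<bar> \<le> M) \<Longrightarrow> (\<forall>x\<in>{0..1}. \<bar>hderiv (Suc q + d) g x\<bar> \<le> M') \<Longrightarrow>
    x \<in> {0..1} \<Longrightarrow> \<bar>hderiv (Suc q) g x\<bar> \<le> A * (M / h ^ Suc q + h ^ d * M')"
    using Suc.IH[of "Suc q"] by blast
  define A' where "A' = fact q * (real q + 1) + real q * A"
  have "\<bar>hderiv q g x\<bar> \<le> A' * (M / h ^ q + h ^ Suc d * M')"
    if g: "g \<in> smooth_functions" and h: "0 < h" "real (q + Suc d) * h \<le> 1 / 2"
    and M: "\<forall>x\<in>{0..1}. \<bar>g x\<bar> \<le> M" and M': "\<forall>x\<in>{0..1}. \<bar>hderiv (q + Suc d) g x\<bar> \<le> M'"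
    and x: "x \<in> {0..1}" for g h M M' x
  proof -
    have M0: "0 \<le> M" "0 \<le> M'" using M M' x abs_ge_zero order_trans by blast+
    have qh: "real q * h \<le> 1 / 2"
      by (rule order_trans[OF mult_right_mono h(2)]) (use h in auto)
    have "\<bar>hderiv (Suc q) g y\<bar> \<le> A * (M / h ^ Suc q + h ^ d * M')" if "y \<in> {0..1}" for y
      by (rule A(2)[OF g h(1) _ M _ that]) (use h M' in auto)
    then have "\<bar>hderiv q g x\<bar> \<le> fact q * (real q + 1) * (M / h ^ q) +
        real q * (h * (A * (M / h ^ Suc q + h ^ d * M')))"
      using M by (intro intermediate_derivative_step[OF g h(1) qh _ _ x]) auto
    also have "h * (A * (M / h ^ Suc q + h ^ d * M')) = A * (M / h ^ q + h ^ Suc d * M')"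
      using h by (simp add: field_simps)
    also have "fact q * (real q + 1) * (M / h ^ q) \<le>
        fact q * (real q + 1) * (M / h ^ q + h ^ Suc d * M')"
      using M0 h by (intro mult_left_mono) auto
    also have "fact q * (real q + 1) * (M / h ^ q + h ^ Suc d * M') +
        real q * (A * (M / h ^ q + h ^ Suc d * M')) = A' * (M / h ^ q + h ^ Suc d * M')"
      by (simp add: A'_def distrib_right mult.assoc)
    finally show ?thesis by simp
  qed
  moreover have "A' \<ge> 0" using A(1) by (simp add: A'_def)
  ultimately show ?case by blast
qed

context cantor_coding
begin

text \<open>The dichotomy holds on the dense set \<open>range v\<close>, and both alternatives are
  closed conditions.\<close>

lemma K_near_or_far:
  assumes "x \<in> K" "s \<ge> 1"
  shows "\<bar>x - v a\<bar> \<le> C * \<delta> s \<or> \<bar>x - v a\<bar> \<ge> \<delta> (s - 1) / 2"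
proof -
  let ?S = "{x. \<bar>x - v a\<bar> \<le> C * \<delta> s} \<union> {x. \<delta> (s - 1) / 2 \<le> \<bar>x - v a\<bar>}"
  have "closed ?S"
    by (intro closed_Un closed_Collect_le continuous_intros)
  moreover have "range v \<subseteq> ?S"
  proof
    fix y assume "y \<in> range v"
    then obtain j where y: "y = v j" by blast
    show "y \<in> ?S"
      using near[of j s a] far[of j "s - 1" a] assms(2) unfolding y by auto
  qed
  ultimately have "K \<subseteq> ?S" unfolding K_closure by (rule closure_minimal[rotated])
  with assms(1) show ?thesis by blast
qed

text \<open>The class of \<open>a\<close> modulo \<open>2 ^ k\<close> has \<open>2 ^ (t - k)\<close>
  indices below \<open>2 ^ t\<close>, so the i-th node agrees with \<open>a\<close> in
  \<open>t - blen i\<close> digits. The reference index \<open>a\<close> itself may exceed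
  \<open>2 ^ t\<close>.\<close>

lemma class_enumerate:
  assumes "s \<le> t" "a mod 2 ^ s = 0"
  shows "\<exists>js. bij_betw js {..<(2 :: nat) ^ (t - s)} {j. j < 2 ^ t \<and> j mod 2 ^ s = 0} \<and>
    (\<forall>i<(2 :: nat) ^ (t - s). \<forall>k. s \<le> k \<longrightarrow> k \<le> t \<longrightarrow> k \<le> agree t a (js i) \<longleftrightarrow> i < 2 ^ (t - k))"
proof -
  let ?J = "{j. j < 2 ^ t \<and> j mod 2 ^ s = (0 :: nat)}"
  have card: "card ?J = 2 ^ (t - s)"
    using card_residue_power[OF assms(1), of 0] by simp
  obtain js where js: "bij_betw js {..<card ?J} ?J"
    "\<And>i k. i < card ?J \<Longrightarrow> k \<le> agree t a (js i) \<longleftrightarrow> i < card {j\<in>?J. k \<le> agree t a j}"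
    using enumerate_by_level[of ?J "agree t a"] by auto
  have "card {j\<in>?J. k \<le> agree t a j} = 2 ^ (t - k)" if "s \<le> k" "k \<le> t" for k
  proof -
    have "{j\<in>?J. k \<le> agree t a j} = {j. j < 2 ^ t \<and> j mod 2 ^ k = a mod 2 ^ k}"
      using le_agree_iff[OF that(2)] mod_power_mono[OF _ that(1), of _ a] assms(2) by auto
    then show ?thesis using card_residue_power[OF that(2)] by simp
  qed
  with js show ?thesis unfolding card by (intro exI[of _ js]) auto
qed

text \<open>Up to constants, the product of the distances from a point of a class to its
  \<open>N\<close> nodes with the \<open>q\<close> nearest left out; this is the scale of the q-th
  derivative of the nodal polynomial.\<close>

definition level_prod :: "nat \<Rightarrow> nat \<Rightarrow> nat \<Rightarrow> real" where
  "level_prod t N q = (\<Prod>i=q..<N. \<delta> (t - blen i))"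

lemma level_prod_pos: "level_prod t N q > 0"
  unfolding level_prod_def by (intro prod_pos) (auto simp: \<delta>_pos)

lemma level_prod_split:
  assumes "k \<le> q" "q \<le> N"
  shows "level_prod t N k = (\<Prod>i=k..<q. \<delta> (t - blen i)) * level_prod t N q"
  unfolding level_prod_def by (rule prod.atLeastLessThan_concat[OF assms, symmetric])

lemma \<delta>_blen_mono: "i \<le> j \<Longrightarrow> \<delta> (t - blen i) \<le> \<delta> (t - blen j)"
  by (intro \<delta>_antimono diff_le_mono2 blen_mono)

lemma level_prod_le_power:
  assumes "k \<le> q" "q \<le> N"
  shows "level_prod t N k \<le> \<delta> (t - blen q) ^ (q - k) * level_prod t N q"
proof -
  have "(\<Prod>i=k..<q. \<delta> (t - blen i)) \<le> (\<Prod>i=k..<q. \<delta> (t - blen q))"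
    by (rule prod_mono) (use \<delta>_pos \<delta>_blen_mono in \<open>auto simp: less_imp_le\<close>)
  then show ?thesis
    unfolding level_prod_split[OF assms] using level_prod_pos[of t N q] by simp
qed

lemma level_prod_ge_power:
  assumes "q \<le> l" "l \<le> N"
  shows "\<delta> (t - blen q) ^ (l - q) * level_prod t N l \<le> level_prod t N q"
proof -
  have "(\<Prod>i=q..<l. \<delta> (t - blen q)) \<le> (\<Prod>i=q..<l. \<delta> (t - blen i))"
    by (rule prod_mono) (use \<delta>_pos \<delta>_blen_mono in \<open>auto simp: less_imp_le\<close>)
  then show ?thesis
    unfolding level_prod_split[OF assms] using level_prod_pos[of t N l] by simp
qed

lemma level_prod_mono:
  assumes "k \<le> q" "q \<le> N"
  shows "level_prod t N k \<le> level_prod t N q"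
proof -
  have "\<delta> (t - blen q) ^ (q - k) \<le> 1"
    by (rule power_le_one) (use \<delta>_pos[of "t - blen q"] \<delta>_le_1[of "t - blen q"] in auto)
  then show ?thesis
    using level_prod_le_power[OF assms, of t] level_prod_pos[of t N q]
    by (meson mult_left_le_one_le less_imp_le order_trans \<delta>_pos zero_le_power)
qed

text \<open>The general derivative bound with \<open>h\<close> equal to the scale of the q-th node:
  the \<open>q\<close> nearest factors are raised to \<open>h\<close>, and their product cancels the
  loss \<open>1 / h ^ q\<close>.\<close>

lemma nodal_class_bound:
  fixes s c q :: nat
  defines "t \<equiv> s + c" and "N \<equiv> (2 :: nat) ^ c"
  assumes s: "s \<ge> 1" and sep: "12 * C * \<delta> s \<le> \<delta> (s - 1)"
    and y: "y \<in> K" "\<bar>y - v 0\<bar> \<le> C * \<delta> s" and q: "q \<le> N"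
  shows "\<bar>poly ((pderiv ^^ q) (nodal_poly (v ` {j. j < 2 ^ t \<and> j mod 2 ^ s = 0}))) y\<bar> \<le>
    real N ^ N * (2 * C) ^ N * level_prod t N q"
proof -
  let ?J = "{j. j < 2 ^ t \<and> j mod 2 ^ s = 0}" and ?h = "\<delta> (t - blen q)"
  \<comment> \<open>Distances are only known between coded points, so \<open>y\<close> is replaced
    by a coded one at distance below \<open>\<delta> t\<close>; the gap of level
    \<open>s - 1\<close> keeps it in the class of 0.\<close>
  obtain a where a: "\<bar>y - v a\<bar> < \<delta> t" using K_approx[OF y(1) \<delta>_pos] by blast
  have "a mod 2 ^ s = 0"
  proof (rule ccontr)
    assume "a mod 2 ^ s \<noteq> 0"
    then have "\<bar>v a - v 0\<bar> \<ge> \<delta> (s - 1) / 2" using far[of a "s - 1" 0] s by simp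
    moreover have "\<delta> t \<le> \<delta> s" by (rule \<delta>_antimono) (simp add: t_def)
    moreover have "\<delta> s \<le> C * \<delta> s" using C_ge_1 \<delta>_pos[of s] by simp
    moreover have "12 * (C * \<delta> s) \<le> \<delta> (s - 1)" using sep by (simp add: mult.assoc)
    ultimately show False using a y(2) \<delta>_pos[of s] by linarith
  qed
  then obtain js where js: "bij_betw js {..<N} ?J"
    "\<And>i k. i < N \<Longrightarrow> s \<le> k \<Longrightarrow> k \<le> t \<Longrightarrow> k \<le> agree t a (js i) \<longleftrightarrow> i < 2 ^ (t - k)"
    using class_enumerate[of s t a] unfolding t_def N_def by auto
  have dist: "\<bar>y - v (js i)\<bar> \<le> 2 * C * \<delta> (t - blen i)" if "i < N" for i
  proof -
    have "blen i \<le> c" using that by (simp add: blen_le_iff N_def)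
    moreover have "i < 2 ^ blen i" using blen_le_iff by blast
    ultimately have "t - blen i \<le> agree t a (js i)"
      using js(2)[OF that, of "t - blen i"] by (simp add: t_def)
    then have "C * \<delta> (agree t a (js i)) \<le> C * \<delta> (t - blen i)"
      using C_ge_1 by (intro mult_left_mono \<delta>_antimono) auto
    moreover have "\<delta> t \<le> \<delta> (t - blen i)" by (rule \<delta>_antimono) simp
    moreover have "\<delta> (t - blen i) \<le> C * \<delta> (t - blen i)" using C_ge_1 \<delta>_pos[of "t - blen i"] by simp
    ultimately have "\<bar>y - v (js i)\<bar> \<le> 2 * (C * \<delta> (t - blen i))"
      using a dist_le_agree[of "js i" a t] by linarith
    then show ?thesis by (simp add: mult.assoc)
  qed
  have card: "card (v ` ?J) = N"
    using card_image[OF inj_on_subset[OF inj_v subset_UNIV], of ?J] bij_betw_same_card[OF js(1)]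
        by simp
  have "\<bar>poly ((pderiv ^^ q) (nodal_poly (v ` ?J))) y\<bar> \<le>
      real N ^ q / ?h ^ q * (\<Prod>b\<in>v ` ?J. max \<bar>y - b\<bar> ?h)"
    using higher_deriv_nodal_bound[of "v ` ?J" ?h q y] \<delta>_pos card by simp
  also have "(\<Prod>b\<in>v ` ?J. max \<bar>y - b\<bar> ?h) = (\<Prod>j\<in>?J. max \<bar>y - v j\<bar> ?h)"
    by (rule prod.reindex_cong[of v]) (use inj_on_subset[OF inj_v subset_UNIV] in auto)
  also have "\<dots> = (\<Prod>i<N. max \<bar>y - v (js i)\<bar> ?h)"
    by (rule prod.reindex_bij_betw[OF js(1), symmetric])
  also have "\<dots> \<le> (\<Prod>i<N. 2 * C * (if i < q then ?h else \<delta> (t - blen i)))"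
  proof (rule prod_mono, safe)
    fix i assume "i < N"
    have h2: "?h \<le> 2 * C * ?h" using C_ge_1 \<delta>_pos[of "t - blen q"] by simp
    show "max \<bar>y - v (js i)\<bar> ?h \<le> 2 * C * (if i < q then ?h else \<delta> (t - blen i))"
    proof (cases "i < q")
      case True
      then have "2 * C * \<delta> (t - blen i) \<le> 2 * C * ?h"
        using C_ge_1 by (intro mult_left_mono \<delta>_blen_mono) auto
      with True dist[OF \<open>i < N\<close>] h2 show ?thesis by simp
    next
      case False
      then have "2 * C * ?h \<le> 2 * C * \<delta> (t - blen i)"
        using C_ge_1 by (intro mult_left_mono \<delta>_blen_mono) auto
      with False dist[OF \<open>i < N\<close>] h2 show ?thesis by simp
    qed
  qed simp
  also have "\<dots> = (2 * C) ^ N * (?h ^ q * level_prod t N q)"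
  proof -
    have "(\<Prod>i<N. if i < q then ?h else \<delta> (t - blen i)) =
        (\<Prod>i=0..<q. if i < q then ?h else \<delta> (t - blen i)) * (\<Prod>i=q..<N. if i < q then ?h else \<delta> (t -
            blen i))"
      unfolding lessThan_atLeast0 by (rule prod.atLeastLessThan_concat[OF _ q, symmetric]) simp
    also have "\<dots> = ?h ^ q * level_prod t N q"
      by (simp add: level_prod_def)
    finally show ?thesis by (simp only: prod.distrib) simp
  qed
  also have "real N ^ q / ?h ^ q * ((2 * C) ^ N * (?h ^ q * level_prod t N q)) =
      real N ^ q * ((2 * C) ^ N * level_prod t N q)"
    using \<delta>_pos[of "t - blen q"] by (simp add: field_simps)
  also have "\<dots> \<le> real N ^ N * ((2 * C) ^ N * level_prod t N q)"
    using q C_ge_1 level_prod_pos[of t N q]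
    by (intro mult_right_mono power_increasing mult_nonneg_nonneg) (auto simp: N_def)
  finally show ?thesis
    using \<delta>_pos by (simp add: mult.assoc divide_right_mono mult_left_mono less_imp_le)
qed

definition test_const :: "nat \<Rightarrow> real" where
  "test_const N = real N ^ N * (2 * C) ^ N * (1 + (real N + 2) * 4 ^ N)"

text \<open>A nodal polynomial localised to one piece of \<open>K\<close>. The separation hypothesis
  puts the zone where the bump varies, between 2R and 3R from \<open>v 0\<close>, into a gap of
  \<open>K\<close>: points of \<open>K\<close> lie within R or beyond 6R. Hence on \<open>K\<close>
  every derivative is that of the polynomial or 0.\<close>

lemma test_function:
  fixes s c :: nat
  defines "t \<equiv> s + c" and "N \<equiv> (2 :: nat) ^ c"
  defines "\<omega> \<equiv> nodal_poly (v ` {j. j < 2 ^ t \<and> j mod 2 ^ s = 0})"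
  assumes s: "s \<ge> 1" and sep: "12 * C * \<delta> s \<le> \<delta> (s - 1)"
  shows "\<exists>f\<in>whitney_functions K. (\<forall>j. j mod 2 ^ s = 0 \<longrightarrow> f (v j) = poly \<omega> (v j)) \<and>
    (\<forall>q\<le>N. whitney_norm K q f \<le> test_const N * level_prod t N q)"
proof -
  define c1 where "c1 = real N ^ N * (2 * C) ^ N"
  have c1: "c1 \<ge> 0" using C_ge_1 by (simp add: c1_def)
  define R where "R = C * \<delta> s"
  have R: "R > 0" "12 * R \<le> \<delta> (s - 1)"
    using C_ge_1 \<delta>_pos[of s] sep by (simp_all add: R_def mult.assoc)
  define u where "u x = bump (1 / R * x + - v 0 / R)" for x
  define F where "F x = u x * poly \<omega> x" for x
  define f where "f x = (if x \<in> K then F x else 0)" for x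
  have u: "u \<in> smooth_functions" unfolding u_def[abs_def] by (rule smooth_affine(1)[OF smooth_bump])
  have F: "F \<in> smooth_functions" unfolding F_def[abs_def] by (rule smooth_mult(1)[OF u
      smooth_poly(1)])
  have rep: "represents F f" using F by (simp add: represents_def f_def)
  then have fW: "f \<in> whitney_functions K" unfolding whitney_functions_iff by (auto simp: f_def)
  have arg: "1 / R * x + - v 0 / R = (x - v 0) / R" for x using R by (simp add: field_simps)
  have near_F: "F x = poly \<omega> x" if "\<bar>x - v 0\<bar> < 2 * R" for x
  proof -
    have "\<bar>(x - v 0) / R\<bar> \<le> 2" using that R by (simp add: pos_divide_le_eq abs_divide)
    then show ?thesis unfolding F_def u_def arg by (simp add: bump_1)
  qed
  have far_F: "F x = 0" if "\<bar>x - v 0\<bar> > 3 * R" for x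
  proof -
    have "\<bar>(x - v 0) / R\<bar> \<ge> 3" using that R by (simp add: pos_le_divide_eq abs_divide)
    then show ?thesis unfolding F_def u_def arg by (simp add: bump_0)
  qed
  have near_h: "hderiv k F x = poly ((pderiv ^^ k) \<omega>) x" if "\<bar>x - v 0\<bar> \<le> R" for k x
  proof -
    have "hderiv k F x = hderiv k (poly \<omega>) x"
      by (rule hderiv_local[OF F smooth_poly(1), of "{x. \<bar>x - v 0\<bar> < 2 * R}"])
        (use that R near_F in \<open>auto intro!: open_Collect_less continuous_intros\<close>)
    then show ?thesis by (simp add: smooth_poly)
  qed
  have far_h: "hderiv k F x = 0" if "\<bar>x - v 0\<bar> \<ge> \<delta> (s - 1) / 2" for k x
  proof -
    have "hderiv k F x = hderiv k (\<lambda>x. 0) x"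
      by (rule hderiv_local[OF F smooth_zero(1), of "{x. 3 * R < \<bar>x - v 0\<bar>}"])
        (use that R far_F in \<open>auto intro!: open_Collect_less continuous_intros\<close>)
    then show ?thesis by (simp add: smooth_zero)
  qed
  note dich = K_near_or_far[OF _ s, of _ 0, folded R_def]
  let ?\<pi> = "level_prod t N"
  note \<pi>pos = level_prod_pos[of t N]
  have hbound: "\<bar>hderiv k F x\<bar> \<le> c1 * ?\<pi> k" if "x \<in> K" "k \<le> N" for x k
    using dich[OF that(1)]
  proof
    assume "\<bar>x - v 0\<bar> \<le> R"
    then show ?thesis
      using nodal_class_bound[OF s sep that(1), of k c] that(2) near_h[of x k]
      unfolding c1_def \<omega>_def t_def N_def R_def by simp
  next
    assume "\<bar>x - v 0\<bar> \<ge> \<delta> (s - 1) / 2"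
    then show ?thesis using far_h c1 \<pi>pos[of k] by simp
  qed
  have jet: "\<bar>jet_remainder F q k y x\<bar> \<le> c1 * ((real N + 2) * 4 ^ N) * ?\<pi> q * \<bar>x - y\<bar> ^ (q - k)"
    if q: "q \<le> N" and xy: "x \<in> K" "y \<in> K" "x \<noteq> y" and k: "k \<le> q" for q k x y
  proof -
    define D where "D = \<bar>x - y\<bar>"
    have D: "D > 0" using xy(3) by (simp add: D_def)
    have D_le: "D \<ge> 0" using D by simp
    have yt: "\<bar>hderiv (k + j) F y / fact j * (x - y) ^ j\<bar> \<le> c1 * (?\<pi> (k + j) * D ^ j)"
      if "k + j \<le> N" for j
    proof -
      have "\<bar>hderiv (k + j) F y / fact j * (x - y) ^ j\<bar> = \<bar>hderiv (k + j) F y\<bar> / fact j * D ^ j"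
        by (simp add: abs_mult power_abs D_def)
      also have "\<dots> \<le> \<bar>hderiv (k + j) F y\<bar> * D ^ j"
        using D by (intro mult_right_mono) (auto simp: divide_le_eq mult_le_cancel_left1)
      also have "\<dots> \<le> c1 * ?\<pi> (k + j) * D ^ j"
        using hbound[OF xy(2) that] D by (intro mult_right_mono) auto
      finally show ?thesis by (simp add: mult.assoc)
    qed
    have goal: "c1 * (n * (?\<pi> q * (b * D ^ (q - k)))) \<le> c1 * ((real N + 2) * 4 ^ N) * ?\<pi> q * D ^
        (q - k)"
      if "0 \<le> n" "n \<le> real N + 2" "0 \<le> b" "b \<le> 4 ^ N" for n b :: real
    proof -
      have "n * b \<le> (real N + 2) * 4 ^ N" using that by (intro mult_mono) auto
      then have "(n * b) * (c1 * ?\<pi> q * D ^ (q - k)) \<le> ((real N + 2) * 4 ^ N) * (c1 * ?\<pi> q * D ^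
          (q - k))"
        using c1 \<pi>pos[of q] D by (intro mult_right_mono) auto
      then show ?thesis by (simp only: mult_ac)
    qed
    show ?thesis
    \<comment> \<open>For large \<open>D\<close> the terms of the remainder are bounded one by one,
      powers of the scale being traded for powers of \<open>4 * D\<close>. For small
      \<open>D\<close> both points lie on the same side of the gap, and the remainder is the tail,
      beyond order \<open>q\<close>, of the exact expansion of a polynomial of degree
      \<open>N\<close>.\<close>
    proof (cases "\<delta> (t - blen q) \<le> 4 * D")
      case True
      have *: "?\<pi> (k + j) * D ^ j \<le> ?\<pi> q * (4 ^ q * D ^ (q - k))" if j: "k + j \<le> q" for j
      proof -
        have "?\<pi> (k + j) \<le> \<delta> (t - blen q) ^ (q - (k + j)) * ?\<pi> q"
          by (rule level_prod_le_power[OF j q])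
        also have "\<dots> \<le> (4 * D) ^ (q - (k + j)) * ?\<pi> q"
          using True \<delta>_pos \<pi>pos[of q] by (intro mult_right_mono power_mono) (auto simp: less_imp_le)
        also have "\<dots> \<le> (4 ^ q * D ^ (q - (k + j))) * ?\<pi> q"
          unfolding power_mult_distrib using D \<pi>pos[of q]
          by (intro mult_right_mono power_increasing) auto
        finally have "?\<pi> (k + j) * D ^ j \<le> (4 ^ q * D ^ (q - (k + j))) * ?\<pi> q * D ^ j"
          using D by (intro mult_right_mono) auto
        also have "\<dots> = ?\<pi> q * (4 ^ q * (D ^ (q - (k + j)) * D ^ j))" by (simp only: mult_ac)
        also have "D ^ (q - (k + j)) * D ^ j = D ^ (q - k)"
          using j by (simp flip: power_add)
        finally show ?thesis .
      qed
      define E where "E = c1 * (?\<pi> q * (4 ^ q * D ^ (q - k)))"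
      have "\<bar>jet_remainder F q k y x\<bar> \<le> \<bar>hderiv k F x\<bar> +
          \<bar>\<Sum>j<Suc q - k. hderiv (k + j) F y / fact j * (x - y) ^ j\<bar>"
        unfolding jet_remainder_def taylor_fun_def by (rule abs_triangle_ineq4)
      moreover have "\<bar>hderiv k F x\<bar> \<le> E"
      proof -
        have "?\<pi> k \<le> ?\<pi> q * (4 ^ q * D ^ (q - k))" using *[of 0] k by simp
        from mult_left_mono[OF this c1] show ?thesis
          using hbound[OF xy(1), of k] k q by (simp add: E_def)
      qed
      moreover have "\<bar>\<Sum>j<Suc q - k. hderiv (k + j) F y / fact j * (x - y) ^ j\<bar> \<le>
          (\<Sum>j<Suc q - k. E)"
      proof (rule order_trans[OF sum_abs], rule sum_mono)
        fix j assume "j \<in> {..<Suc q - k}"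
        then have j: "k + j \<le> q" by auto
        have "c1 * (?\<pi> (k + j) * D ^ j) \<le> E"
          unfolding E_def using *[OF j] c1 by (intro mult_left_mono)
        then show "\<bar>hderiv (k + j) F y / fact j * (x - y) ^ j\<bar> \<le> E"
          using yt[of j] j q by linarith
      qed
      moreover have "E + (\<Sum>j<Suc q - k. E) = real (Suc (Suc q - k)) * E"
        by (simp add: distrib_right)
      ultimately have "\<bar>jet_remainder F q k y x\<bar> \<le> real (Suc (Suc q - k)) * E" by linarith
      also have "\<dots> = c1 * (real (Suc (Suc q - k)) * (?\<pi> q * (4 ^ q * D ^ (q - k))))"
        unfolding E_def by (simp only: mult.left_commute)
      also have "\<dots> \<le> c1 * ((real N + 2) * 4 ^ N) * ?\<pi> q * D ^ (q - k)"
        by (rule goal) (use q in \<open>auto intro: power_increasing\<close>)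
      finally show ?thesis by (simp add: D_def)
    next
      case False
      have "\<delta> (t - blen q) \<le> \<delta> (s - 1)"
      proof (rule \<delta>_antimono)
        have "0 < N" by (simp add: N_def)
        with q have "q < 2 * N" by linarith
        then have "blen q \<le> Suc c" by (simp add: blen_le_iff N_def)
        then show "s - 1 \<le> t - blen q" by (simp add: t_def)
      qed
      then have D4: "4 * D < \<delta> (s - 1)" using False by simp
      have "\<not> (\<bar>a - v 0\<bar> \<le> R \<and> \<bar>b - v 0\<bar> \<ge> \<delta> (s - 1) / 2)" if "\<bar>a - b\<bar> = D" for a b
        using D4 R that by linarith
      then have "\<not> (\<bar>x - v 0\<bar> \<le> R \<and> \<bar>y - v 0\<bar> \<ge> \<delta> (s - 1) / 2)"
        "\<not> (\<bar>y - v 0\<bar> \<le> R \<and> \<bar>x - v 0\<bar> \<ge> \<delta> (s - 1) / 2)"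
        unfolding D_def by (auto simp: abs_minus_commute)
      then consider "\<bar>x - v 0\<bar> \<le> R" "\<bar>y - v 0\<bar> \<le> R"
        | "\<bar>x - v 0\<bar> \<ge> \<delta> (s - 1) / 2" "\<bar>y - v 0\<bar> \<ge> \<delta> (s - 1) / 2"
        using dich[OF xy(1)] dich[OF xy(2)] by blast
      then show ?thesis
      proof cases
        case 2
        then have "jet_remainder F q k y x = 0"
          unfolding jet_remainder_def taylor_fun_def using far_h by simp
        then show ?thesis using c1 \<pi>pos[of q] by simp
      next
        case 1
        obtain z where "hderiv k (poly \<omega>) x - taylor_fun (\<lambda>j. hderiv (k + j) (poly \<omega>) y) (Suc N -
            k) y x =
            hderiv (k + (Suc N - k)) (poly \<omega>) z / fact (Suc N - k) * (x - y) ^ (Suc N - k)"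
          using taylor_remainder[OF smooth_poly(1), of x y k \<omega> "Suc N - k"] by blast
        moreover have "hderiv (k + (Suc N - k)) (poly \<omega>) z = 0"
        proof -
          have card: "card (v ` {j. j < 2 ^ t \<and> j mod 2 ^ s = 0}) = N"
            using card_image[OF inj_on_subset[OF inj_v subset_UNIV]] card_residue_power[of s t 0]
            by (simp add: t_def N_def)
          then have "degree \<omega> = N" by (simp add: \<omega>_def degree_nodal)
          then have "(pderiv ^^ Suc N) \<omega> = [:fact (Suc N) * coeff \<omega> (Suc N):]"
            by (intro higher_pderiv_le_degree) simp
          also have "coeff \<omega> (Suc N) = 0" using \<open>degree \<omega> = N\<close> by (intro coeff_eq_0) simp
          finally show ?thesis using k q by (simp add: smooth_poly del: funpow.simps)
        qed
        ultimately have "hderiv k F x = (\<Sum>j<Suc N - k. hderiv (k + j) F y / fact j * (x - y) ^ j)"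
          using near_h[OF 1(1)] near_h[OF 1(2)] by (simp add: smooth_poly taylor_fun_def)
        also have "\<dots> = (\<Sum>j<Suc q - k. hderiv (k + j) F y / fact j * (x - y) ^ j) +
            (\<Sum>j=Suc q - k..<Suc N - k. hderiv (k + j) F y / fact j * (x - y) ^ j)"
          unfolding lessThan_atLeast0 by (rule sum.atLeastLessThan_concat[symmetric]) (use q in
              auto)
        finally have "jet_remainder F q k y x =
            (\<Sum>j=Suc q - k..<Suc N - k. hderiv (k + j) F y / fact j * (x - y) ^ j)"
          unfolding jet_remainder_def taylor_fun_def by simp
        also have "\<bar>\<dots>\<bar> \<le> (\<Sum>j=Suc q - k..<Suc N - k. c1 * (?\<pi> q * D ^ (q - k)))"
        proof (rule order_trans[OF sum_abs], rule sum_mono)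
          fix j assume "j \<in> {Suc q - k..<Suc N - k}"
          then have j: "q \<le> k + j" "k + j \<le> N" using k by auto
          have "?\<pi> (k + j) * D ^ (k + j - q) \<le> ?\<pi> (k + j) * \<delta> (t - blen q) ^ (k + j - q)"
            using False D_le \<pi>pos[of "k + j"] by (intro mult_left_mono power_mono) auto
          also have "\<dots> \<le> ?\<pi> q" using level_prod_ge_power[OF j, of t] by (simp add: mult.commute)
          finally have "?\<pi> (k + j) * D ^ (k + j - q) * D ^ (q - k) \<le> ?\<pi> q * D ^ (q - k)"
            using D by (intro mult_right_mono) auto
          moreover have "D ^ (k + j - q) * D ^ (q - k) = D ^ j"
            using j k by (simp flip: power_add)
          ultimately have "?\<pi> (k + j) * D ^ j \<le> ?\<pi> q * D ^ (q - k)" by (simp add: mult.assoc)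
          then have "c1 * (?\<pi> (k + j) * D ^ j) \<le> c1 * (?\<pi> q * D ^ (q - k))"
            using c1 by (intro mult_left_mono)
          then show "\<bar>hderiv (k + j) F y / fact j * (x - y) ^ j\<bar> \<le> c1 * (?\<pi> q * D ^ (q - k))"
            using yt[OF j(2)] by linarith
        qed
        also have "\<dots> = c1 * (real (Suc N - k - (Suc q - k)) * (?\<pi> q * (1 * D ^ (q - k))))"
          by (simp add: mult_ac)
        also have "\<dots> \<le> c1 * ((real N + 2) * 4 ^ N) * ?\<pi> q * D ^ (q - k)"
          by (rule goal) auto
        finally show ?thesis by (simp add: D_def)
      qed
    qed
  qed
  have "whitney_norm K q f \<le> test_const N * ?\<pi> q" if q: "q \<le> N" for q
  proof -
    have "whitney_norm K q f \<le> c1 * ?\<pi> q + c1 * ((real N + 2) * 4 ^ N) * ?\<pi> q"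
    proof (rule whitney_norm_le[OF rep])
      show "\<bar>hderiv k F x\<bar> \<le> c1 * ?\<pi> q" if "x \<in> K" "k \<le> q" for k x
        using hbound[OF that(1), of k] mult_left_mono[OF level_prod_mono[OF that(2) q, of t] c1]
            that(2) q
        by linarith
    qed (use jet[OF q] in auto)
    then show ?thesis by (simp add: test_const_def c1_def algebra_simps)
  qed
  moreover have "f (v j) = poly \<omega> (v j)" if "j mod 2 ^ s = 0" for j
  proof -
    have "\<bar>v j - v 0\<bar> \<le> R" unfolding R_def by (rule near) (use that in simp)
    then show ?thesis using near_F[of "v j"] R v_in_K by (simp add: f_def)
  qed
  ultimately show ?thesis using fW by blast
qed

text \<open>The set consists of the coded point \<open>y\<close> with index \<open>2 ^ t\<close>,
  the first beyond the nodes, and of the \<open>2 ^ (\<alpha> + 1)\<close> nodes nearest to it. As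
  \<open>g\<close> vanishes at these nodes, one term survives, and the divided difference is in
  modulus the product of the distances from \<open>y\<close> to the remaining nodes.\<close>

lemma divdiff_class_lower:
  fixes s c \<alpha> :: nat
  defines "t \<equiv> s + c" and "N \<equiv> (2 :: nat) ^ c"
  assumes \<alpha>: "\<alpha> + 1 \<le> c"
    and g: "\<And>j. j mod 2 ^ s = 0 \<Longrightarrow> g (v j) = poly (nodal_poly (v ` {j. j < 2 ^ t \<and> j mod 2 ^ s =
        0})) (v j)"
  shows "\<exists>X. finite X \<and> card X = Suc (2 ^ (\<alpha> + 1)) \<and> X \<subseteq> {0..1} \<and>
    level_prod t N (2 ^ (\<alpha> + 1)) / 2 ^ N \<le> \<bar>divdiff g X\<bar>"
proof -
  define l where "l = t - (\<alpha> + 1)"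
  define q where "q = (2 :: nat) ^ (\<alpha> + 1)"
  have sl: "s \<le> l" "l \<le> t" using \<alpha> by (auto simp: l_def t_def)
  have qN: "q \<le> N" unfolding q_def N_def using \<alpha> by (intro power_increasing) auto
  let ?J = "{j. j < 2 ^ t \<and> j mod 2 ^ s = (0 :: nat)}" and ?Q = "{j. j < 2 ^ t \<and> j mod 2 ^ l = (0
      :: nat)}"
  let ?m = "2 ^ t :: nat"
  define y where "y = v ?m"
  define X where "X = insert y (v ` ?Q)"
  have pow0: "?m mod 2 ^ k = 0" if "k \<le> t" for k using that by (simp add: le_imp_power_dvd)
  have QJ: "?Q \<subseteq> ?J" using mod_power_mono[OF _ sl(1), of _ 0] by auto
  have cardv: "card (v ` S) = card S" for S by (rule card_image) (rule inj_on_subset[OF inj_v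
      subset_UNIV])
  have cardQ: "card ?Q = q" using card_residue_power[OF sl(2), of 0] \<alpha> by (simp add: l_def q_def
      t_def)
  have yQ: "y \<notin> v ` S" if "S \<subseteq> ?J" for S
  proof
    assume "y \<in> v ` S"
    then obtain j where "j \<in> S" "v ?m = v j" unfolding y_def by blast
    then show False using that injD[OF inj_v, of ?m j] by auto
  qed
  have X: "finite X" "card X = Suc q" "X \<subseteq> {0..1}"
    unfolding X_def using yQ[OF QJ] cardv[of ?Q] cardQ v_range by (auto simp: y_def)
  obtain js where js: "bij_betw js {..<N} ?J"
    "\<And>i k. i < N \<Longrightarrow> s \<le> k \<Longrightarrow> k \<le> t \<Longrightarrow> k \<le> agree t ?m (js i) \<longleftrightarrow> i < 2 ^ (t - k)"
    using class_enumerate[of s t ?m] pow0[of s] unfolding N_def t_def by auto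
  have inQ: "js i \<in> ?Q \<longleftrightarrow> i < q" if "i < N" for i
  proof -
    have "js i \<in> ?J" using js(1) that bij_betwE by blast
    then have "js i \<in> ?Q \<longleftrightarrow> js i mod 2 ^ l = ?m mod 2 ^ l" using pow0[OF sl(2)] by simp
    also have "\<dots> \<longleftrightarrow> l \<le> agree t ?m (js i)" using le_agree_iff[OF sl(2)] by simp
    also have "\<dots> \<longleftrightarrow> i < 2 ^ (t - l)" by (rule js(2)[OF that sl])
    also have "t - l = \<alpha> + 1" using \<alpha> by (simp add: l_def t_def)
    finally show ?thesis by (simp add: q_def)
  qed
  have bij': "bij_betw js {q..<N} (?J - ?Q)"
    unfolding bij_betw_def
  proof
    show "inj_on js {q..<N}"
      by (rule inj_on_subset[OF bij_betw_imp_inj_on[OF js(1)]]) auto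
    show "js ` {q..<N} = ?J - ?Q"
    proof (intro antisym subsetI)
      fix j assume "j \<in> js ` {q..<N}"
      then obtain i where i: "q \<le> i" "i < N" "j = js i" by auto
      then have "j \<in> ?J" using bij_betw_apply[OF js(1), of i] by simp
      moreover have "j \<notin> ?Q" unfolding i(3) inQ[OF i(2)] using i(1) by simp
      ultimately show "j \<in> ?J - ?Q" by blast
    next
      fix j assume j: "j \<in> ?J - ?Q"
      have "j \<in> js ` {..<N}" unfolding bij_betw_imp_surj_on[OF js(1)] using j by simp
      then obtain i where i: "i < N" "j = js i" by auto
      have "js i \<notin> ?Q" using j unfolding i(2) by simp
      then have "\<not> i < q" unfolding inQ[OF i(1)] .
      then show "j \<in> js ` {q..<N}" using i by simp
    qed
  qed
  have "(\<Prod>i=q..<N. \<delta> (t - blen i) / 2) \<le> (\<Prod>i=q..<N. \<bar>y - v (js i)\<bar>)"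
  proof (rule prod_mono, safe)
    fix i assume i: "i \<in> {q..<N}"
    then have "i \<ge> 1" using order_trans[of 1 q i] by (simp add: q_def)
    then have b: "blen i \<ge> 1" using blen_le_iff[of i 0] by simp
    have bc: "blen i \<le> c" using i by (simp add: blen_le_iff N_def)
    define k where "k = t - blen i + 1"
    have k: "s \<le> k" "k \<le> t" "t - k = blen i - 1" using b bc by (auto simp: k_def t_def)
    have "\<not> i < 2 ^ (blen i - 1)" unfolding blen_le_iff[symmetric] using b by simp
    then have "\<not> k \<le> agree t ?m (js i)" using js(2)[OF _ k(1,2), of i] i k(3) by simp
    then have ag: "agree t ?m (js i) \<le> t - blen i" by (simp add: k_def)
    then have "agree t ?m (js i) < t" using b bc by (simp add: t_def)
    then have "\<delta> (agree t ?m (js i)) / 2 \<le> \<bar>v (js i) - y\<bar>"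
      unfolding y_def by (rule dist_ge_agree)
    moreover have "\<delta> (t - blen i) \<le> \<delta> (agree t ?m (js i))" by (rule \<delta>_antimono[OF ag])
    ultimately show "\<delta> (t - blen i) / 2 \<le> \<bar>y - v (js i)\<bar>" by (simp add: abs_minus_commute)
  qed (use \<delta>_pos in \<open>auto simp: less_imp_le\<close>)
  also have "(\<Prod>i=q..<N. \<bar>y - v (js i)\<bar>) = (\<Prod>j\<in>?J - ?Q. \<bar>y - v j\<bar>)"
    by (rule prod.reindex_bij_betw[OF bij'])
  also have "\<dots> = (\<Prod>b\<in>v ` (?J - ?Q). \<bar>y - b\<bar>)"
    by (rule prod.reindex_cong[of v, symmetric]) (use inj_on_subset[OF inj_v subset_UNIV] in auto)
  also have "\<dots> = \<bar>divdiff g X\<bar>"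
  proof -
    have gy: "g y = (\<Prod>b\<in>v ` ?J. y - b)"
      unfolding y_def using g[OF pow0] sl by (simp add: poly_nodal)
    have g0: "g x = 0" if x: "x \<in> v ` ?Q" for x
    proof -
      obtain j where "j \<in> ?Q" "x = v j" using x by (rule imageE)
      then have j: "j \<in> ?J" "x = v j" using subsetD[OF QJ] by simp_all
      have "(\<Prod>b\<in>v ` ?J. v j - b) = 0"
        by (rule prod_zero, simp, rule bexI[OF _ imageI[OF j(1)]], simp)
      moreover have "g (v j) = (\<Prod>b\<in>v ` ?J. v j - b)"
        using g[of j] j(1) by (simp add: poly_nodal)
      ultimately show ?thesis unfolding j(2) by simp
    qed
    have "divdiff g X = g y / (\<Prod>z\<in>X - {y}. y - z) + (\<Sum>x\<in>v ` ?Q. g x / (\<Prod>z\<in>X - {x}. x - z))"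
      unfolding divdiff_def X_def by (rule sum.insert) (use yQ[OF QJ] in auto)
    also have "(\<Sum>x\<in>v ` ?Q. g x / (\<Prod>z\<in>X - {x}. x - z)) = 0"
      by (intro sum.neutral ballI) (simp add: g0)
    also have "X - {y} = v ` ?Q" unfolding X_def by (rule Diff_insert_absorb[OF yQ[OF QJ]])
    also have "g y = (\<Prod>b\<in>v ` (?J - ?Q). y - b) * (\<Prod>z\<in>v ` ?Q. y - z)"
      unfolding gy image_set_diff[OF inj_v] by (rule prod.subset_diff[OF image_mono[OF QJ]]) simp
    also have "(\<Prod>b\<in>v ` (?J - ?Q). y - b) * (\<Prod>z\<in>v ` ?Q. y - z) / (\<Prod>z\<in>v ` ?Q. y - z) + 0 =
        (\<Prod>b\<in>v ` (?J - ?Q). y - b)"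
    proof -
      have "(\<Prod>z\<in>S. y - z) \<noteq> 0" if "finite S" "y \<notin> S" for S using that by auto
      then have "(\<Prod>z\<in>v ` ?Q. y - z) \<noteq> 0" using yQ[OF QJ] by simp
      then show ?thesis by simp
    qed
    finally show ?thesis by (simp add: abs_prod)
  qed
  finally have "(\<Prod>i=q..<N. \<delta> (t - blen i) / 2) \<le> \<bar>divdiff g X\<bar>" .
  moreover have "level_prod t N q / 2 ^ N \<le> (\<Prod>i=q..<N. \<delta> (t - blen i) / 2)"
  proof -
    have "(\<Prod>i=q..<N. \<delta> (t - blen i) / 2) = level_prod t N q / 2 ^ (N - q)"
      by (simp add: prod_dividef level_prod_def)
    also have "\<dots> \<ge> level_prod t N q / 2 ^ N"
      using level_prod_pos[of t N q] by (intro divide_left_mono power_increasing) auto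
    finally show ?thesis .
  qed
  ultimately show ?thesis using X unfolding q_def by (intro exI[of _ X]) auto
qed

text \<open>Restates \<open>\<delta>_ratio\<close> in the form in which gaps beat diameters; it
  supplies the separation for the test functions with \<open>12 * C\<close> and for the bumps with
  \<open>6 * C\<close>.\<close>

lemma eventually_separated:
  assumes "M > 0"
  shows "\<exists>T. \<forall>s\<ge>T. M * \<delta> (Suc s) \<le> \<delta> s"
proof -
  have "eventually (\<lambda>k. \<delta> (Suc k) / \<delta> k < 1 / M) sequentially"
    using \<delta>_ratio assms by (intro order_tendstoD) auto
  then obtain T where T: "\<And>k. k \<ge> T \<Longrightarrow> \<delta> (Suc k) / \<delta> k < 1 / M"
    by (auto simp: eventually_sequentially)
  have "M * \<delta> (Suc k) \<le> \<delta> k" if "k \<ge> T" for k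
  proof -
    have "\<delta> (Suc k) < 1 / M * \<delta> k" using T[OF that] \<delta>_pos[of k] by (simp only: pos_divide_less_eq)
    then have "M * \<delta> (Suc k) < M * (1 / M * \<delta> k)" using assms by (simp only:
        mult_less_cancel_left_pos)
    then show ?thesis using assms by simp
  qed
  then show ?thesis by blast
qed

text \<open>Constants are fixed in the order forced by the operator: \<open>\<alpha>\<close> from
  the bound for \<open>W f\<close> itself, then \<open>L\<close> from \<open>\<epsilon>\<close>,
  then \<open>R\<close> from the derivative of order \<open>Q\<close>, and only then the number
  \<open>N\<close> of zeros, so large that all these norms are covered by
  \<open>test_function\<close>. Only the level is chosen after that.\<close>

lemma weight_condition_necessary:
  assumes cont: "continuous_map (whitney_topology K) smooth_topology W" and lin: "linear_op W"
    and ext: "\<And>f x. f \<in> whitney_functions K \<Longrightarrow> x \<in> K \<Longrightarrow> W f x = f x" and \<epsilon>: "\<epsilon> > 0"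
  shows "\<exists>n0. \<forall>n\<ge>n0. \<forall>s\<ge>1. weight (n + s) < \<epsilon> * (\<Sum>k=s..n+s. weight k)"
proof (rule ccontr)
  assume "\<not> ?thesis"
  then have neg: "\<exists>n\<ge>n0. \<exists>s\<ge>1. \<epsilon> * (\<Sum>k=s..n+s. weight k) \<le> weight (n + s)" for n0
    by (metis not_le)
  note est = estimate_if_continuous(1)[OF cont lin]
  obtain \<alpha> C1 where C1: "\<And>f. f \<in> whitney_functions K \<Longrightarrow>
      smooth_seminorm 1 (W f) \<le> C1 * (\<Sum>i\<le>\<alpha>. whitney_norm K i f)"
    using est[of 1] by blast
  \<comment> \<open>The indices from \<open>p\<close> to \<open>q - 1\<close> form one dyadic block,
    on which \<open>blen\<close> is constant.\<close>
  define p :: nat where "p = 2 ^ \<alpha>"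
  define q :: nat where "q = 2 ^ (\<alpha> + 1)"
  have pq: "q = 2 * p" "p \<le> q" "\<alpha> \<le> p" "p \<ge> 1"
    using less_exp[of \<alpha>] by (auto simp: p_def q_def)
  \<comment> \<open>With this size of \<open>L0\<close>, failure of the condition for
    \<open>\<epsilon>\<close> puts \<open>\<delta> t ^ L0\<close> below the product of
    distances.\<close>
  obtain L0 :: nat where L0: "real p / \<epsilon> \<le> real L0" using real_arch_simple by blast
  define L where "L = Suc L0"
  define Q where "Q = q + 4 * L"
  obtain R CQ where CQ: "\<And>f. f \<in> whitney_functions K \<Longrightarrow>
      smooth_seminorm Q (W f) \<le> CQ * (\<Sum>i\<le>R. whitney_norm K i f)"
    using est[of Q] by blast
  define c where "c = R + \<alpha> + 1"
  define N :: nat where "N = 2 ^ c"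
  have RN: "R \<le> N" using less_exp[of c] by (simp add: N_def c_def)
  have qN: "q \<le> N" unfolding q_def N_def by (intro power_increasing) (auto simp: c_def)
  define TC where "TC = test_const N"
  have TC: "TC \<ge> 0" unfolding TC_def test_const_def using C_ge_1 by (intro mult_nonneg_nonneg) auto
  obtain A where A: "A \<ge> 0" "\<And>g h M M' x. g \<in> smooth_functions \<Longrightarrow> 0 < h \<Longrightarrow> real Q * h \<le> 1 / 2 \<Longrightarrow>
    (\<forall>x\<in>{0..1}. \<bar>g x\<bar> \<le> M) \<Longrightarrow> (\<forall>x\<in>{0..1}. \<bar>hderiv Q g x\<bar> \<le> M') \<Longrightarrow> x \<in> {0..1} \<Longrightarrow>
    \<bar>hderiv q g x\<bar> \<le> A * (M / h ^ q + h ^ (4 * L) * M')"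
    using intermediate_derivative[of q "4 * L"] unfolding Q_def by blast
  define D1 where "D1 = \<bar>C1\<bar> * (real (Suc \<alpha>) * TC)"
  define D2 where "D2 = \<bar>CQ\<bar> * (real (Suc R) * TC)"
  have D: "D1 \<ge> 0" "D2 \<ge> 0" using TC by (simp_all add: D1_def D2_def)
  define E where "E = 2 ^ N * (A * (D1 + D2))"
  have E: "E \<ge> 0" using A(1) D by (simp add: E_def)
  \<comment> \<open>The first bound makes \<open>h\<close> small enough for \<open>Q\<close>
    interpolation steps in [0, 1], the second makes \<open>E * h < 1\<close>.\<close>
  define \<eta> where "\<eta> = min (1 / (2 * real Q + 2)) (1 / (E + 1))"
  have \<eta>: "\<eta> > 0" using E by (simp add: \<eta>_def)
  have "eventually (\<lambda>t. \<delta> t < \<eta> ^ 4) sequentially"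
    using \<delta>_tendsto_0 \<eta> by (intro order_tendstoD) auto
  then obtain T1 where T1: "\<And>t. t \<ge> T1 \<Longrightarrow> \<delta> t < \<eta> ^ 4" by (auto simp: eventually_sequentially)
  obtain T2 where T2: "\<And>s. s \<ge> T2 \<Longrightarrow> 12 * C * \<delta> (Suc s) \<le> \<delta> s"
    using eventually_separated[of "12 * C"] C_ge_1 by auto
  obtain n s where n: "n \<ge> T1 + T2 + c + 2" and s: "s \<ge> 1"
    and cond: "\<epsilon> * (\<Sum>k=s..n+s. weight k) \<le> weight (n + s)" using neg by blast
  define t where "t = n + s"
  \<comment> \<open>Tuned so that \<open>s' + c - (\<alpha> + 1) = t\<close>: the block of indices
    from \<open>p\<close> to \<open>q - 1\<close> then consists of \<open>p\<close> factors
    \<open>\<delta> t\<close>. The lower bound on \<open>n\<close> gives \<open>s' \<ge> s\<close>,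
    so the weights of the test function occur in the violated inequality.\<close>
  define s' where "s' = t + \<alpha> + 1 - c"
  have s': "s' \<ge> s" "s' \<ge> 1" "s' + c = t + \<alpha> + 1" "s' - 1 \<ge> T2"
    using n s by (auto simp: s'_def t_def)
  have sep: "12 * C * \<delta> s' \<le> \<delta> (s' - 1)" using T2[OF s'(4)] s'(2) by simp
  let ?\<pi> = "level_prod (s' + c) N"
  let ?\<omega> = "nodal_poly (v ` {j. j < 2 ^ (s' + c) \<and> j mod 2 ^ s' = 0})"
  obtain f where f: "f \<in> whitney_functions K"
    "\<And>j. j mod 2 ^ s' = 0 \<Longrightarrow> f (v j) = poly ?\<omega> (v j)"
    "\<And>q. q \<le> N \<Longrightarrow> whitney_norm K q f \<le> TC * ?\<pi> q"
    using test_function[OF s'(2) sep, of c] unfolding TC_def N_def by blast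
  obtain F where F: "represents F f" using f(1) unfolding whitney_functions_iff by blast
  have "W f (v j) = poly ?\<omega> (v j)" if "j mod 2 ^ s' = 0" for j
    using ext[OF f(1) v_in_K] f(2)[OF that] by simp
  from divdiff_class_lower[of \<alpha> c s' "W f", OF _ this] obtain X where
    X: "finite X" "card X = Suc q" "X \<subseteq> {0..1}" "?\<pi> q / 2 ^ N \<le> \<bar>divdiff (W f) X\<bar>"
    unfolding q_def N_def by (auto simp: c_def)
  have Wf: "W f \<in> smooth_functions" by (rule estimate_if_continuous(2)[OF cont lin f(1)])
  obtain \<xi> where \<xi>: "\<xi> \<in> {0..1}" "divdiff (W f) X = hderiv q (W f) \<xi> / fact q"
    using divdiff_mean_value[OF Wf X(1-3)] by blast
  have "\<bar>divdiff (W f) X\<bar> \<le> \<bar>hderiv q (W f) \<xi>\<bar>"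
    unfolding \<xi>(2) by (simp add: divide_le_eq mult_le_cancel_left1)
  with X(4) have lower: "?\<pi> q / 2 ^ N \<le> \<bar>hderiv q (W f) \<xi>\<bar>" by linarith
  note \<pi>pos = level_prod_pos[of "s' + c" N]
  have sums: "a * (\<Sum>i\<le>r. whitney_norm K i f) \<le> \<bar>a\<bar> * (real (Suc r) * TC) * b"
    if "\<And>i. i \<le> r \<Longrightarrow> i \<le> N \<and> ?\<pi> i \<le> b" for a b r
  proof -
    have "(\<Sum>i\<le>r. whitney_norm K i f) \<le> (\<Sum>i\<le>r. TC * b)"
    proof (rule sum_mono)
      fix i assume "i \<in> {..r}"
      then have "i \<le> N" "TC * ?\<pi> i \<le> TC * b" using that[of i] TC by (auto intro: mult_left_mono)
      then show "whitney_norm K i f \<le> TC * b" using f(3)[of i] by linarith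
    qed
    then have 1: "(\<Sum>i\<le>r. whitney_norm K i f) \<le> real (Suc r) * TC * b" by simp
    have "a * (\<Sum>i\<le>r. whitney_norm K i f) \<le> \<bar>a\<bar> * (\<Sum>i\<le>r. whitney_norm K i f)"
      by (intro mult_right_mono sum_nonneg whitney_norm_nonneg[OF F]) auto
    also have "\<dots> \<le> \<bar>a\<bar> * (real (Suc r) * TC * b)" by (rule mult_left_mono[OF 1]) simp
    finally show ?thesis by (simp only: mult.assoc)
  qed
  have M: "\<forall>x\<in>{0..1}. \<bar>W f x\<bar> \<le> D1 * ?\<pi> p"
  proof
    fix x :: real assume "x \<in> {0..1}"
    then have "\<bar>W f x\<bar> \<le> smooth_seminorm 1 (W f)"
      using smooth_seminorm_upper[OF Wf, of 0 1 x] by simp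
    also have "\<dots> \<le> C1 * (\<Sum>i\<le>\<alpha>. whitney_norm K i f)" by (rule C1[OF f(1)])
    also have "\<dots> \<le> D1 * ?\<pi> p"
      unfolding D1_def by (rule sums) (use pq qN in \<open>auto intro: level_prod_mono\<close>)
    finally show "\<bar>W f x\<bar> \<le> D1 * ?\<pi> p" .
  qed
  have M': "\<forall>x\<in>{0..1}. \<bar>hderiv Q (W f) x\<bar> \<le> D2"
  proof
    fix x :: real assume "x \<in> {0..1}"
    then have "\<bar>hderiv Q (W f) x\<bar> \<le> smooth_seminorm Q (W f)"
      by (intro smooth_seminorm_upper[OF Wf]) (auto simp: Q_def L_def)
    also have "\<dots> \<le> CQ * (\<Sum>i\<le>R. whitney_norm K i f)" by (rule CQ[OF f(1)])
    also have "\<dots> \<le> D2 * 1"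
      unfolding D2_def
    proof (rule sums)
      fix i assume "i \<le> R"
      then have "i \<le> N" using RN by simp
      then show "i \<le> N \<and> ?\<pi> i \<le> 1"
        using level_prod_mono[of i N N "s' + c"] by (simp add: level_prod_def)
    qed
    finally show "\<bar>hderiv Q (W f) x\<bar> \<le> D2" by simp
  qed
  \<comment> \<open>Since \<open>\<delta> t ^ p = h ^ (2 * q)\<close>, division by
    \<open>h ^ q\<close> leaves at least one factor \<open>h\<close> in the low-order term.\<close>
  define h where "h = root 4 (\<delta> t)"
  have h4: "h ^ 4 = \<delta> t" unfolding h_def using \<delta>_pos[of t] by simp
  have h0: "h > 0" unfolding h_def using \<delta>_pos[of t] by simp
  have h\<eta>: "h < \<eta>"
  proof (rule ccontr)
    assume "\<not> h < \<eta>"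
    then have "\<eta> ^ 4 \<le> h ^ 4" using \<eta> by (intro power_mono) auto
    then show False using T1[of t] n h4 by (simp add: t_def)
  qed
  then have "h < 1 / (2 * real Q + 2)" "h < 1 / (E + 1)" by (auto simp: \<eta>_def)
  then have hQ: "(2 * real Q + 2) * h < 1" and hE: "(E + 1) * h < 1"
    using E by (simp_all add: pos_less_divide_eq mult.commute)
  have hQ': "real Q * h \<le> 1 / 2" using hQ h0 by (simp add: distrib_right)
  have "0 \<le> E * h" using E h0 by simp
  then have Eh: "E * h < 1" and h1: "h \<le> 1" using hE h0 by (simp_all add: distrib_right)
  have up: "\<bar>hderiv q (W f) \<xi>\<bar> \<le> A * (D1 * ?\<pi> p / h ^ q + h ^ (4 * L) * D2)"
    by (rule A(2)[OF Wf h0 hQ' M M' \<xi>(1)])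
  have split: "?\<pi> p = \<delta> t ^ p * ?\<pi> q"
  proof -
    have "(\<Prod>i=p..<q. \<delta> (s' + c - blen i)) = (\<Prod>l=\<alpha>..<\<alpha> + 1. \<delta> (s' + c - Suc l) ^ 2 ^ l)"
      unfolding p_def q_def by (rule prod_blen) simp
    also have "\<dots> = \<delta> t ^ p" using s'(3) by (simp add: p_def)
    finally show ?thesis using level_prod_split[OF pq(2) qN, of "s' + c"] by simp
  qed
  have a: "D1 * ?\<pi> p / h ^ q \<le> D1 * ?\<pi> q * h"
  proof -
    have "\<delta> t ^ p = h ^ (2 * p) * h ^ q"
      unfolding h4[symmetric] pq(1) by (simp flip: power_mult power_add)
    then have "D1 * ?\<pi> p / h ^ q = D1 * ?\<pi> q * h ^ (2 * p)"
      using h0 by (simp add: split)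
    also have "h ^ (2 * p) \<le> h ^ 1" using h0 h1 pq(4) by (intro power_decreasing) auto
    finally show ?thesis using D \<pi>pos[of q] by (simp add: mult_left_mono)
  qed
  have b: "h ^ (4 * L) * D2 \<le> D2 * ?\<pi> q * h"
  proof -
    have "\<delta> t ^ L0 \<le> ?\<pi> p"
    proof -
      have "(\<Sum>k=s'..t. weight k) \<le> (\<Sum>k=s..t. weight k)"
        by (rule sum_mono2) (use s'(1) weight_nonneg in auto)
      then have "\<epsilon> * (\<Sum>k=s'..t. weight k) \<le> weight t"
        using cond \<epsilon> unfolding t_def[symmetric] by (meson mult_left_mono less_imp_le order_trans)
      then have S: "(\<Sum>k=s'..t. weight k) \<le> weight t / \<epsilon>"
        using \<epsilon> by (simp add: pos_le_divide_eq mult.commute)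
      \<comment> \<open>The violated inequality bounds the weights from \<open>s'\<close> to
        \<open>t\<close> by \<open>weight t / \<epsilon>\<close>. Since
        \<open>2 ^ (s' + c) = 2 ^ (t + 1) * p\<close>, this compares the logarithm of the product
        with \<open>p / \<epsilon>\<close> times that of \<open>\<delta> t\<close>.\<close>
      have "ln (\<delta> t ^ L0) = - (real L0 * (2 ^ (t + 1) * weight t))"
        using \<delta>_pos[of t] by (simp add: ln_realpow ln_\<delta>)
      also have "\<dots> \<le> - (real p / \<epsilon> * (2 ^ (t + 1) * weight t))"
        using L0 weight_nonneg[of t] by (intro le_imp_neg_le mult_right_mono) auto
      also have "\<dots> = - (2 ^ (s' + c) * (weight t / \<epsilon>))"
        unfolding s'(3) p_def by (simp add: power_add mult_ac)
      also have "\<dots> \<le> - (2 ^ (s' + c) * (\<Sum>k=s'..t. weight k))"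
        using S by (intro le_imp_neg_le mult_left_mono) auto
      also have "(\<Sum>k=s'..t. weight k) = (\<Sum>k=s'+c-c..<s'+c-\<alpha>. weight k)"
      proof -
        have "s' + c - c = s'" "s' + c - \<alpha> = Suc t" using s'(3) by arith+
        then show ?thesis by (simp only: atLeastLessThanSuc_atLeastAtMost)
      qed
      also have "- (2 ^ (s' + c) * (\<Sum>k=s'+c-c..<s'+c-\<alpha>. weight k)) = ln (?\<pi> p)"
        unfolding level_prod_def p_def N_def by (rule ln_prod_blen[symmetric]) (auto simp: c_def)
      finally show ?thesis using ln_le_cancel_iff[OF _ \<pi>pos] \<delta>_pos[of t] by simp
    qed
    also have "?\<pi> p \<le> ?\<pi> q" by (rule level_prod_mono[OF pq(2) qN])
    finally have "\<delta> t ^ L0 * \<delta> t \<le> ?\<pi> q * h"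
      using power_decreasing[of 1 4 h] h0 h1 h4 \<pi>pos[of q] \<delta>_pos[of t] by (intro mult_mono) auto
    moreover have "h ^ (4 * L) = \<delta> t ^ L0 * \<delta> t"
      unfolding power_mult h4 L_def by simp
    ultimately show ?thesis using D by (simp add: mult_ac mult_left_mono)
  qed
  have "?\<pi> q / 2 ^ N \<le> A * (D1 * ?\<pi> q * h + D2 * ?\<pi> q * h)"
    using lower up mult_left_mono[OF add_mono[OF a b] A(1)] by linarith
  then have "?\<pi> q \<le> 2 ^ N * (A * (D1 * ?\<pi> q * h + D2 * ?\<pi> q * h))"
    by (simp add: pos_divide_le_eq mult.commute)
  also have "\<dots> = (E * h) * ?\<pi> q"
    by (simp add: E_def algebra_simps)
  also have "\<dots> < 1 * ?\<pi> q" using Eh \<pi>pos[of q] by (intro mult_strict_right_mono)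
  finally show False by simp
qed

end

section \<open>Sufficiency\<close>

lemma higher_pderiv_diff: "(pderiv ^^ n) (p - q) = (pderiv ^^ n) p - (pderiv ^^ n) q" for p q ::
    "real poly"
  using higher_pderiv_add[of n p "- q"] higher_pderiv_smult[of n "-1" q] by simp

lemma lagrange_lincomb:
  "lagrange (\<lambda>x. a * f x + b * g x) X = smult a (lagrange f X) + smult b (lagrange g X)"
  by (rule poly_eqI) (simp add: lagrange_def coeff_sum sum_distrib_left distrib_right sum.distrib
      mult.assoc
      add_divide_distrib)

lemma blen_Suc_le: "blen (Suc s) \<le> Suc (blen s)"
proof -
  have "s < 2 ^ blen s" using blen_le_iff by blast
  then have "Suc s < 2 ^ Suc (blen s)" by simp
  then show ?thesis unfolding blen_le_iff .
qed

lemma power_blen_le: "s \<ge> 1 \<Longrightarrow> 2 ^ blen s \<le> 2 * s"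
proof -
  assume s: "s \<ge> 1"
  then have b: "blen s \<ge> 1" using blen_le_iff[of s 0] by simp
  then have "\<not> s < 2 ^ (blen s - 1)" unfolding blen_le_iff[symmetric] by simp
  then have "2 * 2 ^ (blen s - 1) \<le> 2 * s" by simp
  then show ?thesis using b by (simp flip: power_Suc)
qed

lemma chain_difference_bound:
  fixes g :: "nat \<Rightarrow> real"
  assumes "T1 \<le> T2" "\<And>T. T1 \<le> T \<Longrightarrow> T < T2 \<Longrightarrow> \<bar>g (Suc T) - g T\<bar> \<le> b"
  shows "\<bar>g T2 - g T1\<bar> \<le> real (T2 - T1) * b"
  using assms
proof (induction T2 rule: dec_induct)
  case (step n)
  have "\<bar>g (Suc n) - g T1\<bar> \<le> \<bar>g (Suc n) - g n\<bar> + \<bar>g n - g T1\<bar>" by linarith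
  also have "\<dots> \<le> b + real (n - T1) * b"
    using step by (intro add_mono step.IH step.prems) auto
  also have "\<dots> = real (Suc n - T1) * b"
    using step.hyps by (simp add: Suc_diff_le distrib_right)
  finally show ?case .
qed simp

section \<open>Local interpolants and their change from one level to the next\<close>

context cantor_coding
begin

definition node_set :: "nat \<Rightarrow> nat \<Rightarrow> nat \<Rightarrow> nat set" where
  "node_set s t a = {j. j < 2 ^ t \<and> j mod 2 ^ s = a mod 2 ^ s}"

lemma finite_node_set [simp]: "finite (node_set s t a)"
  by (simp add: node_set_def)

lemma card_node_set: "s \<le> t \<Longrightarrow> card (node_set s t a) = 2 ^ (t - s)"
  unfolding node_set_def by (rule card_residue_power)

text \<open>Up to level \<open>s\<close> there is only one class. Beyond it, any class among the
  numbers up to \<open>T\<close> has at most one element more than the class of \<open>a\<close>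
  below \<open>T\<close>, and the latter lies entirely in \<open>Y\<close>.\<close>

lemma residue_domination:
  fixes s k a a' b T :: nat
  assumes X: "finite Y" "b \<notin> Y" "insert b Y \<subseteq> {j. j \<le> T \<and> j mod 2 ^ s = a mod 2 ^ s}"
    and Y: "{j. j < T \<and> j mod 2 ^ Suc s = a mod 2 ^ Suc s} \<subseteq> Y"
  shows "card {j\<in>insert b Y. j mod 2 ^ k = a' mod 2 ^ k} \<le> card {j\<in>Y. j mod 2 ^ k = a mod 2 ^ k} +
      1"
proof (cases "k \<le> s")
  case True
  have "j mod 2 ^ k = a mod 2 ^ k" if "j \<in> Y" for j
    by (rule mod_power_mono[OF _ True]) (use X(3) that in blast)
  then have "Y = {j\<in>Y. j mod 2 ^ k = a mod 2 ^ k}" by blast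
  moreover have "card {j\<in>insert b Y. j mod 2 ^ k = a' mod 2 ^ k} \<le> card (insert b Y)"
    using X(1) by (intro card_mono) auto
  ultimately show ?thesis using X(1,2) by simp
next
  case False
  have "card {j\<in>insert b Y. j mod 2 ^ k = a' mod 2 ^ k} \<le> card {j. j < Suc T \<and> j mod 2 ^ k = a'
      mod 2 ^ k}"
    using X(3) by (intro card_mono) auto
  also have "\<dots> \<le> T div 2 ^ k + 1" by (rule card_residue_bounds(2)) simp
  also have "T div 2 ^ k \<le> card {j. j < T \<and> j mod 2 ^ k = a mod 2 ^ k}"
    by (rule card_residue_bounds(1)) simp
  also have "\<dots> \<le> card {j\<in>Y. j mod 2 ^ k = a mod 2 ^ k}"
  proof (rule card_mono)
    show "{j. j < T \<and> j mod 2 ^ k = a mod 2 ^ k} \<subseteq> {j\<in>Y. j mod 2 ^ k = a mod 2 ^ k}"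
    proof
      fix j assume j: "j \<in> {j. j < T \<and> j mod 2 ^ k = a mod 2 ^ k}"
      have "j mod 2 ^ Suc s = a mod 2 ^ Suc s"
        by (rule mod_power_mono[of j k a]) (use j False in simp_all)
      then show "j \<in> {j\<in>Y. j mod 2 ^ k = a mod 2 ^ k}" using j Y by blast
    qed
  qed (use X(1) in simp)
  finally show ?thesis by simp
qed

definition interp_deriv :: "(real \<Rightarrow> real) \<Rightarrow> nat \<Rightarrow> real \<Rightarrow> nat set \<Rightarrow> real" where
  "interp_deriv f k x Y = poly ((pderiv ^^ k) (lagrange f (v ` Y))) x"

text \<open>One differentiated Newton term. As \<open>Y\<close> lies below
  \<open>2 ^ (t + 2)\<close>, it has at most 4 nodes in the class of \<open>a\<close> modulo
  \<open>2 ^ t\<close>, which \<open>3 \<le> m\<close> covers; at the coarser levels used,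
  \<open>sup'\<close> makes the class of \<open>a\<close> full.\<close>

lemma interp_deriv_insert:
  fixes s t a b m T k :: nat
  defines "R \<equiv> \<Prod>i<2^m. \<delta> (t - blen i)"
  assumes Y: "finite Y" "b \<notin> Y" and m: "3 \<le> m" "m + s + 1 \<le> t"
    and sub: "insert b Y \<subseteq> {j. j \<le> T \<and> j mod 2 ^ s = a mod 2 ^ s}"
    and sup: "{j. j < T \<and> j mod 2 ^ Suc s = a mod 2 ^ Suc s} \<subseteq> Y"
    and sup': "node_set (Suc s) t a \<subseteq> Y" and top: "Y \<subseteq> {..<2 ^ (t + 2)}" and card: "card Y \<le> n"
    and base: "\<And>Z. Z \<subseteq> v ` insert b Y \<Longrightarrow> card Z = Suc (2 ^ m) \<Longrightarrow> \<bar>divdiff f Z\<bar> \<le> A"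
    and A: "A \<ge> 0" and x: "\<bar>x - v a\<bar> \<le> 3 * C * \<delta> t"
  shows "\<bar>interp_deriv f k x (insert b Y) - interp_deriv f k x Y\<bar> \<le>
    real n ^ k / \<delta> t ^ k * (A * (16 * C) ^ n * R)"
proof -
  have R: "R \<ge> 0" unfolding R_def by (intro prod_nonneg) (auto simp: less_imp_le[OF \<delta>_pos])
  have vb: "v b \<notin> v ` Y" using Y(2) injD[OF inj_v] by blast
  have cardv: "card (v ` Y) = card Y" by (rule card_image) (rule inj_on_subset[OF inj_v
      subset_UNIV])
  have "interp_deriv f k x (insert b Y) - interp_deriv f k x Y =
      divdiff f (v ` insert b Y) * poly ((pderiv ^^ k) (nodal_poly (v ` Y))) x"
    unfolding interp_deriv_def image_insert
    by (subst lagrange_insert) (use Y vb in \<open>auto simp: higher_pderiv_add higher_pderiv_smult\<close>)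
  also have "\<bar>\<dots>\<bar> \<le> \<bar>divdiff f (v ` insert b Y)\<bar> *
      (real (card Y) ^ k / \<delta> t ^ k * (\<Prod>y\<in>v ` Y. max \<bar>x - y\<bar> (\<delta> t)))"
    unfolding abs_mult
    using higher_deriv_nodal_bound[of "v ` Y" "\<delta> t" k x] Y(1) \<delta>_pos cardv
    by (intro mult_left_mono) auto
  also have "\<dots> = real (card Y) ^ k / \<delta> t ^ k *
      (\<bar>divdiff f (v ` insert b Y)\<bar> * (\<Prod>y\<in>v ` Y. max \<bar>x - y\<bar> (\<delta> t)))"
    by (simp only: mult_ac)
  also have "\<dots> \<le> real (card Y) ^ k / \<delta> t ^ k * (A * (16 * C) ^ card Y * R)"
  proof (rule mult_left_mono)
    show "\<bar>divdiff f (v ` insert b Y)\<bar> * (\<Prod>y\<in>v ` Y. max \<bar>x - y\<bar> (\<delta> t)) \<le> A * (16 * C) ^ card Y * R"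
      unfolding R_def
    proof (rule divdiff_times_nodal_le[OF Y])
      show "card {j\<in>Y. j mod 2 ^ t = a mod 2 ^ t} \<le> 2 ^ m"
      proof -
        have "card {j\<in>Y. j mod 2 ^ t = a mod 2 ^ t} \<le> card {j. j < 2 ^ (t + 2) \<and> j mod 2 ^ t = a
            mod 2 ^ t}"
          using top by (intro card_mono) auto
        also have "\<dots> = 2 ^ 2" by (subst card_residue_power) auto
        also have "\<dots> \<le> 2 ^ m" using m(1) by (intro power_increasing) auto
        finally show ?thesis .
      qed
      show "2 ^ k \<le> card {j\<in>Y. j mod 2 ^ (t - k) = a mod 2 ^ (t - k)}" if "k \<le> m" for k
      proof -
        have "Suc s \<le> t - k" using that m by simp
        then have "{j. j < 2 ^ t \<and> j mod 2 ^ (t - k) = a mod 2 ^ (t - k)} \<subseteq>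
            {j\<in>Y. j mod 2 ^ (t - k) = a mod 2 ^ (t - k)}"
          using sup' mod_power_mono[of _ "t - k" a "Suc s"] unfolding node_set_def by blast
        then have "card {j. j < 2 ^ t \<and> j mod 2 ^ (t - k) = a mod 2 ^ (t - k)} \<le>
            card {j\<in>Y. j mod 2 ^ (t - k) = a mod 2 ^ (t - k)}"
          using Y(1) by (intro card_mono) auto
        then show ?thesis
          using card_residue_power[of "t - k" t a] that m by simp
      qed
    qed (use m base A x residue_domination[OF Y sub sup] in auto)
  qed (use \<delta>_pos[of t] in simp)
  also have "\<dots> \<le> real n ^ k / \<delta> t ^ k * (A * (16 * C) ^ n * R)"
    using card A R C_ge_1 \<delta>_pos[of t]
    by (intro mult_mono mult_right_mono mult_left_mono divide_right_mono power_mono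
        power_increasing) auto
  finally show ?thesis .
qed

text \<open>A class modulo \<open>2 ^ s\<close> has \<open>2 ^ blen s\<close> indices below
  \<open>2 ^ lev s\<close>. For \<open>s \<ge> 1\<close> this is more than \<open>s\<close> and at
  most \<open>2 * s\<close>, hence unbounded but linear.\<close>

definition lev :: "nat \<Rightarrow> nat" where
  "lev s = s + blen s"

lemma lev_Suc: "lev s < lev (Suc s)" "lev (Suc s) \<le> lev s + 2"
  using blen_Suc_le[of s] blen_mono[of s "Suc s"] by (auto simp: lev_def)

text \<open>Both node sets arise from the common set \<open>node_set (Suc s) t a\<close> by
  inserting nodes one at a time: finer nodes in the half of \<open>a\<close> on one side, the nodes
  of the other half on the other. The half of \<open>a\<close> stays full throughout, so every
  insertion is an admissible Newton step.\<close>

lemma interp_deriv_increment: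
  fixes s a m k :: nat
  defines "t \<equiv> lev s"
  defines "R \<equiv> \<Prod>i<2^m. \<delta> (t - blen i)"
  assumes s: "s \<ge> 1" and m: "3 \<le> m" "m + 1 \<le> blen s"
    and base: "\<And>Z. Z \<subseteq> K \<Longrightarrow> finite Z \<Longrightarrow> card Z = Suc (2 ^ m) \<Longrightarrow> \<bar>divdiff f Z\<bar> \<le> A"
    and A: "A \<ge> 0" and x: "\<bar>x - v a\<bar> \<le> 3 * C * \<delta> t"
  shows "\<bar>interp_deriv f k x (node_set (Suc s) (lev (Suc s)) a) - interp_deriv f k x (node_set s t
      a)\<bar> \<le>
    8 * 2 ^ t * (real (4 * s) ^ k / \<delta> t ^ k * (A * (16 * C) ^ (4 * s) * R))"
proof -
  define b where "b = real (4 * s) ^ k / \<delta> t ^ k * (A * (16 * C) ^ (4 * s) * R)"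
  define t' where "t' = lev (Suc s)"
  have R: "R \<ge> 0" unfolding R_def by (intro prod_nonneg) (auto simp: less_imp_le[OF \<delta>_pos])
  have b0: "b \<ge> 0" unfolding b_def using A R C_ge_1 \<delta>_pos[of t] by simp
  have t': "t \<le> t'" "t' \<le> t + 2" using lev_Suc[of s] by (auto simp: t_def t'_def)
  have mt: "m + s + 1 \<le> t" using m by (simp add: t_def lev_def)
  have c1: "card (node_set (Suc s) t' a) \<le> 4 * s"
  proof -
    have "card (node_set (Suc s) t' a) = 2 ^ blen (Suc s)"
      by (subst card_node_set) (auto simp: t'_def lev_def)
    also have "\<dots> \<le> 2 * Suc s" by (rule power_blen_le) simp
    finally show ?thesis using s by simp
  qed
  have c2: "card (node_set s t a) \<le> 4 * s"
  proof -
    have "card (node_set s t a) = 2 ^ blen s"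
      by (subst card_node_set) (auto simp: t_def lev_def)
    also have "\<dots> \<le> 2 * s" by (rule power_blen_le[OF s])
    finally show ?thesis by simp
  qed
  have baseZ: "\<bar>divdiff f Z\<bar> \<le> A" if "Z \<subseteq> v ` S" "card Z = Suc (2 ^ m)" for Z S
  proof (rule base)
    show "Z \<subseteq> K" using that(1) v_in_K by blast
    show "finite Z" using that(2) card.infinite by fastforce
  qed (rule that(2))
  have sub1: "j mod 2 ^ s = a mod 2 ^ s" if "j mod 2 ^ Suc s = a mod 2 ^ Suc s" for j
    using mod_power_mono[OF that, of s] by simp
  have sub2: "node_set (Suc s) t a \<subseteq> node_set s t a"
    unfolding node_set_def using sub1 by blast
  have up: "\<bar>interp_deriv f k x (node_set (Suc s) t' a) - interp_deriv f k x (node_set (Suc s) t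
      a)\<bar> \<le>
      real (2 ^ t' - 2 ^ t) * b"
  proof -
    define Y where "Y T = {j. j < T \<and> j mod 2 ^ Suc s = a mod 2 ^ Suc s}" for T
    have "\<bar>interp_deriv f k x (Y (2 ^ t')) - interp_deriv f k x (Y (2 ^ t))\<bar> \<le> real (2 ^ t' - 2 ^
        t) * b"
    proof (rule chain_difference_bound[of "2 ^ t" "2 ^ t'" "\<lambda>T. interp_deriv f k x (Y T)"])
      show "(2 :: nat) ^ t \<le> 2 ^ t'" using t' by (intro power_increasing) auto
      fix T :: nat assume T: "2 ^ t \<le> T" "T < 2 ^ t'"
      show "\<bar>interp_deriv f k x (Y (Suc T)) - interp_deriv f k x (Y T)\<bar> \<le> b"
      proof (cases "T mod 2 ^ Suc s = a mod 2 ^ Suc s")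
        case True
        then have YS: "Y (Suc T) = insert T (Y T)" by (auto simp: Y_def less_Suc_eq)
        have sb: "Y T \<subseteq> node_set (Suc s) t' a" using T(2) by (auto simp: Y_def node_set_def)
        have "(2 :: nat) ^ t' \<le> 2 ^ (t + 2)" using t' by (intro power_increasing) auto
        then have top: "Y T \<subseteq> {..<2 ^ (t + 2)}" using T(2) by (auto simp: Y_def)
        show ?thesis
          unfolding YS b_def R_def
        proof (rule interp_deriv_insert[OF _ _ m(1) mt])
          show "insert T (Y T) \<subseteq> {j. j \<le> T \<and> j mod 2 ^ s = a mod 2 ^ s}"
          proof
            fix j assume "j \<in> insert T (Y T)"
            then have "j \<le> T" "j mod 2 ^ Suc s = a mod 2 ^ Suc s" using True unfolding Y_def by auto
            with sub1 show "j \<in> {j. j \<le> T \<and> j mod 2 ^ s = a mod 2 ^ s}" by blast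
          qed
          show "node_set (Suc s) t a \<subseteq> Y T" using T(1) by (auto simp: Y_def node_set_def)
          show "card (Y T) \<le> 4 * s"
            using card_mono[OF finite_node_set sb] c1 by linarith
          show "\<bar>divdiff f Z\<bar> \<le> A" if "Z \<subseteq> v ` insert T (Y T)" "card Z = Suc (2 ^ m)" for Z
            by (rule baseZ[OF that])
          show "Y T \<subseteq> {..<2 ^ (t + 2)}" by (rule top)
        qed (use A x in \<open>auto simp: Y_def\<close>)
      next
        case False
        then have "Y (Suc T) = Y T" by (auto simp: Y_def less_Suc_eq)
        then show ?thesis using b0 by simp
      qed
    qed
    then show ?thesis by (simp add: Y_def node_set_def)
  qed
  have down: "\<bar>interp_deriv f k x (node_set s t a) - interp_deriv f k x (node_set (Suc s) t a)\<bar> \<le>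
      real (2 ^ t - 0) * b"
  proof -
    define Y where "Y T = node_set (Suc s) t a \<union> {j. j < T \<and> j mod 2 ^ s = a mod 2 ^ s}" for T
    have "\<bar>interp_deriv f k x (Y (2 ^ t)) - interp_deriv f k x (Y 0)\<bar> \<le> real (2 ^ t - 0) * b"
    proof (rule chain_difference_bound[of 0 "2 ^ t" "\<lambda>T. interp_deriv f k x (Y T)"])
      fix T :: nat assume T: "T < 2 ^ t"
      show "\<bar>interp_deriv f k x (Y (Suc T)) - interp_deriv f k x (Y T)\<bar> \<le> b"
      proof (cases "T mod 2 ^ s = a mod 2 ^ s \<and> T \<notin> Y T")
        case True
        then have YS: "Y (Suc T) = insert T (Y T)" by (auto simp: Y_def less_Suc_eq)
        have sb: "Y T \<subseteq> node_set s t a"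
          unfolding Y_def by (rule Un_least[OF sub2]) (use T in \<open>auto simp: node_set_def\<close>)
        have top: "Y T \<subseteq> {..<2 ^ (t + 2)}"
        proof
          fix j assume "j \<in> Y T"
          then have "j < 2 ^ t" using sb by (auto simp: node_set_def)
          also have "(2 :: nat) ^ t \<le> 2 ^ (t + 2)" by (intro power_increasing) auto
          finally show "j \<in> {..<2 ^ (t + 2)}" by simp
        qed
        show ?thesis
          unfolding YS b_def R_def
        \<comment> \<open>The half of \<open>a\<close> is already full up to \<open>2 ^ t\<close>,
          so the counting bound is taken at the end of the range, whichever nodes of the other half
          are present.\<close>
        proof (rule interp_deriv_insert[OF _ _ m(1) mt, where T = "2 ^ t - 1"])
          show "insert T (Y T) \<subseteq> {j. j \<le> 2 ^ t - 1 \<and> j mod 2 ^ s = a mod 2 ^ s}"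
            using True T sb by (auto simp: node_set_def)
          show "{j. j < 2 ^ t - 1 \<and> j mod 2 ^ Suc s = a mod 2 ^ Suc s} \<subseteq> Y T"
            by (auto simp: Y_def node_set_def)
          show "card (Y T) \<le> 4 * s"
            using card_mono[OF finite_node_set sb] c2 by linarith
          show "finite (Y T)" by (rule finite_subset[OF sb finite_node_set])
          show "\<bar>divdiff f Z\<bar> \<le> A" if "Z \<subseteq> v ` insert T (Y T)" "card Z = Suc (2 ^ m)" for Z
            by (rule baseZ[OF that])
          show "Y T \<subseteq> {..<2 ^ (t + 2)}" by (rule top)
          show "T \<notin> Y T" using True by blast
          show "node_set (Suc s) t a \<subseteq> Y T" by (simp add: Y_def)
        qed (rule A, rule x)
      next
        case False
        then have "Y (Suc T) = Y T" by (auto simp: Y_def less_Suc_eq)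
        then show ?thesis using b0 by simp
      qed
    qed simp
    moreover have "Y (2 ^ t) = node_set s t a" "Y 0 = node_set (Suc s) t a"
      unfolding Y_def node_set_def[symmetric] using sub2 by auto
    ultimately show ?thesis by simp
  qed
  have "real (2 ^ t' - 2 ^ t) + real (2 ^ t - 0) = 2 ^ t'"
    using t' by (simp add: of_nat_diff)
  also have "\<dots> \<le> 2 ^ (t + 2)" using t' by (intro power_increasing) auto
  also have "\<dots> \<le> 8 * 2 ^ t" by (simp add: power_add)
  finally have "(real (2 ^ t' - 2 ^ t) + real (2 ^ t - 0)) * b \<le> 8 * 2 ^ t * b"
    using b0 by (rule mult_right_mono)
  then show ?thesis
    using up down unfolding b_def[symmetric] t'_def[symmetric] distrib_right by linarith
qed

section \<open>Gluing local polynomials by bumps\<close>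

definition local_bump :: "nat \<Rightarrow> nat \<Rightarrow> real \<Rightarrow> real" where
  "local_bump t a x = bump (1 / (C * \<delta> t) * x + - v a / (C * \<delta> t))"

lemma scale_pos: "C * \<delta> t > 0"
  using C_ge_1 \<delta>_pos[of t] by simp

lemma local_bump_arg: "1 / (C * \<delta> t) * x + - v a / (C * \<delta> t) = (x - v a) / (C * \<delta> t)"
  by (simp add: diff_divide_distrib)

lemma smooth_local_bump:
  "local_bump t a \<in> smooth_functions"
  "hderiv k (local_bump t a) x = (1 / (C * \<delta> t)) ^ k * hderiv k bump ((x - v a) / (C * \<delta> t))"
proof -
  show "local_bump t a \<in> smooth_functions"
    unfolding local_bump_def[abs_def] by (rule smooth_affine(1)[OF smooth_bump])
  show "hderiv k (local_bump t a) x = (1 / (C * \<delta> t)) ^ k * hderiv k bump ((x - v a) / (C * \<delta> t))"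
    unfolding local_bump_def[abs_def] smooth_affine(2)[OF smooth_bump] by (simp only:
        local_bump_arg)
qed

lemma hderiv_local_bump_0:
  assumes "\<bar>x - v a\<bar> > 3 * C * \<delta> t"
  shows "hderiv k (local_bump t a) x = 0"
proof -
  have "3 < \<bar>(x - v a) / (C * \<delta> t)\<bar>"
    using assms scale_pos[of t] by (simp add: pos_less_divide_eq mult.assoc)
  then show ?thesis unfolding smooth_local_bump(2) by (simp add: hderiv_bump_0)
qed

text \<open>The rescaled argument is at most 1 on the class of \<open>a\<close>, and at least 3 on
  the others because their distance \<open>\<delta> t / 2\<close> exceeds three radii. On the coded
  points the bumps of one level are thus a partition of unity.\<close>

lemma local_bump_node:
  assumes "6 * C * \<delta> (Suc t) \<le> \<delta> t"
  shows "local_bump (Suc t) a (v i) = (if i mod 2 ^ Suc t = a mod 2 ^ Suc t then 1 else 0)"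
proof (cases "i mod 2 ^ Suc t = a mod 2 ^ Suc t")
  case True
  have "\<bar>(v i - v a) / (C * \<delta> (Suc t))\<bar> \<le> 1"
    using near[OF True] scale_pos[of "Suc t"] by (simp add: pos_divide_le_eq)
  then show ?thesis unfolding local_bump_def local_bump_arg using True by (simp add: bump_1)
next
  case False
  have "3 * (C * \<delta> (Suc t)) \<le> \<bar>v i - v a\<bar>"
    using far[OF False] assms by (simp add: mult.assoc)
  then have "3 \<le> \<bar>(v i - v a) / (C * \<delta> (Suc t))\<bar>"
    using scale_pos[of "Suc t"] by (simp add: pos_le_divide_eq)
  then show ?thesis unfolding local_bump_def local_bump_arg using False by (simp add: bump_0)
qed

definition patch :: "nat \<Rightarrow> (nat \<Rightarrow> real poly) \<Rightarrow> real \<Rightarrow> real" where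
  "patch t P x = (\<Sum>a<2^t. local_bump t a x * poly (P a) x)"

lemma smooth_patch:
  "patch t P \<in> smooth_functions"
  "hderiv k (patch t P) x = (\<Sum>a<2^t. \<Sum>i\<le>k. real (k choose i) *
    (hderiv i (local_bump t a) x * poly ((pderiv ^^ (k - i)) (P a)) x))"
proof -
  have sm: "(\<lambda>x. local_bump t a x * poly (P a) x) \<in> smooth_functions" for a
    by (rule smooth_mult(1)[OF smooth_local_bump(1) smooth_poly(1)])
  show "patch t P \<in> smooth_functions"
    unfolding patch_def[abs_def] by (rule smooth_sum(1)[OF sm])
  show "hderiv k (patch t P) x = (\<Sum>a<2^t. \<Sum>i\<le>k. real (k choose i) *
    (hderiv i (local_bump t a) x * poly ((pderiv ^^ (k - i)) (P a)) x))"
    unfolding patch_def[abs_def] smooth_sum(2)[OF sm] smooth_mult(2)[OF smooth_local_bump(1)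
        smooth_poly(1)]
      smooth_poly(2) ..
qed

lemma two_power_le: "2 ^ t \<le> 1 / \<delta> t"
proof -
  have "\<delta> t \<le> (1 / 2) ^ t"
    by (rule order_trans[OF \<delta>_le_power power_mono]) auto
  then have "2 ^ t * \<delta> t \<le> 2 ^ t * (1 / 2) ^ t" by (rule mult_left_mono) simp
  also have "\<dots> = 1" by (simp flip: power_mult_distrib)
  finally show ?thesis using \<delta>_pos[of t] by (simp add: pos_le_divide_eq)
qed

text \<open>Differentiated bumps cost at most \<open>1 / \<delta> t ^ p\<close>, and the sum over
  \<open>2 ^ t\<close> classes costs one further factor by \<open>two_power_le\<close>. Bounds on
  the polynomials are requested only on the supports of their bumps.\<close>

lemma patch_bound:
  "\<exists>M\<ge>0. \<forall>t P b x k. k \<le> p \<longrightarrow> 0 \<le> b \<longrightarrow>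
    (\<forall>a<2^t. \<bar>x - v a\<bar> \<le> 3 * C * \<delta> t \<longrightarrow> (\<forall>i\<le>k. \<bar>poly ((pderiv ^^ i) (P a)) x\<bar> \<le> b)) \<longrightarrow>
    \<bar>hderiv k (patch t P) x\<bar> \<le> M * (b / \<delta> t ^ (p + 1))"
proof -
  obtain M where M: "M \<ge> 0" "\<And>k x. k \<le> p \<Longrightarrow> \<bar>hderiv k bump x\<bar> \<le> M"
    using bump_bounded[of p] by blast
  have "\<bar>hderiv k (patch t P) x\<bar> \<le> (real (Suc p) * 2 ^ p * M) * (b / \<delta> t ^ (p + 1))"
    if k: "k \<le> p" and b: "0 \<le> b" and
      P: "\<forall>a<2^t. \<bar>x - v a\<bar> \<le> 3 * C * \<delta> t \<longrightarrow> (\<forall>i\<le>k. \<bar>poly ((pderiv ^^ i) (P a)) x\<bar> \<le> b)"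
    for t P b x k
  proof -
    define E where "E = 2 ^ p * (M / \<delta> t ^ p * b)"
    have dp: "\<delta> t ^ p > 0" using \<delta>_pos[of t] by simp
    have E0: "E \<ge> 0" unfolding E_def using M(1) b dp by simp
    have inner: "\<bar>real (k choose i) * (hderiv i (local_bump t a) x * poly ((pderiv ^^ (k - i)) (P
        a)) x)\<bar> \<le> E"
      if a: "a < 2 ^ t" and i: "i \<le> k" for a i
    proof (cases "\<bar>x - v a\<bar> \<le> 3 * C * \<delta> t")
      case False
      then have "hderiv i (local_bump t a) x = 0" by (intro hderiv_local_bump_0) simp
      then show ?thesis using E0 by simp
    next
      case True
      have "(1 / (C * \<delta> t)) ^ i \<le> (1 / \<delta> t) ^ i"
        using C_ge_1 \<delta>_pos[of t] by (intro power_mono divide_left_mono) auto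
      also have "\<dots> \<le> (1 / \<delta> t) ^ p"
        using \<delta>_pos[of t] \<delta>_le_1[of t] i k by (intro power_increasing) auto
      finally have 1: "(1 / (C * \<delta> t)) ^ i \<le> 1 / \<delta> t ^ p" by (simp add: power_one_over)
      have "\<bar>hderiv i (local_bump t a) x\<bar> = (1 / (C * \<delta> t)) ^ i * \<bar>hderiv i bump ((x - v a) / (C *
          \<delta> t))\<bar>"
        unfolding smooth_local_bump(2) abs_mult using scale_pos[of t] by simp
      also have "\<dots> \<le> 1 / \<delta> t ^ p * M"
        by (rule mult_mono[OF 1 M(2)]) (use i k dp in auto)
      finally have 2: "\<bar>hderiv i (local_bump t a) x\<bar> \<le> M / \<delta> t ^ p" by simp
      have 3: "\<bar>poly ((pderiv ^^ (k - i)) (P a)) x\<bar> \<le> b" using P a True by simp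
      have "real (k choose i) \<le> 2 ^ k"
        using binomial_le_pow2[of k i] by (metis of_nat_le_iff of_nat_numeral of_nat_power)
      also have "\<dots> \<le> 2 ^ p" using k by (intro power_increasing) auto
      finally show ?thesis
        unfolding abs_mult E_def using 2 3 M(1) dp b by (intro mult_mono) auto
    qed
    have "\<bar>hderiv k (patch t P) x\<bar> \<le> (\<Sum>a<(2::nat)^t. real (Suc p) * E)"
      unfolding smooth_patch(2)
    proof (rule order_trans[OF sum_abs], rule sum_mono)
      fix a :: nat assume a: "a \<in> {..<2 ^ t}"
      have "\<bar>\<Sum>i\<le>k. real (k choose i) * (hderiv i (local_bump t a) x * poly ((pderiv ^^ (k - i)) (P
          a)) x)\<bar> \<le> (\<Sum>i\<le>k. E)"
        by (rule order_trans[OF sum_abs], rule sum_mono) (use inner a in simp)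
      also have "\<dots> \<le> real (Suc p) * E" using k E0 by (simp add: mult_right_mono)
      finally show "\<bar>\<Sum>i\<le>k. real (k choose i) * (hderiv i (local_bump t a) x * poly ((pderiv ^^ (k
          - i)) (P a)) x)\<bar>
          \<le> real (Suc p) * E" .
    qed
    also have "\<dots> = 2 ^ t * (real (Suc p) * E)" by simp
    also have "\<dots> \<le> 1 / \<delta> t * (real (Suc p) * E)"
      using E0 by (intro mult_right_mono two_power_le) auto
    also have "\<dots> = (real (Suc p) * 2 ^ p * M) * (b / \<delta> t ^ (p + 1))"
      unfolding E_def by simp
    finally show ?thesis .
  qed
  then show ?thesis using M(1) by (intro exI[of _ "real (Suc p) * 2 ^ p * M"]) auto
qed

text \<open>With the node set fixed, bounding each basis polynomial suffices, the constant depending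
  on the set. This handles the starting patch and the finitely many early layers.\<close>

lemma interp_deriv_rough:
  assumes "finite J"
  shows "\<exists>c\<ge>0. \<forall>f F x k. represents F f \<longrightarrow> k \<le> p \<longrightarrow> x \<in> {-R..R} \<longrightarrow>
    \<bar>interp_deriv f k x J\<bar> \<le> c * whitney_norm K r f"
proof -
  let ?X = "v ` J"
  define e where "e y = smult (1 / (\<Prod>z\<in>?X - {y}. y - z)) (nodal_poly (?X - {y}))" for y
  have "\<exists>M\<ge>0. \<forall>k\<le>p. \<forall>x\<in>{-R..R}. \<bar>hderiv k (poly (e y)) x\<bar> \<le> M" for y
    by (rule smooth_bounded_on_compact[OF smooth_poly(1)]) simp
  then obtain M where M: "\<And>y. M y \<ge> 0" "\<And>y k x. k \<le> p \<Longrightarrow> x \<in> {-R..R} \<Longrightarrow> \<bar>hderiv k (poly (e y)) x\<bar> \<le>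
      M y"
    by metis
  have "\<bar>interp_deriv f k x J\<bar> \<le> (\<Sum>y\<in>?X. M y) * whitney_norm K r f"
    if rep: "represents F f" and k: "k \<le> p" and x: "x \<in> {-R..R}" for f F x k
  proof -
    have "interp_deriv f k x J = (\<Sum>y\<in>?X. f y * hderiv k (poly (e y)) x)"
      unfolding interp_deriv_def lagrange_def e_def smooth_poly(2)
      by (simp add: higher_pderiv_sum higher_pderiv_smult poly_sum)
    also have "\<bar>\<dots>\<bar> \<le> (\<Sum>y\<in>?X. M y * whitney_norm K r f)"
    proof (rule order_trans[OF sum_abs], rule sum_mono)
      fix y assume "y \<in> ?X"
      then have yK: "y \<in> K" using v_in_K by blast
      have "\<bar>f y\<bar> \<le> whitney_norm K r f"
        using hderiv_le_whitney_norm[OF rep yK, of 0 r] rep yK by (simp add: represents_def)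
      then show "\<bar>f y * hderiv k (poly (e y)) x\<bar> \<le> M y * whitney_norm K r f"
        unfolding abs_mult mult.commute[of "M y"] using M(2)[OF k x] whitney_norm_nonneg[OF rep]
        by (intro mult_mono) auto
    qed
    finally show ?thesis by (simp add: sum_distrib_right)
  qed
  moreover have "(\<Sum>y\<in>?X. M y) \<ge> 0" by (intro sum_nonneg M(1))
  ultimately show ?thesis by blast
qed

section \<open>Layers and their decay\<close>

definition piece :: "(real \<Rightarrow> real) \<Rightarrow> nat \<Rightarrow> nat \<Rightarrow> real poly" where
  "piece f s a = lagrange f (v ` node_set s (lev s) a)"

definition layer :: "(real \<Rightarrow> real) \<Rightarrow> nat \<Rightarrow> real \<Rightarrow> real" where
  "layer f s = patch (lev s) (\<lambda>a. piece f (Suc s) a - piece f s a)"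

lemma poly_piece_diff:
  "poly ((pderiv ^^ k) (piece f (Suc s) a - piece f s a)) x =
    interp_deriv f k x (node_set (Suc s) (lev (Suc s)) a) - interp_deriv f k x (node_set s (lev s)
        a)"
  by (simp add: piece_def interp_deriv_def higher_pderiv_diff)

lemma support_bounded:
  assumes "\<bar>x - v a\<bar> \<le> 3 * C * \<delta> t"
  shows "x \<in> {-(1 + 3 * C)..1 + 3 * C}"
proof -
  have "3 * C * \<delta> t \<le> 3 * C * 1" using C_ge_1 \<delta>_le_1[of t] by (intro mult_left_mono) auto
  then have "3 * C * \<delta> t \<le> 3 * C" by simp
  then show ?thesis using assms v_range[of a] unfolding atLeastAtMost_iff by linarith
qed

lemma patch_rough:
  fixes J :: "nat \<Rightarrow> nat set"
  assumes "\<And>a. finite (J a)" "\<And>a. finite (J' a)"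
    and P: "\<And>f a k x. poly ((pderiv ^^ k) (P f a)) x = interp_deriv f k x (J a) - interp_deriv f k
        x (J' a)"
  shows "\<exists>c\<ge>0. \<forall>f F x k. represents F f \<longrightarrow> k \<le> p \<longrightarrow> \<bar>hderiv k (patch t (P f)) x\<bar> \<le> c * whitney_norm
      K r f"
proof -
  let ?R = "1 + 3 * C"
  have "\<exists>c\<ge>0. \<forall>f F x k. represents F f \<longrightarrow> k \<le> p \<longrightarrow> x \<in> {-?R..?R} \<longrightarrow>
    \<bar>poly ((pderiv ^^ k) (P f a)) x\<bar> \<le> c * whitney_norm K r f" for a
  proof -
    obtain c1 where c1: "c1 \<ge> 0" "\<And>f F x k. represents F f \<Longrightarrow> k \<le> p \<Longrightarrow> x \<in> {-?R..?R} \<Longrightarrow>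
        \<bar>interp_deriv f k x (J a)\<bar> \<le> c1 * whitney_norm K r f"
      using interp_deriv_rough[OF assms(1)[of a], of p ?R r] by blast
    obtain c2 where c2: "c2 \<ge> 0" "\<And>f F x k. represents F f \<Longrightarrow> k \<le> p \<Longrightarrow> x \<in> {-?R..?R} \<Longrightarrow>
        \<bar>interp_deriv f k x (J' a)\<bar> \<le> c2 * whitney_norm K r f"
      using interp_deriv_rough[OF assms(2)[of a], of p ?R r] by blast
    have "\<bar>poly ((pderiv ^^ k) (P f a)) x\<bar> \<le> (c1 + c2) * whitney_norm K r f"
      if "represents F f" "k \<le> p" "x \<in> {-?R..?R}" for f F x k
      unfolding P distrib_right using c1(2)[OF that] c2(2)[OF that] by linarith
    then show ?thesis using c1(1) c2(1) by (intro exI[of _ "c1 + c2"]) auto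
  qed
  then obtain c where c: "\<And>a. c a \<ge> 0" "\<And>a f F x k. represents F f \<Longrightarrow> k \<le> p \<Longrightarrow> x \<in> {-?R..?R} \<Longrightarrow>
    \<bar>poly ((pderiv ^^ k) (P f a)) x\<bar> \<le> c a * whitney_norm K r f" by metis
  define c' where "c' = (\<Sum>a<(2::nat)^t. c a)"
  have c': "c' \<ge> 0" unfolding c'_def by (intro sum_nonneg c(1))
  obtain M where M: "M \<ge> 0" "\<And>t P b x k. k \<le> p \<Longrightarrow> 0 \<le> b \<Longrightarrow>
    (\<forall>a<2^t. \<bar>x - v a\<bar> \<le> 3 * C * \<delta> t \<longrightarrow> (\<forall>i\<le>k. \<bar>poly ((pderiv ^^ i) (P a)) x\<bar> \<le> b)) \<Longrightarrow>
    \<bar>hderiv k (patch t P) x\<bar> \<le> M * (b / \<delta> t ^ (p + 1))"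
    using patch_bound[of p] by blast
  have "\<bar>hderiv k (patch t (P f)) x\<bar> \<le> M * (c' / \<delta> t ^ (p + 1)) * whitney_norm K r f"
    if rep: "represents F f" and k: "k \<le> p" for f F x k
  proof -
    note n0 = whitney_norm_nonneg[OF rep, of r]
    have "\<bar>hderiv k (patch t (P f)) x\<bar> \<le> M * (c' * whitney_norm K r f / \<delta> t ^ (p + 1))"
    proof (rule M(2)[OF k])
      show "0 \<le> c' * whitney_norm K r f" using c' n0 by simp
      show "\<forall>a<2^t. \<bar>x - v a\<bar> \<le> 3 * C * \<delta> t \<longrightarrow>
          (\<forall>i\<le>k. \<bar>poly ((pderiv ^^ i) (P f a)) x\<bar> \<le> c' * whitney_norm K r f)"
      proof (intro allI impI)
        fix a i :: nat
        assume a: "a < 2 ^ t" and x: "\<bar>x - v a\<bar> \<le> 3 * C * \<delta> t" and i: "i \<le> k"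
        have "\<bar>poly ((pderiv ^^ i) (P f a)) x\<bar> \<le> c a * whitney_norm K r f"
          by (rule c(2)[OF rep _ support_bounded[OF x]]) (use i k in simp)
        also have "\<dots> \<le> c' * whitney_norm K r f"
          unfolding c'_def using a c(1) n0 by (intro mult_right_mono member_le_sum) auto
        finally show "\<bar>poly ((pderiv ^^ i) (P f a)) x\<bar> \<le> c' * whitney_norm K r f" .
      qed
    qed
    then show ?thesis by (simp add: mult.assoc)
  qed
  moreover have "M * (c' / \<delta> t ^ (p + 1)) \<ge> 0" using M(1) c' \<delta>_pos[of t] by simp
  ultimately show ?thesis by blast
qed

lemma layer_rough:
  "\<exists>c\<ge>0. \<forall>f F x k. represents F f \<longrightarrow> k \<le> p \<longrightarrow> \<bar>hderiv k (layer f s) x\<bar> \<le> c * whitney_norm K r f"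
  unfolding layer_def
  by (rule patch_rough[of "node_set (Suc s) (lev (Suc s))" "node_set s (lev s)"])
    (auto simp: poly_piece_diff simp del: funpow.simps)

lemma start_rough:
  "\<exists>c\<ge>0. \<forall>f F x k. represents F f \<longrightarrow> k \<le> p \<longrightarrow> \<bar>hderiv k (patch (lev s) (piece f s)) x\<bar> \<le> c *
      whitney_norm K r f"
  by (rule patch_rough[of "node_set s (lev s)" "\<lambda>a. {}"])
    (auto simp: piece_def interp_deriv_def lagrange_def)

definition weight_condition :: bool where
  "weight_condition \<longleftrightarrow> (\<forall>\<epsilon>>0. \<exists>n0. \<forall>n\<ge>n0. \<forall>s\<ge>1. weight (n + s) < \<epsilon> * (\<Sum>k=s..n+s. weight k))"

lemma blen_unbounded: "2 ^ l \<le> s \<Longrightarrow> l + 1 \<le> blen s"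
  using blen_le_iff[of s l] by simp

text \<open>All losses (number of steps, powers of the number of nodes, \<open>C\<close>-factors, derivatives of the
  bumps) are fixed powers of \<open>1 / \<delta> t\<close>, because there are only \<open>O(s)\<close> nodes at level \<open>s\<close>.\<close>

lemma layer_decay:
  assumes "weight_condition"
  shows "\<exists>r c s1. c \<ge> 0 \<and> (\<forall>s\<ge>s1. \<forall>f F x k. represents F f \<longrightarrow> k \<le> p \<longrightarrow>
    \<bar>hderiv k (layer f s) x\<bar> \<le> c * (1 / 32) ^ s * whitney_norm K r f)"
proof -
  obtain D :: nat where D: "16 * C \<le> 32 ^ D"
    using real_arch_pow[of 32 "16 * C"] by (auto intro: less_imp_le)
  \<comment> \<open>Powers of \<open>1 / \<delta> t\<close>: 1 for the number of chain steps,
    \<open>2 * p\<close> for node counts and derivatives, \<open>4 * D\<close> for the constants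
    \<open>16 * C\<close>. In \<open>P\<close>, a further \<open>p + 1\<close> pays for
    \<open>patch_bound\<close> and the last factor \<open>\<delta> t\<close> is left for
    convergence.\<close>
  define e where "e = 1 + 2 * p + 4 * D"
  define P where "P = e + p + 2"
  have "1 / real (2 * P) > 0" by (simp add: P_def)
  then obtain n0 where n0: "\<And>n s. n \<ge> n0 \<Longrightarrow> s \<ge> 1 \<Longrightarrow>
      weight (n + s) < 1 / real (2 * P) * (\<Sum>k=s..n+s. weight k)"
    using assms unfolding weight_condition_def by blast
  define m where "m = max n0 3"
  define r :: nat where "r = 2 ^ m"
  obtain cr where cr: "cr \<ge> 0" "\<And>f F X. represents F f \<Longrightarrow> X \<subseteq> K \<Longrightarrow> finite X \<Longrightarrow> card X = Suc r \<Longrightarrow>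
    \<bar>divdiff f X\<bar> \<le> cr * whitney_norm K r f"
    using divdiff_le_whitney_norm[of r] by blast
  obtain M where M: "M \<ge> 0" "\<And>t P b x k. k \<le> p \<Longrightarrow> 0 \<le> b \<Longrightarrow>
    (\<forall>a<2^t. \<bar>x - v a\<bar> \<le> 3 * C * \<delta> t \<longrightarrow> (\<forall>i\<le>k. \<bar>poly ((pderiv ^^ i) (P a)) x\<bar> \<le> b)) \<Longrightarrow>
    \<bar>hderiv k (patch t P) x\<bar> \<le> M * (b / \<delta> t ^ (p + 1))"
    using patch_bound[of p] by blast
  have "\<bar>hderiv k (layer f s) x\<bar> \<le> (M * 8 * cr) * (1 / 32) ^ s * whitney_norm K r f"
    if s: "s \<ge> 2 ^ m + 4" and rep: "represents F f" and k: "k \<le> p" for s f F x k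
  proof -
    define A where "A = cr * whitney_norm K r f"
    have A: "A \<ge> 0" unfolding A_def using cr(1) whitney_norm_nonneg[OF rep] by simp
    define t where "t = lev s"
    define E where "E = 1 / \<delta> t"
    have E1: "E \<ge> 1" unfolding E_def using \<delta>_pos[of t] \<delta>_le_1[of t] by simp
    have E\<delta>: "E * \<delta> t = 1" unfolding E_def using \<delta>_pos[of t] by simp
    have s1: "s \<ge> 1" using s by simp
    have mb: "m + 1 \<le> blen s" by (rule blen_unbounded) (use s in simp)
    have st: "s \<le> t" "m + 1 \<le> t" using mb by (auto simp: t_def lev_def)
    have E32: "32 ^ s \<le> E"
    proof -
      have "\<delta> t \<le> (1 / 32) ^ t" by (rule \<delta>_le_power)
      also have "\<dots> \<le> (1 / 32) ^ s" using st by (intro power_decreasing) auto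
      finally have "32 ^ s * \<delta> t \<le> 32 ^ s * (1 / 32) ^ s" by (intro mult_left_mono) auto
      also have "\<dots> = 1" by (simp flip: power_mult_distrib)
      finally show ?thesis unfolding E_def using \<delta>_pos[of t] by (simp add: pos_le_divide_eq)
    qed
    define R where "R = (\<Prod>i<2^m. \<delta> (t - blen i))"
    have R: "0 \<le> R" "R \<le> \<delta> t ^ P"
    proof -
      show "0 \<le> R" unfolding R_def by (intro prod_nonneg) (auto simp: less_imp_le[OF \<delta>_pos])
      \<comment> \<open>Uniformity of the condition enters here: \<open>m\<close> is fixed while the
        initial level \<open>t - m\<close> grows with the layer.\<close>
      have "weight (m + (t - m)) < 1 / real (2 * P) * (\<Sum>k=t-m..m+(t-m). weight k)"
        by (rule n0) (use st in \<open>auto simp: m_def\<close>)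
      then have "real (2 * P) * weight t \<le> (\<Sum>k=t-m..t. weight k)"
        using st by (simp add: P_def field_simps less_imp_le)
      then show "R \<le> \<delta> t ^ P"
        unfolding R_def using st by (intro prod_blen_le_power) auto
    qed
    have s4: "real (4 * s) \<le> E"
    proof -
      have "4 * s \<le> 2 * 2 ^ s + 2 * 2 ^ s" using less_exp[of s] by linarith
      also have "\<dots> = 4 * 2 ^ s" by simp
      also have "\<dots> \<le> 2 ^ s * 2 ^ s"
        using power_increasing[of 2 s "2 :: nat"] s by simp
      also have "\<dots> = 4 ^ s" by (simp flip: power_mult_distrib)
      finally have "real (4 * s) \<le> real (4 ^ s)" by (simp only: of_nat_le_iff)
      also have "\<dots> \<le> 32 ^ s" by (simp add: power_mono)
      finally show ?thesis using E32 by linarith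
    qed
    have Cs: "(16 * C) ^ (4 * s) \<le> E ^ (4 * D)"
    proof -
      have "(16 * C) ^ (4 * s) \<le> (32 ^ D) ^ (4 * s)" using C_ge_1 by (intro power_mono[OF D]) simp
      also have "\<dots> = (32 ^ s) ^ (4 * D)" by (simp only: power_mult[symmetric] mult_ac)
      also have "\<dots> \<le> E ^ (4 * D)" by (intro power_mono[OF E32]) simp
      finally show ?thesis .
    qed
    define b where "b = 8 * A * \<delta> t ^ (p + 2)"
    have b0: "b \<ge> 0" unfolding b_def using A \<delta>_pos[of t] by simp
    have "\<bar>hderiv k (layer f s) x\<bar> \<le> M * (b / \<delta> t ^ (p + 1))"
      unfolding layer_def t_def[symmetric]
    proof (rule M(2)[OF k b0], intro allI impI)
      fix a i :: nat
      assume x: "\<bar>x - v a\<bar> \<le> 3 * C * \<delta> t" and i: "i \<le> k"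
      have "\<bar>poly ((pderiv ^^ i) (piece f (Suc s) a - piece f s a)) x\<bar> \<le>
          8 * 2 ^ t * (real (4 * s) ^ i / \<delta> t ^ i * (A * (16 * C) ^ (4 * s) * R))"
        unfolding poly_piece_diff t_def R_def
      proof (rule interp_deriv_increment[OF s1 _ mb])
        show "\<bar>divdiff f Z\<bar> \<le> A" if "Z \<subseteq> K" "finite Z" "card Z = Suc (2 ^ m)" for Z
          unfolding A_def using cr(2)[OF rep that(1,2)] that(3) by (simp add: r_def)
      qed (use A x in \<open>auto simp: m_def t_def\<close>)
      also have "\<dots> \<le> 8 * E * (E ^ i * E ^ i * (A * E ^ (4 * D) * \<delta> t ^ P))"
      proof -
        have "real (4 * s) ^ i / \<delta> t ^ i \<le> E ^ i * E ^ i"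
        proof -
          have "real (4 * s) ^ i / \<delta> t ^ i = real (4 * s) ^ i * E ^ i"
            by (simp add: E_def power_one_over)
          also have "\<dots> \<le> E ^ i * E ^ i" using E1 by (intro mult_right_mono power_mono s4) auto
          finally show ?thesis .
        qed
        moreover have "A * (16 * C) ^ (4 * s) * R \<le> A * E ^ (4 * D) * \<delta> t ^ P"
          using A Cs R C_ge_1 E1 by (intro mult_mono mult_left_mono) auto
        ultimately have "real (4 * s) ^ i / \<delta> t ^ i * (A * (16 * C) ^ (4 * s) * R) \<le>
            E ^ i * E ^ i * (A * E ^ (4 * D) * \<delta> t ^ P)"
          by (rule mult_mono) (use A R C_ge_1 E1 in auto)
        moreover have "8 * 2 ^ t \<le> 8 * E" using two_power_le[of t] by (simp add: E_def)
        ultimately show ?thesis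
          using A R C_ge_1 E1 \<delta>_pos[of t] by (intro mult_mono[of "8 * 2 ^ t"]) auto
      qed
      also have "\<dots> = 8 * A * (E ^ (1 + 2 * i + 4 * D) * \<delta> t ^ P)"
      proof -
        have "E ^ (1 + 2 * i + 4 * D) = E * (E ^ i * E ^ i) * E ^ (4 * D)"
          by (simp only: mult_2[of i] power_add power_one_right)
        then show ?thesis by (simp only: mult_ac)
      qed
      also have "\<dots> \<le> 8 * A * (E ^ e * \<delta> t ^ P)"
        using A E1 i k \<delta>_pos[of t] unfolding e_def
        by (intro mult_left_mono mult_right_mono power_increasing) auto
      also have "E ^ e * \<delta> t ^ P = \<delta> t ^ (p + 2)"
      proof -
        have "E ^ e * \<delta> t ^ P = (E * \<delta> t) ^ e * \<delta> t ^ (p + 2)"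
          unfolding P_def by (simp only: add.assoc power_add power_mult_distrib mult.assoc)
        then show ?thesis by (simp add: E\<delta>)
      qed
      finally show "\<bar>poly ((pderiv ^^ i) (piece f (Suc s) a - piece f s a)) x\<bar> \<le> b"
        by (simp add: b_def)
    qed
    also have "b / \<delta> t ^ (p + 1) = 8 * A * \<delta> t"
      using \<delta>_pos[of t] by (simp add: b_def)
    also have "M * (8 * A * \<delta> t) \<le> M * (8 * A * (1 / 32) ^ s)"
    proof -
      have "\<delta> t \<le> (1 / 32) ^ s"
        using \<delta>_antimono[OF st(1)] \<delta>_le_power[of s] by linarith
      then show ?thesis using M(1) A by (intro mult_left_mono) auto
    qed
    finally show ?thesis by (simp add: A_def mult_ac)
  qed
  moreover have "M * 8 * cr \<ge> 0" using M(1) cr(1) by simp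
  ultimately show ?thesis by blast
qed

text \<open>The finitely many layers before \<open>s1\<close> are absorbed into the constant by
  \<open>layer_rough\<close>; the factor \<open>32 ^ s\<close> compensates the decay demanded of
  them.\<close>

lemma layer_estimate:
  assumes "weight_condition"
  shows "\<exists>r c. c \<ge> 0 \<and> (\<forall>s f F x k. represents F f \<longrightarrow> k \<le> p \<longrightarrow>
    \<bar>hderiv k (layer f s) x\<bar> \<le> c * (1 / 32) ^ s * whitney_norm K r f)"
proof -
  obtain r c s1 where c: "c \<ge> 0" "\<And>s f F x k. s \<ge> s1 \<Longrightarrow> represents F f \<Longrightarrow> k \<le> p \<Longrightarrow>
    \<bar>hderiv k (layer f s) x\<bar> \<le> c * (1 / 32) ^ s * whitney_norm K r f"
    using layer_decay[OF assms, of p] by blast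
  obtain d where d: "\<And>s. d s \<ge> 0" "\<And>s f F x k. represents F f \<Longrightarrow> k \<le> p \<Longrightarrow>
    \<bar>hderiv k (layer f s) x\<bar> \<le> d s * whitney_norm K r f"
    using layer_rough[of p _ r] by metis
  define c' where "c' = c + (\<Sum>s<s1. d s * 32 ^ s)"
  have sum0: "(\<Sum>s<s1. d s * 32 ^ s) \<ge> 0" by (intro sum_nonneg mult_nonneg_nonneg d(1)) auto
  have "\<bar>hderiv k (layer f s) x\<bar> \<le> c' * (1 / 32) ^ s * whitney_norm K r f"
    if rep: "represents F f" and k: "k \<le> p" for s f F x k
  proof (cases "s \<ge> s1")
    case True
    have "c * (1 / 32) ^ s * whitney_norm K r f \<le> c' * (1 / 32) ^ s * whitney_norm K r f"
      using sum0 whitney_norm_nonneg[OF rep] by (intro mult_right_mono) (auto simp: c'_def)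
    then show ?thesis using c(2)[OF True rep k, of x] by linarith
  next
    case False
    have "d s * 32 ^ s \<le> (\<Sum>s<s1. d s * 32 ^ s)"
      using False d(1) by (intro member_le_sum) auto
    then have "d s * 32 ^ s * (1 / 32) ^ s \<le> c' * (1 / 32) ^ s"
      using c(1) by (intro mult_right_mono) (auto simp: c'_def)
    then have "d s \<le> c' * (1 / 32) ^ s" by (simp add: mult.assoc flip: power_mult_distrib)
    then have "d s * whitney_norm K r f \<le> c' * (1 / 32) ^ s * whitney_norm K r f"
      using whitney_norm_nonneg[OF rep] by (intro mult_right_mono) auto
    then show ?thesis using d(2)[OF rep k, of s x] by linarith
  qed
  moreover have "c' \<ge> 0" using c(1) sum0 by (simp add: c'_def)
  ultimately show ?thesis by blast
qed

section \<open>The extension operator\<close>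

definition ext_op :: "nat \<Rightarrow> (real \<Rightarrow> real) \<Rightarrow> real \<Rightarrow> real" where
  "ext_op s0 f x = patch (lev s0) (piece f s0) x + (\<Sum>n. layer f (s0 + n) x)"

lemma patch_node:
  assumes "6 * C * \<delta> (Suc t) \<le> \<delta> t"
  shows "patch (Suc t) P (v i) = poly (P (i mod 2 ^ Suc t)) (v i)"
proof -
  have "patch (Suc t) P (v i) = (\<Sum>a<2^Suc t. if a = i mod 2 ^ Suc t then poly (P a) (v i) else 0)"
    unfolding patch_def by (rule sum.cong) (auto simp: local_bump_node[OF assms] simp del:
        power_Suc)
  also have "\<dots> = poly (P (i mod 2 ^ Suc t)) (v i)"
    by (subst sum.delta) (auto simp del: power_Suc)
  finally show ?thesis .
qed

text \<open>At a coded point the patch picks the representative modulo \<open>2 ^ t\<close>; since a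
  piece depends only on the class modulo \<open>2 ^ s\<close>, this is the piece of the point
  itself.\<close>

lemma piece_mod: "s \<le> t \<Longrightarrow> piece f s (i mod 2 ^ t) = piece f s i"
  unfolding piece_def node_set_def by (simp add: mod_mod_cancel le_imp_power_dvd)

lemma smooth_layer: "layer f s \<in> smooth_functions"
  unfolding layer_def by (rule smooth_patch(1))

lemma summable_geometric_shift: "summable (\<lambda>n. (1 / 32 :: real) ^ (s0 + n))"
  unfolding power_add by (intro summable_mult summable_geometric) simp

lemma
  assumes wc: weight_condition and rep: "represents F f"
  shows smooth_layers: "(\<lambda>x. \<Sum>n. layer f (s0 + n) x) \<in> smooth_functions"
    and hderiv_layers: "hderiv k (\<lambda>x. \<Sum>n. layer f (s0 + n) x) = (\<lambda>x. \<Sum>n. hderiv k (layer f (s0 +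
        n)) x)"
    and summable_layers: "summable (\<lambda>n. layer f (s0 + n) x)"
proof -
  have "\<forall>p. \<exists>r c. c \<ge> 0 \<and> (\<forall>s x. \<bar>hderiv p (layer f s) x\<bar> \<le> c * (1 / 32) ^ s * whitney_norm K r f)"
    using layer_estimate[OF wc] rep by (meson order_refl)
  then obtain r c where c: "\<And>p s x. \<bar>hderiv p (layer f s) x\<bar> \<le> c p * (1 / 32) ^ s * whitney_norm K
      (r p) f"
    by metis
  let ?b = "\<lambda>k n. c k * (1 / 32) ^ (s0 + n) * whitney_norm K (r k) f"
  have summ: "summable (?b k)" for k
    by (intro summable_mult2 summable_mult summable_geometric_shift)
  show "(\<lambda>x. \<Sum>n. layer f (s0 + n) x) \<in> smooth_functions"
    by (rule smooth_suminf(1)[OF smooth_layer c summ])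
  show "hderiv k (\<lambda>x. \<Sum>n. layer f (s0 + n) x) = (\<lambda>x. \<Sum>n. hderiv k (layer f (s0 + n)) x)"
    by (rule smooth_suminf(2)[OF smooth_layer c summ])
  show "summable (\<lambda>n. layer f (s0 + n) x)"
    by (rule summable_comparison_test'[OF summ[of 0], of 0]) (use c[of 0] in simp)
qed

lemma smooth_ext_op:
  assumes weight_condition "represents F f"
  shows "ext_op s0 f \<in> smooth_functions"
    and "hderiv k (ext_op s0 f) x =
      hderiv k (patch (lev s0) (piece f s0)) x + (\<Sum>n. hderiv k (layer f (s0 + n)) x)"
  unfolding ext_op_def[abs_def] smooth_add(2)[OF smooth_patch(1) smooth_layers[OF assms]]
    hderiv_layers[OF assms]
  by (rule smooth_add(1)[OF smooth_patch(1) smooth_layers[OF assms]], rule refl)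

lemma ext_op_estimate:
  assumes wc: weight_condition
  shows "\<exists>r D. \<forall>f\<in>whitney_functions K. smooth_seminorm q (ext_op s0 f) \<le> D * whitney_norm K r f"
proof -
  obtain r c where c: "c \<ge> 0" "\<And>s f F x k. represents F f \<Longrightarrow> k \<le> q \<Longrightarrow>
    \<bar>hderiv k (layer f s) x\<bar> \<le> c * (1 / 32) ^ s * whitney_norm K r f"
    using layer_estimate[OF wc, of q] by blast
  obtain d where d: "\<And>f F x k. represents F f \<Longrightarrow> k \<le> q \<Longrightarrow>
    \<bar>hderiv k (patch (lev s0) (piece f s0)) x\<bar> \<le> d * whitney_norm K r f"
    using start_rough[of q s0 r] by blast
  let ?S = "\<Sum>n. (1 / 32 :: real) ^ (s0 + n)"
  have "smooth_seminorm q (ext_op s0 f) \<le> (d + c * ?S) * whitney_norm K r f"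
    if f: "f \<in> whitney_functions K" for f
  proof (rule smooth_seminorm_least)
    fix k x assume k: "k \<le> q"
    obtain F where rep: "represents F f" using f unfolding whitney_functions_iff by blast
    let ?b = "\<lambda>n. c * (1 / 32) ^ (s0 + n) * whitney_norm K r f"
    have summ: "summable ?b"
      by (intro summable_mult2 summable_mult summable_geometric_shift)
    have "\<bar>\<Sum>n. hderiv k (layer f (s0 + n)) x\<bar> \<le> (\<Sum>n. ?b n)"
      using norm_suminf_le[OF _ summ, of "\<lambda>n. hderiv k (layer f (s0 + n)) x"] c(2)[OF rep k] by simp
    also have "(\<Sum>n. ?b n) = c * ?S * whitney_norm K r f"
      by (simp only: suminf_mult2[OF summable_mult[OF summable_geometric_shift], symmetric]
          suminf_mult[OF summable_geometric_shift])
    finally show "\<bar>hderiv k (ext_op s0 f) x\<bar> \<le> (d + c * ?S) * whitney_norm K r f"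
      unfolding smooth_ext_op(2)[OF wc rep] distrib_right using d[OF rep k, of x] by linarith
  qed
  then show ?thesis by blast
qed

lemma linear_ext_op:
  assumes wc: weight_condition
  shows "linear_op (ext_op s0)"
  unfolding linear_op_def
proof (intro ballI allI ext)
  fix f g a b x
  assume "f \<in> whitney_functions K" "g \<in> whitney_functions K"
  then obtain F G where F: "represents F f" and G: "represents G g" unfolding
      whitney_functions_iff by blast
  let ?h = "\<lambda>x. a * f x + b * g x"
  have piece: "piece ?h s i = smult a (piece f s i) + smult b (piece g s i)" for s i
    unfolding piece_def by (rule lagrange_lincomb)
  have patch: "patch t (\<lambda>i. smult a (P i) + smult b (Q i)) x = a * patch t P x + b * patch t Q x"
      for t P Q
    unfolding patch_def sum_distrib_left sum.distrib[symmetric]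
    by (rule sum.cong) (simp_all add: algebra_simps)
  have start: "patch (lev s0) (piece ?h s0) x = a * patch (lev s0) (piece f s0) x + b * patch (lev
      s0) (piece g s0) x"
  proof -
    have "piece ?h s0 = (\<lambda>i. smult a (piece f s0 i) + smult b (piece g s0 i))"
      by (simp only: fun_eq_iff piece) simp
    then show ?thesis by (simp only: patch)
  qed
  have layer: "layer ?h s x = a * layer f s x + b * layer g s x" for s
  proof -
    have "piece ?h (Suc s) i - piece ?h s i =
        smult a (piece f (Suc s) i - piece f s i) + smult b (piece g (Suc s) i - piece g s i)" for i
      by (simp add: piece smult_diff_right)
    then show ?thesis unfolding layer_def by (simp only: patch)
  qed
  have "(\<Sum>n. layer ?h (s0 + n) x) = a * (\<Sum>n. layer f (s0 + n) x) + b * (\<Sum>n. layer g (s0 + n) x)"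
    unfolding layer
    by (simp only: suminf_mult[OF summable_layers[OF wc F], symmetric]
        suminf_mult[OF summable_layers[OF wc G], symmetric]
        suminf_add[OF summable_mult[OF summable_layers[OF wc F]] summable_mult[OF
            summable_layers[OF wc G]]])
  then show "ext_op s0 ?h x = a * ext_op s0 f x + b * ext_op s0 g x"
    unfolding ext_op_def start by (simp add: algebra_simps)
qed

text \<open>At \<open>v i\<close> the layers telescope, and the interpolants have \<open>v i\<close>
  among their nodes as soon as \<open>i < 2 ^ lev s\<close>. Continuity carries the equality from
  the coded points to all of \<open>K\<close>.\<close>

lemma ext_op_extends:
  assumes wc: weight_condition and s0: "s0 \<ge> 1"
    and sep: "\<And>t. Suc t \<ge> s0 \<Longrightarrow> 6 * C * \<delta> (Suc t) \<le> \<delta> t"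
    and f: "f \<in> whitney_functions K" and x: "x \<in> K"
  shows "ext_op s0 f x = f x"
proof -
  obtain F where rep: "represents F f" using f unfolding whitney_functions_iff by blast
  have F: "F \<in> smooth_functions" "\<And>t. t \<in> K \<Longrightarrow> F t = f t" using rep by (auto simp: represents_def)
  have node: "ext_op s0 f (v i) = F (v i)" for i
  proof -
    define g where "g n = poly (piece f (s0 + n) i) (v i)" for n
    \<comment> \<open>The classes of the patch must be at least as fine as those modulo
      \<open>2 ^ Suc s\<close>, because the next piece occurs in the same layer.\<close>
    have lev: "Suc s \<le> lev s" if "s \<ge> s0" for s
      using blen_le_iff[of s 0] that s0 by (simp add: lev_def)
    have node_patch: "patch (lev s) P (v i) = poly (P (i mod 2 ^ lev s)) (v i)" if s: "s \<ge> s0" for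
        s P
    proof -
      obtain t where t: "lev s = Suc t" using lev[OF s] by (cases "lev s") auto
      show ?thesis unfolding t by (rule patch_node[OF sep]) (use lev[OF s] s t in simp)
    qed
    have "layer f (s0 + n) (v i) = g (Suc n) - g n" for n
      unfolding layer_def g_def using node_patch[of "s0 + n"] lev[of "s0 + n"]
      by (simp add: piece_mod)
    moreover have "g \<longlonglongrightarrow> f (v i)"
    proof (rule tendsto_eventually)
      have "g n = f (v i)" if "n \<ge> i" for n
      proof -
        have "i < 2 ^ i" by (rule less_exp)
        also have "\<dots> \<le> 2 ^ lev (s0 + n)" using that by (intro power_increasing) (auto simp: lev_def)
        finally have "i \<in> node_set (s0 + n) (lev (s0 + n)) i" by (simp add: node_set_def)
        then show ?thesis unfolding g_def piece_def by (intro poly_lagrange_node) auto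
      qed
      then show "eventually (\<lambda>n. g n = f (v i)) sequentially"
        unfolding eventually_sequentially by blast
    qed
    ultimately have "(\<lambda>n. layer f (s0 + n) (v i)) sums (f (v i) - g 0)"
      by (simp only: telescope_sums)
    then have "(\<Sum>n. layer f (s0 + n) (v i)) = f (v i) - g 0" by (rule sums_unique[symmetric])
    moreover have "patch (lev s0) (piece f s0) (v i) = g 0"
      using node_patch[of s0] lev[of s0] by (simp add: g_def piece_mod)
    ultimately show ?thesis using F(2)[OF v_in_K] by (simp add: ext_op_def)
  qed
  have "continuous_on UNIV (ext_op s0 f)" "continuous_on UNIV F"
    using smooth_continuous_on[OF smooth_ext_op(1)[OF wc rep], of UNIV 0]
      smooth_continuous_on[OF F(1), of UNIV 0] by simp_all
  then have "closed {x. ext_op s0 f x = F x}" by (rule closed_Collect_eq)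
  moreover have "range v \<subseteq> {x. ext_op s0 f x = F x}" using node by auto
  ultimately have "K \<subseteq> {x. ext_op s0 f x = F x}"
    unfolding K_closure by (rule closure_minimal[rotated])
  then show ?thesis using x F(2) by auto
qed

lemma extension_property_iff: "extension_property K \<longleftrightarrow> weight_condition"
proof
  assume "extension_property K"
  then obtain W where "continuous_map (whitney_topology K) smooth_topology W" "linear_op W"
    "\<And>f x. f \<in> whitney_functions K \<Longrightarrow> x \<in> K \<Longrightarrow> W f x = f x"
    unfolding extension_property_def linear_op_def by blast
  then show weight_condition
    unfolding weight_condition_def using weight_condition_necessary by blast
next
  assume wc: weight_condition
  obtain T where T: "\<And>t. t \<ge> T \<Longrightarrow> 6 * C * \<delta> (Suc t) \<le> \<delta> t"
    using eventually_separated[of "6 * C"] C_ge_1 by auto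
  define s0 where "s0 = Suc T"
  have "continuous_map (whitney_topology K) smooth_topology (ext_op s0)"
  proof (rule continuous_if_estimate[OF linear_ext_op[OF wc] _ ext_op_estimate[OF wc]])
    fix f assume "f \<in> whitney_functions K"
    then show "ext_op s0 f \<in> smooth_functions"
      using smooth_ext_op(1)[OF wc] unfolding whitney_functions_iff by blast
  qed
  moreover have "\<forall>f\<in>whitney_functions K. \<forall>x\<in>K. ext_op s0 f x = f x"
    using ext_op_extends[OF wc, of s0] T by (simp add: s0_def)
  ultimately show "extension_property K"
    using linear_ext_op[OF wc, of s0] unfolding extension_property_def linear_op_def by blast
qed

end

theorem theorem5p3:
  fixes \<gamma> :: "nat \<Rightarrow> real"
  assumes "\<And>s. s \<ge> 1 \<Longrightarrow> 0 < \<gamma> s \<and> \<gamma> s \<le> 1 / 32"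
    and "summable (\<lambda>s. \<gamma> (Suc s))"
  shows "extension_property (cantor_K \<gamma>) \<longleftrightarrow>
    uniform_limit {1..} (\<lambda>n s. B \<gamma> (n + s) / (\<Sum>k=s..n+s. B \<gamma> k)) (\<lambda>_. 0) sequentially"
proof -
  interpret cantor_coding "cantor_K \<gamma>" "code_point \<gamma> 0" "delta \<gamma>" "exp (8 * (\<Sum>s. \<gamma> (Suc s)))"
    by (rule cantor_coding_cantor_K[OF assms])
  have B: "B \<gamma> = weight" by (simp add: fun_eq_iff B_def weight_def)
  have "dist (weight (n + s) / (\<Sum>k=s..n+s. weight k)) 0 < \<epsilon> \<longleftrightarrow>
      weight (n + s) < \<epsilon> * (\<Sum>k=s..n+s. weight k)" if "s \<ge> 1" for n s \<epsilon>
  proof -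
    \<comment> \<open>Starting at \<open>s \<ge> 1\<close> makes all summands positive;
      \<open>weight 0\<close> would be 0, since \<open>\<delta>_0\<close> fixes the initial scale at
      1.\<close>
    have "(\<Sum>k=s..n+s. weight k) > 0"
      using that by (intro sum_pos weight_pos) auto
    then show ?thesis
      using weight_nonneg[of "n + s"] by (simp add: dist_real_def pos_divide_less_eq)
  qed
  then have "uniform_limit {1..} (\<lambda>n s. B \<gamma> (n + s) / (\<Sum>k=s..n+s. B \<gamma> k)) (\<lambda>_. 0) sequentially \<longleftrightarrow>
      weight_condition"
    unfolding uniform_limit_iff weight_condition_def B eventually_sequentially by (simp add:
        Ball_def)
  then show ?thesis using extension_property_iff by simp
qed

end
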